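(* Let $(R,\mathfrak{m})$ be an Artinian local ring of length $l$. Then there exists an Artinian local Gorenstein ring $(S,\mathfrak{n})$ of the same length $l$ with an algebraically closed residue field, such that $R$ is a subring of $S$ (i.e., $R$ embeds in $S$ as a ring).
   Context: Rings are commutative with identity. The length of a ring is its length as a module over itself. An Artinian local ring is Gorenstein if its socle (the annihilator of the maximal ideal) is a principal ideal. *)

theory Defs
  imports "HOL-Algebra.Algebra" "HOL-Library.Extended_Nat"
begin

locale artinian_ring = cring R for R (structure) +
  assumes descending_chain_stationary:
    "\<And>I :: nat \<Rightarrow> 'a set.
       \<lbrakk> \<And>i. ideal (I i) R; \<And>i. I (Suc i) \<subseteq> I i \<rbrakk> \<Longrightarrow> \<exists>n. \<forall>i\<ge>n. I i = I n"

locale local_ring = cring R for R (structure) and \<mm> +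
  assumes maximal: "maximalideal \<mm> R"
    and unique_maximal: "\<And>J. maximalideal J R \<Longrightarrow> J = \<mm>"

locale artinian_local_ring = artinian_ring R + local_ring R \<mm> for R (structure) and \<mm>

definition annihilator :: "('a, 'm) ring_scheme \<Rightarrow> 'a set \<Rightarrow> 'a set"
  where "annihilator R I = {a \<in> carrier R. \<forall>x\<in>I. a \<otimes>\<^bsub>R\<^esub> x = \<zero>\<^bsub>R\<^esub>}"

locale artinian_local_gorenstein_ring = artinian_local_ring R \<mm> for R (structure) and \<mm> +
  assumes socle_principal: "principalideal (annihilator R \<mm>) R"

text \<open>The length of a module is the supremum of the lengths of the strictly increasing
  chains \<open>N 0 \<subset> \<dots> \<subset> N n\<close> of submodules; it takes the value \<open>\<infinity>\<close> if they are unbounded.\<close>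

definition module_length ::
    "('a, 'm) ring_scheme \<Rightarrow> ('a, 'b, 'k) module_scheme \<Rightarrow> enat"
  where "module_length R M =
    (SUP n \<in> {n. \<exists>N :: nat \<Rightarrow> 'b set.
                   (\<forall>i\<le>n. submodule (N i) R M) \<and> (\<forall>i<n. N i \<subset> N (Suc i))}. enat n)"

definition self_module :: "('a, 'm) ring_scheme \<Rightarrow> ('a, 'a) module"
  where "self_module R =
    \<lparr>carrier = carrier R, monoid.mult = (\<otimes>\<^bsub>R\<^esub>), one = \<one>\<^bsub>R\<^esub>,
     ring.zero = \<zero>\<^bsub>R\<^esub>, ring.add = (\<oplus>\<^bsub>R\<^esub>), smult = (\<otimes>\<^bsub>R\<^esub>)\<rparr>"

lemma (in cring) self_module_is_module: "module R (self_module R)"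
proof (rule moduleI)
  show "abelian_group (self_module R)"
    by (rule abelian_groupI)
       (auto simp: self_module_def a_ac intro: add.l_inv_ex)
qed (auto simp: self_module_def l_distr r_distr m_assoc is_cring)

lemma (in cring) submodule_self_module_iff: "submodule I R (self_module R) \<longleftrightarrow> ideal I R"
proof -
  have "subgroup I (add_monoid (self_module R)) \<longleftrightarrow> subgroup I (add_monoid R)"
    by (simp add: self_module_def subgroup_def m_inv_def)
  moreover have "a \<in> carrier R" if "subgroup I (add_monoid R)" "a \<in> I" for a
    using subgroup.subset[OF that(1)] that(2) by auto
  ultimately show ?thesis
    by (auto simp: submodule_def submodule_axioms_def ideal_def ideal_axioms_def
        additive_subgroup_def self_module_def ring_axioms)
       (metis m_comm)
qed

definition ring_length :: "('a, 'm) ring_scheme \<Rightarrow> enat"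
  where "ring_length R = module_length R (self_module R)"

end

theory Submission
  imports Defs "HOL-Algebra.UnivPoly"
begin

text \<open>
  An Artinian local ring of length \<open>l\<close> has elements \<open>a 0, \<dots>, a (l - 1)\<close> such that every non-unit
  multiplies \<open>a i\<close> into the ideal generated by \<open>a 0, \<dots>, a (i - 1)\<close>, and such that all of them
  generate the unit ideal. Such a flag bounds the length by \<open>l\<close>, makes the ring local and passes to
  quotients, to ultrapowers, to unions of chains, and to \<open>S[X]/(f)\<close> for \<open>f\<close> monic with irreducible
  reduction. Hence \<open>R\<close> embeds into a ring \<open>S\<close> of length at most \<open>l\<close> whose residue field \<open>L\<close> is
  algebraically closed and larger than \<open>R\<close>: for infinite \<open>R\<close> an ultrapower over a regular
  ultrafilter supplies the cardinality; Zorn's lemma supplies the algebraic closedness.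

  Divide \<open>S\<close> by an ideal maximal with respect to meeting \<open>R\<close> in \<open>0\<close>. Every nonzero ideal of the
  quotient \<open>T\<close> meets \<open>R\<close>. If the socle of \<open>T\<close> contained two independent elements, it would contain
  \<open>|L|\<close> ideals with pairwise zero intersection, each containing a nonzero element of \<open>R\<close>, although
  \<open>|L| > |R|\<close>. So \<open>T\<close> is Gorenstein of length at most \<open>l\<close>. Finally, if \<open>s\<close> generates the socle of \<open>T\<close>
  (\<open>s = 0\<close> if \<open>T\<close> is a field) and \<open>n\<close> is its maximal ideal, then \<open>T[t]/(t\<^sup>2 - s, t n)\<close> is Gorenstein
  with the same residue field and with length larger by one.
\<close>

section \<open>Flags of ideals\<close>

text \<open>Two obstacles shape the argument. First, an embedding does not control length:
  \<open>k[x,y]/(x,y)^2\<close> has length 3, yet x -> t, y -> c t embeds it into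
  \<open>K[t]/(t^2)\<close>, of length 2, whenever c lies in K but not in k. This shows how a larger
  residue field makes room for a Gorenstein overring, and why only an upper bound on the length is
  kept until the very end. A flag is such a bound in a stable form: finitely many elements with
  relations between them and no strictness, so a homomorphic image inherits it with the same
  \<open>l\<close>.

  Second, the statement must name the type of S in advance, while closures, ultrapowers and
  quotients live in ever larger types. The stages therefore carry cardinal bounds, by which the
  results are moved back into \<open>('a + nat) set\<close> along injections. The power set leaves
  room for a residue field of cardinality above that of R; the summand \<open>nat\<close> keeps the
  type infinite when R is finite. For finite R, an algebraically closed residue field is large
  enough simply because it is infinite.\<close>

lemma (in cring) ideal_subsetI:
  assumes "I \<subseteq> carrier R" "\<zero> \<in> I" "\<And>x y. \<lbrakk>x \<in> I; y \<in> I\<rbrakk> \<Longrightarrow> x \<oplus> y \<in> I"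
    and "\<And>x r. \<lbrakk>x \<in> I; r \<in> carrier R\<rbrakk> \<Longrightarrow> r \<otimes> x \<in> I"
  shows "ideal I R"
proof (rule idealI[OF ring_axioms])
  show "subgroup I (add_monoid R)"
  proof (rule add.subgroupI)
    fix x assume x: "x \<in> I"
    then have "(\<ominus> \<one>) \<otimes> x = \<ominus> x"
      using assms(1) by (simp add: l_minus subset_iff)
    then show "\<ominus> x \<in> I"
      using assms(4)[OF x, of "\<ominus> \<one>"] by simp
  qed (use assms in auto)
qed (use assms m_comm in \<open>auto simp: subset_iff\<close>)

text \<open>Generators enter one at a time, so that inductions and homomorphisms only ever deal with
  the last one. Nothing forces the steps to be strict.\<close>

primrec flag :: "('a, 'm) ring_scheme \<Rightarrow> (nat \<Rightarrow> 'a) \<Rightarrow> nat \<Rightarrow> 'a set" where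
  "flag R a 0 = {\<zero>\<^bsub>R\<^esub>}"
| "flag R a (Suc i) = {x \<oplus>\<^bsub>R\<^esub> r \<otimes>\<^bsub>R\<^esub> a i | x r. x \<in> flag R a i \<and> r \<in> carrier R}"

lemma flag_cong: "(\<And>i. i < n \<Longrightarrow> a i = b i) \<Longrightarrow> flag R a n = flag R b n"
  by (induction n) auto

lemma flag_hom:
  assumes "h \<in> ring_hom R S" "ring R" "ring S" "\<And>i. i < n \<Longrightarrow> a i \<in> carrier R"
    and "x \<in> flag R a n"
  shows "x \<in> carrier R \<and> h x \<in> flag S (h \<circ> a) n"
  using assms(4,5)
proof (induction n arbitrary: x)
  case 0
  then show ?case using ring_hom_zero[OF assms(1-3)] ring.ring_simprules(2)[OF assms(2)] by auto
next
  case (Suc n)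
  then obtain y r where x: "x = y \<oplus>\<^bsub>R\<^esub> r \<otimes>\<^bsub>R\<^esub> a n" "y \<in> flag R a n" "r \<in> carrier R" by auto
  then have y: "y \<in> carrier R" "h y \<in> flag S (h \<circ> a) n"
    using Suc.IH[of y] x(2) Suc.prems(1) by (simp_all del: o_apply)
  have "h x = h y \<oplus>\<^bsub>S\<^esub> h r \<otimes>\<^bsub>S\<^esub> (h \<circ> a) n"
    using x y Suc.prems(1)[of n] assms(1,2)
    by (simp add: ring_hom_memE ring.ring_simprules)
  moreover have "h r \<in> carrier S" using x(3) assms(1) by (simp add: ring_hom_memE)
  ultimately have "h x \<in> flag S (h \<circ> a) (Suc n)" using y(2) by (auto simp del: o_apply)
  moreover have "x \<in> carrier R" using x y Suc.prems(1)[of n] assms(2) by (simp add: ring.ring_simprules)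
  ultimately show ?case by blast
qed

lemma (in cring) flag_ideal:
  assumes "\<And>i. i < n \<Longrightarrow> a i \<in> carrier R"
  shows "ideal (flag R a n) R"
  using assms
proof (induction n)
  case 0
  then show ?case by (simp add: zeroideal)
next
  case (Suc n)
  then interpret I: ideal "flag R a n" R by simp
  have an: "a n \<in> carrier R" using Suc.prems by simp
  show ?case
  proof (rule ideal_subsetI)
    show "flag R a (Suc n) \<subseteq> carrier R" using I.Icarr an by auto
    have "\<zero> = \<zero> \<oplus> \<zero> \<otimes> a n" using an by simp
    then show "\<zero> \<in> flag R a (Suc n)" using I.zero_closed by (fastforce simp del: l_null)
  next
    fix x y assume "x \<in> flag R a (Suc n)" "y \<in> flag R a (Suc n)"
    then obtain x' r y' s where *: "x = x' \<oplus> r \<otimes> a n" "x' \<in> flag R a n" "r \<in> carrier R"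
      "y = y' \<oplus> s \<otimes> a n" "y' \<in> flag R a n" "s \<in> carrier R" by auto
    then have "x \<oplus> y = (x' \<oplus> y') \<oplus> (r \<oplus> s) \<otimes> a n"
      using I.Icarr[of x'] I.Icarr[of y'] an by algebra
    then show "x \<oplus> y \<in> flag R a (Suc n)" using * I.a_closed by auto
  next
    fix x t assume "x \<in> flag R a (Suc n)" and t: "t \<in> carrier R"
    then obtain x' r where *: "x = x' \<oplus> r \<otimes> a n" "x' \<in> flag R a n" "r \<in> carrier R" by auto
    then have "t \<otimes> x = (t \<otimes> x') \<oplus> (t \<otimes> r) \<otimes> a n"
      using I.Icarr[of x'] an t by algebra
    then show "t \<otimes> x \<in> flag R a (Suc n)" using * I.I_l_closed t by auto
  qed
qed

lemma (in cring) flag_Suc_subset: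
  assumes "\<And>i. i \<le> n \<Longrightarrow> a i \<in> carrier R"
  shows "flag R a n \<subseteq> flag R a (Suc n)"
proof
  interpret I: ideal "flag R a n" R using assms by (intro flag_ideal) simp
  fix x assume x: "x \<in> flag R a n"
  then have "x = x \<oplus> \<zero> \<otimes> a n" using I.Icarr assms by simp
  then show "x \<in> flag R a (Suc n)" using x by (auto simp del: l_null)
qed

lemma (in cring) flag_mono:
  assumes "\<And>i. i < n \<Longrightarrow> a i \<in> carrier R" "m \<le> n"
  shows "flag R a m \<subseteq> flag R a n"
  using assms(2,1)
proof (induction n rule: dec_induct)
  case base
  then show ?case by simp
next
  case (step n)
  then show ?case using flag_Suc_subset[of n a] by fastforce
qed

lemma (in cring) gen_in_flag_Suc:
  assumes "\<And>i. i \<le> n \<Longrightarrow> a i \<in> carrier R"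
  shows "a n \<in> flag R a (Suc n)"
proof -
  interpret I: ideal "flag R a n" R using assms by (intro flag_ideal) simp
  have "a n = \<zero> \<oplus> \<one> \<otimes> a n" using assms by simp
  then show ?thesis using I.zero_closed by fastforce
qed

lemma (in cring) gen_in_flag:
  assumes "\<And>i. i < n \<Longrightarrow> a i \<in> carrier R" "j < n"
  shows "a j \<in> flag R a n"
  using gen_in_flag_Suc[of j a] flag_mono[of n a "Suc j"] assms by auto

lemma (in cring) flag_subset_ideal:
  assumes "ideal I R" "\<And>i. i < n \<Longrightarrow> a i \<in> I"
  shows "flag R a n \<subseteq> I"
  using assms(2)
proof (induction n)
  case 0
  then show ?case using additive_subgroup.zero_closed[OF ideal.axioms(1)[OF assms(1)]] by simp
next
  case (Suc n)
  then have "flag R a n \<subseteq> I" "a n \<in> I" by auto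
  then show ?case
    using additive_subgroup.a_closed[OF ideal.axioms(1)[OF assms(1)]] ideal.I_l_closed[OF assms(1)]
    by auto
qed

text \<open>Multiplication by x is zero on each quotient of \<open>flag R a (Suc i)\<close> by
  \<open>flag R a i\<close>, since \<open>a i\<close> generates that quotient.\<close>

definition lowers_flag :: "('a, 'm) ring_scheme \<Rightarrow> (nat \<Rightarrow> 'a) \<Rightarrow> nat \<Rightarrow> 'a \<Rightarrow> bool" where
  "lowers_flag R a l x \<longleftrightarrow> (\<forall>i<l. x \<otimes>\<^bsub>R\<^esub> a i \<in> flag R a i)"

text \<open>By induction every \<open>a i\<close> is a multiple of \<open>1 - y\<close>, because \<open>a i = (1 - y) a i + y a i\<close>.\<close>

lemma (in cring) one_minus_unit:
  assumes a: "\<And>i. i < l \<Longrightarrow> a i \<in> carrier R" and one: "\<one> \<in> flag R a l"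
    and y: "y \<in> carrier R" "lowers_flag R a l y"
  shows "\<one> \<ominus> y \<in> Units R"
proof -
  let ?u = "\<one> \<ominus> y"
  have u: "?u \<in> carrier R" using y by simp
  interpret P: ideal "PIdl ?u" R using cgenideal_ideal[OF u] .
  have "a i \<in> PIdl ?u" if "i < l" for i
    using that
  proof (induction i rule: less_induct)
    case (less i)
    have "flag R a i \<subseteq> PIdl ?u"
      using less by (intro flag_subset_ideal P.is_ideal) auto
    then have "y \<otimes> a i \<in> PIdl ?u" using y(2) less.prems by (auto simp: lowers_flag_def)
    moreover have "a i \<otimes> ?u \<in> PIdl ?u"
      using a[OF less.prems] unfolding cgenideal_def by blast
    ultimately have "a i \<otimes> ?u \<oplus> y \<otimes> a i \<in> PIdl ?u" by (rule P.a_closed[rotated])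
    moreover have "a i \<otimes> ?u \<oplus> y \<otimes> a i = a i" using a[OF less.prems] y(1) by algebra
    ultimately show ?case by simp
  qed
  then have "\<one> \<in> PIdl ?u" using flag_subset_ideal[OF P.is_ideal, of l a] one by auto
  then obtain x where "x \<in> carrier R" "\<one> = x \<otimes> ?u" unfolding cgenideal_def by auto
  then show ?thesis using u m_comm unfolding Units_def by fastforce
qed

text \<open>Multiplying by the inverse of \<open>y\<close> puts \<open>a i\<close> itself into
  \<open>flag R a i\<close>. Starting from the zero ideal, all generators vanish, and then 1 =
  0.\<close>

lemma (in cring) lowers_flag_not_unit:
  assumes a: "\<And>i. i < l \<Longrightarrow> a i \<in> carrier R" and one: "\<one> \<in> flag R a l" "\<one> \<noteq> \<zero>"
    and y: "lowers_flag R a l y"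
  shows "y \<notin> Units R"
proof
  assume u: "y \<in> Units R"
  have "a i = \<zero>" if "i < l" for i
    using that
  proof (induction i rule: less_induct)
    case (less i)
    have "flag R a i \<subseteq> {\<zero>}" using less by (intro flag_subset_ideal zeroideal) auto
    then have "y \<otimes> a i = \<zero>" using y less.prems by (auto simp: lowers_flag_def)
    then have "inv y \<otimes> (y \<otimes> a i) = \<zero>" using u by simp
    then show "a i = \<zero>" using u a[OF less.prems]
      by (metis Units_closed Units_inv_closed Units_l_inv l_one m_assoc)
  qed
  then have "flag R a l \<subseteq> {\<zero>}" by (intro flag_subset_ideal zeroideal) auto
  then show False using one by auto
qed

lemma ring_hom_Units:
  assumes "h \<in> ring_hom R S" "cring R" "cring S" "x \<in> Units R"
  shows "h x \<in> Units S"
proof -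
  interpret R: cring R by fact
  interpret S: cring S by fact
  have "h x \<otimes>\<^bsub>S\<^esub> h (inv\<^bsub>R\<^esub> x) = \<one>\<^bsub>S\<^esub>"
    using ring_hom_mult[OF assms(1), of x "inv\<^bsub>R\<^esub> x"] ring_hom_one[OF assms(1)] assms(4)
      R.Units_r_inv[OF assms(4)] R.Units_closed R.Units_inv_closed by metis
  moreover have "h x \<in> carrier S" "h (inv\<^bsub>R\<^esub> x) \<in> carrier S"
    using ring_hom_closed[OF assms(1)] assms(4) by auto
  ultimately show ?thesis using S.m_comm unfolding Units_def by fastforce
qed

lemma lowers_flag_hom:
  assumes "h \<in> ring_hom R S" "ring R" "ring S" "\<And>i. i < l \<Longrightarrow> a i \<in> carrier R"
    and "x \<in> carrier R" "lowers_flag R a l x"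
  shows "lowers_flag S (h \<circ> a) l (h x)"
  unfolding lowers_flag_def
proof (intro allI impI)
  fix i assume i: "i < l"
  have "h x \<otimes>\<^bsub>S\<^esub> (h \<circ> a) i = h (x \<otimes>\<^bsub>R\<^esub> a i)"
    using ring_hom_mult[OF assms(1,5) assms(4)[OF i]] by simp
  moreover have "x \<otimes>\<^bsub>R\<^esub> a i \<in> flag R a i" using assms(6) i unfolding lowers_flag_def by blast
  ultimately show "h x \<otimes>\<^bsub>S\<^esub> (h \<circ> a) i \<in> flag S (h \<circ> a) i"
    using flag_hom[OF assms(1-3), of i a] assms(4) i by fastforce
qed

text \<open>Strictness of the flag is left open: quotients then keep the same number
  \<open>l\<close>, which bounds the length without having to equal it.\<close>

locale flag_ring = cring R for R (structure) +
  fixes a :: "nat \<Rightarrow> 'a" and l :: nat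
  assumes one_not_zero: "\<one> \<noteq> \<zero>"
    and gen_closed: "i < l \<Longrightarrow> a i \<in> carrier R"
    and one_in_flag: "\<one> \<in> flag R a l"
    and unit_or_lowers: "x \<in> carrier R \<Longrightarrow> x \<in> Units R \<or> lowers_flag R a l x"
begin

abbreviation "\<nn> \<equiv> carrier R - Units R"

lemma flag_ideal': "i \<le> l \<Longrightarrow> ideal (flag R a i) R"
  using gen_closed by (intro flag_ideal) auto

lemma nonunit_iff_lowers: "x \<in> carrier R \<Longrightarrow> x \<notin> Units R \<longleftrightarrow> lowers_flag R a l x"
  using unit_or_lowers lowers_flag_not_unit[OF gen_closed one_in_flag one_not_zero] by blast

text \<open>Lowering the flag is a linear condition on x, so it passes to sums and multiples.
  Locality rests on this.\<close>

lemma nonunits_ideal: "ideal \<nn> R"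
proof (rule ideal_subsetI)
  have *: "x \<in> \<nn> \<longleftrightarrow> x \<in> carrier R \<and> lowers_flag R a l x" for x
    using nonunit_iff_lowers by blast
  have I: "ideal (flag R a i) R" if "i < l" for i using flag_ideal' that by simp
  show "\<zero> \<in> \<nn>"
    unfolding * lowers_flag_def using gen_closed additive_subgroup.zero_closed[OF ideal.axioms(1)[OF I]]
    by simp
  show "x \<oplus> y \<in> \<nn>" if "x \<in> \<nn>" "y \<in> \<nn>" for x y
    using that unfolding * lowers_flag_def
    using gen_closed additive_subgroup.a_closed[OF ideal.axioms(1)[OF I]]
    by (simp add: l_distr)
  show "r \<otimes> x \<in> \<nn>" if "x \<in> \<nn>" "r \<in> carrier R" for x r
    using that unfolding * lowers_flag_def
    using gen_closed ideal.I_l_closed[OF I] by (simp add: m_assoc)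
qed auto

lemma ideal_subset_nonunits:
  assumes "ideal J R" "J \<noteq> carrier R"
  shows "J \<subseteq> \<nn>"
proof -
  interpret J: ideal J R by fact
  have "u \<notin> J" if "u \<in> Units R" for u
  proof
    assume "u \<in> J"
    then have "\<one> \<in> J" using J.I_l_closed[of u "inv u"] that by simp
    then show False using J.one_imp_carrier assms by simp
  qed
  then show ?thesis using J.Icarr by auto
qed

lemma nonunits_maximal: "maximalideal \<nn> R"
  by (rule maximalidealI[OF nonunits_ideal]) (use ideal_subset_nonunits in auto)

lemma is_local: "local_ring R \<nn>"
proof (intro local_ring.intro local_ring_axioms.intro is_cring)
  show "maximalideal \<nn> R" by (rule nonunits_maximal)
  fix J assume "maximalideal J R"
  then interpret J: maximalideal J R .
  have "J \<subseteq> \<nn>" by (rule ideal_subset_nonunits[OF J.is_ideal]) (use J.I_notcarr in auto)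
  then show "J = \<nn>"
    using J.I_maximal[OF nonunits_ideal] Units_one_closed by auto
qed

text \<open>Non-units must vanish in any field: if \<open>\<psi> x\<close> were nonzero for a
  non-unit x, then cancelling it in the image of \<open>x \<otimes> a i\<close> would kill each
  \<open>\<psi> (a i)\<close> in turn, and finally \<open>\<psi> \<one>\<close>.\<close>

lemma hom_field_eq_zero_iff:
  assumes "\<psi> \<in> ring_hom R L" "field L" "x \<in> carrier R"
  shows "\<psi> x = \<zero>\<^bsub>L\<^esub> \<longleftrightarrow> x \<notin> Units R"
proof -
  interpret L: field L by fact
  interpret h: ring_hom_ring R L \<psi> using assms(1) by (intro ring_hom_ringI2 ring_axioms L.ring_axioms)
  show ?thesis
  proof
    assume "\<psi> x = \<zero>\<^bsub>L\<^esub>"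
    then show "x \<notin> Units R"
      using assms(3) Units_r_inv[of x] h.hom_mult[of x "inv x"] h.hom_one
      by (metis L.l_null L.one_not_zero Units_inv_closed h.hom_closed)
  next
    assume "x \<notin> Units R"
    then have x: "lowers_flag R a l x" using nonunit_iff_lowers assms(3) by simp
    show "\<psi> x = \<zero>\<^bsub>L\<^esub>"
    proof (rule ccontr)
      assume n: "\<psi> x \<noteq> \<zero>\<^bsub>L\<^esub>"
      have K: "ideal (a_kernel R L \<psi>) R" by (rule h.kernel_is_ideal)
      have "a i \<in> a_kernel R L \<psi>" if "i < l" for i
        using that
      proof (induction i rule: less_induct)
        case (less i)
        have "flag R a i \<subseteq> a_kernel R L \<psi>" using less by (intro flag_subset_ideal K) auto
        then have "\<psi> (x \<otimes> a i) = \<zero>\<^bsub>L\<^esub>"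
          using x less.prems unfolding lowers_flag_def a_kernel_def' by blast
        then have "\<psi> x \<otimes>\<^bsub>L\<^esub> \<psi> (a i) = \<zero>\<^bsub>L\<^esub>" using gen_closed[OF less.prems] assms(3) by simp
        then have "\<psi> (a i) = \<zero>\<^bsub>L\<^esub>"
          using n L.integral[OF _ h.hom_closed[OF assms(3)] h.hom_closed[OF gen_closed[OF less.prems]]]
          by blast
        then show ?case using gen_closed[OF less.prems] unfolding a_kernel_def' by blast
      qed
      then have "\<one> \<in> a_kernel R L \<psi>" using flag_subset_ideal[OF K, of l a] one_in_flag by blast
      then have "\<psi> \<one> = \<zero>\<^bsub>L\<^esub>" unfolding a_kernel_def' by blast
      then show False using h.hom_one L.one_not_zero by metis
    qed
  qed
qed

section \<open>Jumps of an ideal along the flag, and the bound on the length\<close>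

text \<open>The number of jumps plays the role of the length of N: each flag quotient is simple or
  zero, so N meets it in nothing or in all of it.\<close>

definition jumps :: "'a set \<Rightarrow> nat set" where
  "jumps N = {i. i < l \<and> \<not> N \<inter> flag R a (Suc i) \<subseteq> flag R a i}"

lemma jumps_mono: "N \<subseteq> N' \<Longrightarrow> jumps N \<subseteq> jumps N'"
  unfolding jumps_def by blast

lemma finite_jumps: "finite (jumps N)"
  unfolding jumps_def by simp

lemma card_jumps_le: "card (jumps N) \<le> l"
  using card_mono[of "{..<l}" "jumps N"] unfolding jumps_def by auto

lemma flag_top: "flag R a l = carrier R"
  using ideal.one_imp_carrier[OF flag_ideal'[OF order_refl] one_in_flag] .

text \<open>Consecutive quotients of the flag are simple, so at a jump of \<open>N\<close> the generator \<open>a i\<close> lies in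
  \<open>N + flag i\<close>.\<close>

lemma jumps_eq_imp_eq:
  assumes N: "ideal N R" "ideal N' R" and sub: "N \<subseteq> N'" and eq: "jumps N = jumps N'"
  shows "N = N'"
proof -
  interpret N: ideal N R by fact
  interpret N': ideal N' R by fact
  have "x \<in> N" if "x \<in> N'" "x \<in> flag R a i" "i \<le> l" for x i
    using that
  proof (induction i arbitrary: x)
    case 0
    then show ?case using N.zero_closed by simp
  next
    case (Suc i)
    then interpret F: ideal "flag R a i" R using flag_ideal' by simp
    have ai: "a i \<in> carrier R" "i < l" using gen_closed Suc by auto
    show ?case
    proof (cases "i \<in> jumps N")
      case False
      then have "i \<notin> jumps N'" using eq by simp
      then have "x \<in> flag R a i" using Suc.prems unfolding jumps_def by auto
      then show ?thesis using Suc by simp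
    next
      case True
      then obtain y where y: "y \<in> N" "y \<in> flag R a (Suc i)" "y \<notin> flag R a i"
        unfolding jumps_def by blast
      from y(2) obtain z r where zr: "y = z \<oplus> r \<otimes> a i" "z \<in> flag R a i" "r \<in> carrier R" by auto
      have "r \<in> Units R"
      proof (rule ccontr)
        assume "r \<notin> Units R"
        then have "r \<otimes> a i \<in> flag R a i"
          using nonunit_iff_lowers zr(3) ai(2) by (simp add: lowers_flag_def)
        then show False using y(3) zr F.a_closed by simp
      qed
      then have inv: "inv r \<in> carrier R" "inv r \<otimes> r = \<one>" by auto
      obtain w s where ws: "x = w \<oplus> s \<otimes> a i" "w \<in> flag R a i" "s \<in> carrier R" using Suc.prems by auto
      have cl: "z \<in> carrier R" "w \<in> carrier R" "y \<in> carrier R" using zr ws F.Icarr y N.Icarr by auto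
      \<comment> \<open>Subtracting \<open>t \<otimes> y\<close> cancels the \<open>a i\<close>
        component of x and leaves an element of N' one level lower in the flag.\<close>
      define t where "t = s \<otimes> inv r"
      have t: "t \<in> carrier R" using ws inv by (simp add: t_def)
      have "t \<otimes> r = s \<otimes> (inv r \<otimes> r)" using ws(3) inv zr(3) by (simp add: t_def m_assoc)
      then have tr: "t \<otimes> r = s" using inv ws by simp
      have "x \<ominus> t \<otimes> y = w \<ominus> t \<otimes> z"
        unfolding ws(1) zr(1) tr[symmetric] using cl t ai zr(3) by algebra
      moreover have "w \<ominus> t \<otimes> z \<in> flag R a i"
        using ws(2) zr(2) t F.I_l_closed F.a_closed F.a_inv_closed by (simp add: a_minus_def)
      moreover have "x \<ominus> t \<otimes> y \<in> N'"
        using Suc.prems(1) y(1) sub t N'.I_l_closed N'.a_closed N'.a_inv_closed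
        by (simp add: a_minus_def subset_iff)
      ultimately have "x \<ominus> t \<otimes> y \<in> N" using Suc by simp
      then have "(x \<ominus> t \<otimes> y) \<oplus> t \<otimes> y \<in> N" using N.a_closed N.I_l_closed y(1) t by simp
      moreover have "(x \<ominus> t \<otimes> y) \<oplus> t \<otimes> y = x"
        using N'.Icarr[OF Suc.prems(1)] t cl by algebra
      ultimately show ?thesis by simp
    qed
  qed
  from this[of _ l] show ?thesis using sub flag_top N'.Icarr by auto
qed

lemma card_jumps_less:
  assumes "ideal N R" "ideal N' R" "N \<subset> N'"
  shows "card (jumps N) < card (jumps N')"
  using jumps_mono[of N N'] jumps_eq_imp_eq[OF assms(1,2)] assms(3) finite_jumps
  by (metis psubset_card_mono psubset_eq)

lemma is_artinian_local: "artinian_local_ring R \<nn>"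
proof -
  have "artinian_ring R"
  proof (intro artinian_ring.intro artinian_ring_axioms.intro is_cring)
    fix I :: "nat \<Rightarrow> 'a set"
    assume I: "\<And>i. ideal (I i) R" "\<And>i. I (Suc i) \<subseteq> I i"
    \<comment> \<open>Each strict descent would lower the number of jumps, so the chain is
      stationary from an index where that number is least.\<close>
    define n where "n = arg_min (\<lambda>i. card (jumps (I i))) (\<lambda>_. True)"
    have n: "card (jumps (I n)) \<le> card (jumps (I i))" for i
      unfolding n_def using arg_min_nat_le[of "\<lambda>_. True" i] by simp
    have "I i = I n" if "n \<le> i" for i
    proof -
      have "I i \<subseteq> I n" using that I(2) by (rule lift_Suc_antimono_le[rotated])
      then show ?thesis using card_jumps_less[OF I(1) I(1), of i n] n[of i] by fastforce
    qed
    then show "\<exists>n. \<forall>i\<ge>n. I i = I n" by blast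
  qed
  then show ?thesis using is_local by (simp add: artinian_local_ring_def)
qed

lemma ring_length_le: "ring_length R \<le> enat l"
proof -
  have "n \<le> l" if N: "\<forall>i\<le>n. submodule (N i) R (self_module R)" "\<forall>i<n. N i \<subset> N (Suc i)" for n N
  proof -
    have "i \<le> card (jumps (N i))" if "i \<le> n" for i
      using that
    proof (induction i)
      case (Suc i)
      then have "card (jumps (N i)) < card (jumps (N (Suc i)))"
        using N by (intro card_jumps_less) (auto simp: submodule_self_module_iff)
      then show ?case using Suc by simp
    qed simp
    then show ?thesis using card_jumps_le[of "N n"] by (meson le_trans order_refl)
  qed
  then show ?thesis unfolding ring_length_def module_length_def by (intro SUP_least) auto
qed

lemma ring_length_eq:
  assumes "\<And>i. i < l \<Longrightarrow> a i \<notin> flag R a i"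
  shows "ring_length R = enat l"
proof -
  have "\<forall>i\<le>l. submodule (flag R a i) R (self_module R)"
    using flag_ideal' by (simp add: submodule_self_module_iff)
  moreover have "flag R a i \<subset> flag R a (Suc i)" if "i < l" for i
  proof -
    have "a j \<in> carrier R" if "j \<le> i" for j using gen_closed that \<open>i < l\<close> by simp
    then show ?thesis using flag_Suc_subset[of i a] gen_in_flag_Suc[of i a] assms[OF that] by blast
  qed
  ultimately have "enat l \<le> ring_length R"
    unfolding ring_length_def module_length_def by (intro SUP_upper) blast
  then show ?thesis using ring_length_le by simp
qed

text \<open>Both alternatives of \<open>unit_or_lowers\<close> push forward along h, and
  surjectivity brings every element of S under one of them.\<close>

lemma flag_ring_hom_image:
  assumes "h \<in> ring_hom R S" "h ` carrier R = carrier S" "cring S" "\<one>\<^bsub>S\<^esub> \<noteq> \<zero>\<^bsub>S\<^esub>"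
  shows "flag_ring S (h \<circ> a) l"
proof -
  interpret S: cring S by fact
  have fl: "h x \<in> flag S (h \<circ> a) i" if "x \<in> flag R a i" "i \<le> l" for x i
    using flag_hom[OF assms(1) ring_axioms S.ring_axioms, of i a x] that gen_closed by auto
  show ?thesis
  proof
    show "\<one>\<^bsub>S\<^esub> \<noteq> \<zero>\<^bsub>S\<^esub>" by fact
    show "(h \<circ> a) i \<in> carrier S" if "i < l" for i
      using gen_closed[OF that] assms(1) by (simp add: ring_hom_memE)
    show "\<one>\<^bsub>S\<^esub> \<in> flag S (h \<circ> a) l" using fl[OF one_in_flag] assms(1) by (simp add: ring_hom_memE)
    fix y assume "y \<in> carrier S"
    then obtain x where x: "x \<in> carrier R" "y = h x" using assms(2) by blast
    show "y \<in> Units S \<or> lowers_flag S (h \<circ> a) l y"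
      using unit_or_lowers[OF x(1)] ring_hom_Units[OF assms(1) is_cring S.is_cring, of x]
        lowers_flag_hom[OF assms(1) ring_axioms S.ring_axioms, of l a x] gen_closed x by auto
  qed
qed

end

text \<open>Serves twice: with \<open>B = {\<one>}\<close> it yields maximal ideals, and with B the
  nonzero elements of an embedded ring it yields the ideal whose quotient is an essential
  extension.\<close>

lemma (in ring) exists_maximal_ideal_avoiding:
  assumes "ideal I R" "I \<inter> B = {}"
  shows "\<exists>J. ideal J R \<and> I \<subseteq> J \<and> J \<inter> B = {} \<and>
    (\<forall>K. ideal K R \<longrightarrow> J \<subset> K \<longrightarrow> K \<inter> B \<noteq> {})"
proof -
  let ?A = "{J. ideal J R \<and> I \<subseteq> J \<and> J \<inter> B = {}}"
  have "\<exists>M\<in>?A. \<forall>K\<in>?A. M \<subseteq> K \<longrightarrow> K = M"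
  proof (rule subset_Zorn_nonempty)
    fix C assume C: "C \<noteq> {}" "subset.chain ?A C"
    have "subset.chain {I. ideal I R} C" using C(2) unfolding pred_on.chain_def by blast
    then have "ideal (\<Union>C) R" using chain_Union_is_ideal[of C] C(1) by simp
    moreover have "I \<subseteq> \<Union>C" "\<Union>C \<inter> B = {}" using C unfolding pred_on.chain_def by blast+
    ultimately show "\<Union>C \<in> ?A" by blast
  next
    show "?A \<noteq> {}" using assms by blast
  qed
  then obtain M where "M \<in> ?A" and M: "\<forall>K\<in>?A. M \<subseteq> K \<longrightarrow> K = M" by (rule bexE)
  then have "K \<inter> B \<noteq> {}" if "ideal K R" "M \<subset> K" for K
    using M \<open>M \<in> ?A\<close> that by (metis (mono_tags, lifting) mem_Collect_eq order_trans psubset_eq)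
  with \<open>M \<in> ?A\<close> show ?thesis by auto
qed

text \<open>A non-unit generates a proper ideal. An ideal maximal among those avoiding 1 and
  containing it is a maximal ideal, hence the given one.\<close>

lemma (in local_ring) maximal_eq_nonunits: "\<mm> = carrier R - Units R"
proof -
  interpret M: maximalideal \<mm> R by (rule maximal)
  have "x \<in> \<mm>" if x: "x \<in> carrier R" "x \<notin> Units R" for x
  proof -
    interpret P: ideal "PIdl x" R using cgenideal_ideal[OF x(1)] .
    have "\<one> \<notin> PIdl x" using x m_comm unfolding cgenideal_def Units_def by fastforce
    then obtain J where J: "ideal J R" "PIdl x \<subseteq> J" "\<one> \<notin> J"
      "\<And>K. ideal K R \<Longrightarrow> J \<subset> K \<Longrightarrow> \<one> \<in> K"
      using exists_maximal_ideal_avoiding[of "PIdl x" "{\<one>}"] P.is_ideal by auto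
    have "maximalideal J R"
    proof (rule maximalidealI[OF J(1)])
      show "carrier R \<noteq> J" using J(3) by auto
      show "K = J \<or> K = carrier R" if "ideal K R" "J \<subseteq> K" "K \<subseteq> carrier R" for K
        using J(4)[OF that(1)] that ideal.one_imp_carrier[OF that(1)] by blast
    qed
    then show ?thesis using unique_maximal J(2) cgenideal_self[OF x(1)] by blast
  qed
  moreover have "x \<notin> Units R" if "x \<in> \<mm>" for x
  proof
    assume "x \<in> Units R"
    then have "\<one> \<in> \<mm>" using M.I_l_closed[OF that, of "inv x"] by simp
    then show False using M.one_imp_carrier M.I_notcarr by simp
  qed
  ultimately show ?thesis using M.Icarr by blast
qed

section \<open>Strict flags from ideal chains of maximal length\<close>

definition ideal_chain :: "('a, 'm) ring_scheme \<Rightarrow> nat \<Rightarrow> (nat \<Rightarrow> 'a set) \<Rightarrow> bool" where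
  "ideal_chain R n N \<longleftrightarrow> (\<forall>i\<le>n. ideal (N i) R) \<and> (\<forall>i<n. N i \<subset> N (Suc i))"

text \<open>A finite supremum of natural numbers is attained.\<close>

lemma (in cring) maximal_ideal_chain:
  assumes "ring_length R = enat l"
  obtains N where "ideal_chain R l N" "\<And>n N. ideal_chain R n N \<Longrightarrow> n \<le> l"
proof -
  define T where "T = {n. \<exists>N. ideal_chain R n N}"
  have len: "ring_length R = (SUP n\<in>T. enat n)"
    unfolding ring_length_def module_length_def T_def ideal_chain_def
    by (simp add: submodule_self_module_iff)
  have le: "n \<le> l" if "n \<in> T" for n
  proof -
    have "enat n \<le> enat l" unfolding assms[symmetric] len by (rule SUP_upper[OF that])
    then show ?thesis by simp
  qed
  then have fin: "finite T" by (meson finite_nat_set_iff_bounded_le)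
  have "0 \<in> T" unfolding T_def ideal_chain_def using oneideal by auto
  then have ne: "T \<noteq> {}" by blast
  have "enat l \<le> enat (Max T)"
    unfolding assms[symmetric] len by (rule SUP_least) (use fin in simp)
  then have "Max T = l" using le[of "Max T"] Max_in[OF fin ne] by simp
  then have "l \<in> T" using Max_in[OF fin ne] by simp
  then show thesis using that le unfolding T_def by blast
qed

lemma ideal_chain_insert:
  assumes N: "ideal_chain R n N" and "i < n" "ideal J R" "N i \<subset> J" "J \<subset> N (Suc i)"
  shows "\<exists>N'. ideal_chain R (Suc n) N'"
proof -
  let ?N = "\<lambda>k. if k \<le> i then N k else if k = Suc i then J else N (k - 1)"
  have "ideal (?N k) R" if "k \<le> Suc n" for k
    using assms that unfolding ideal_chain_def by auto
  moreover have "?N k \<subset> ?N (Suc k)" if "k < Suc n" for k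
  proof -
    consider "k < i" | "k = i" | "k = Suc i" | "Suc i < k" by linarith
    then show ?thesis
    proof cases
      case 4
      then obtain m where "k = Suc m" "i < m" by (cases k) auto
      then show ?thesis using N that unfolding ideal_chain_def by simp
    qed (use assms that in \<open>auto simp: ideal_chain_def\<close>)
  qed
  ultimately have "ideal_chain R (Suc n) ?N" unfolding ideal_chain_def by blast
  then show ?thesis by blast
qed

text \<open>No ideal fits between neighbours of a longest chain, so any element of
  \<open>N (Suc i)\<close> outside \<open>N i\<close> generates \<open>N (Suc i)\<close> over
  \<open>N i\<close>. Choosing one such element per step turns the chain into a flag.\<close>

lemma (in artinian_local_ring) exists_strict_flag:
  assumes "ring_length R = enat l"
  shows "\<exists>a. flag_ring R a l \<and> (\<forall>i<l. a i \<notin> flag R a i)"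
proof -
  obtain N where N: "ideal_chain R l N" and max: "\<And>n N. ideal_chain R n N \<Longrightarrow> n \<le> l"
    using maximal_ideal_chain[OF assms] by blast
  have id: "ideal (N i) R" if "i \<le> l" for i using N that unfolding ideal_chain_def by simp
  have N0: "N 0 = {\<zero>}"
  proof (rule ccontr)
    assume "N 0 \<noteq> {\<zero>}"
    then have "{\<zero>} \<subset> N 0" using additive_subgroup.zero_closed[OF ideal.axioms(1)[OF id[of 0]]] by auto
    then have "ideal_chain R (Suc l) (\<lambda>k. case k of 0 \<Rightarrow> {\<zero>} | Suc k \<Rightarrow> N k)"
      using N zeroideal unfolding ideal_chain_def by (auto split: nat.split)
    then show False using max[of "Suc l"] by simp
  qed
  have Nl: "N l = carrier R"
  proof (rule ccontr)
    assume "N l \<noteq> carrier R"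
    then have "N l \<subset> carrier R" using ideal.Icarr[OF id[of l]] by blast
    then have "ideal_chain R (Suc l) (N(Suc l := carrier R))"
      using N oneideal unfolding ideal_chain_def by (auto simp: le_Suc_eq less_Suc_eq)
    then show False using max[of "Suc l"] by simp
  qed
  have simple: "J = N (Suc i)" if "i < l" "ideal J R" "N i \<subset> J" "J \<subseteq> N (Suc i)" for i J
    using ideal_chain_insert[OF N that(1,2,3)] max[of "Suc l"] that(4) by fastforce
  define a where "a i = (SOME x. x \<in> N (Suc i) \<and> x \<notin> N i)" for i
  have a: "a i \<in> N (Suc i)" "a i \<notin> N i" if "i < l" for i
  proof -
    have "\<exists>x. x \<in> N (Suc i) \<and> x \<notin> N i" using N that unfolding ideal_chain_def by blast
    from someI_ex[OF this] show "a i \<in> N (Suc i)" "a i \<notin> N i" unfolding a_def by auto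
  qed
  have ac: "a i \<in> carrier R" if "i < l" for i using ideal.Icarr[OF id[of "Suc i"] a(1)] that by simp
  have gen: "N (Suc i) = {x \<oplus> r \<otimes> b | x r. x \<in> N i \<and> r \<in> carrier R}"
    if "i < l" "b \<in> N (Suc i)" "b \<notin> N i" for i b
  proof -
    interpret I: ideal "N i" R using id that by simp
    interpret I': ideal "N (Suc i)" R using id that by simp
    let ?b = "\<lambda>k. b"
    have b: "b \<in> carrier R" using I'.Icarr that by simp
    have eq: "{x \<oplus> r \<otimes> b | x r. x \<in> N i \<and> r \<in> carrier R} = N i <+> PIdl b" (is "?J = _")
      unfolding set_add_def' cgenideal_def by auto
    have J: "ideal ?J R" unfolding eq by (intro add_ideals I.is_ideal cgenideal_ideal b)
    have sub: "?J \<subseteq> N (Suc i)"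
      using N that I'.a_closed I'.I_l_closed unfolding ideal_chain_def by fastforce
    have "x = x \<oplus> \<zero> \<otimes> b" if "x \<in> N i" for x using I.Icarr[OF that] b by simp
    then have sup: "N i \<subseteq> ?J" using zero_closed by blast
    have "b = \<zero> \<oplus> \<one> \<otimes> b" using b by simp
    then have "b \<in> ?J" using I.zero_closed by blast
    then show ?thesis using simple[OF that(1) J _ sub] sup that(3) by blast
  qed
  have fl: "flag R a i = N i" if "i \<le> l" for i
    using that
  proof (induction i)
    case (Suc i)
    then show ?case using gen[of i "a i"] a[of i] by simp
  qed (simp add: N0)
  have "flag_ring R a l"
  proof
    interpret M: maximalideal \<mm> R by (rule maximal)
    show "\<one> \<noteq> \<zero>" using M.zero_closed M.one_imp_carrier M.I_notcarr by auto
    show "a i \<in> carrier R" if "i < l" for i using ac[OF that] .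
    show "\<one> \<in> flag R a l" using fl[of l] Nl by simp
    fix x assume x: "x \<in> carrier R"
    show "x \<in> Units R \<or> lowers_flag R a l x"
    proof (cases "x \<in> Units R")
      case nu: False
      have "lowers_flag R a l x"
        unfolding lowers_flag_def
      proof (intro allI impI, rule ccontr)
        fix i assume i: "i < l" and "x \<otimes> a i \<notin> flag R a i"
        then have xa: "x \<otimes> a i \<notin> N i" using fl[of i] by simp
        interpret I: ideal "N i" R using id i by simp
        have "x \<otimes> a i \<in> N (Suc i)" using ideal.I_l_closed[OF id[of "Suc i"] a(1)] i x by simp
        \<comment> \<open>Nakayama's argument: if \<open>x \<otimes> a i\<close> still generated the
          step, then \<open>a i = z \<oplus> r \<otimes> (x \<otimes> a i)\<close>, so the unit
          \<open>\<one> \<ominus> r \<otimes> x\<close> would carry \<open>a i\<close> into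
          \<open>N i\<close>.\<close>
        from gen[OF i this xa] a(1)[OF i] obtain z r where
          zr: "a i = z \<oplus> r \<otimes> (x \<otimes> a i)" "z \<in> N i" "r \<in> carrier R" by blast
        have cl: "a i \<in> carrier R" "z \<in> carrier R" using ac[OF i] I.Icarr zr by auto
        have rx: "r \<otimes> x \<in> \<mm>" using nu x zr(3) M.I_l_closed[of x r] maximal_eq_nonunits by simp
        let ?u = "\<one> \<ominus> r \<otimes> x"
        have uc: "?u \<in> carrier R" using zr x by simp
        have "?u \<in> Units R"
        proof (rule ccontr)
          assume "?u \<notin> Units R"
          then have "?u \<in> \<mm>" using uc maximal_eq_nonunits by blast
          then have "?u \<oplus> r \<otimes> x \<in> \<mm>" using rx M.a_closed by blast
          moreover have "?u \<oplus> r \<otimes> x = \<one>" using zr x by algebra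
          ultimately show False using M.one_imp_carrier M.I_notcarr by simp
        qed
        have "?u \<otimes> a i = a i \<ominus> r \<otimes> (x \<otimes> a i)" using cl x zr(3) by algebra
        also have "\<dots> = z \<oplus> r \<otimes> (x \<otimes> a i) \<ominus> r \<otimes> (x \<otimes> a i)" using zr(1) by simp
        also have "\<dots> = z" using cl x zr(3) by algebra
        finally have "inv ?u \<otimes> (?u \<otimes> a i) \<in> N i" using zr(2) I.I_l_closed \<open>?u \<in> Units R\<close> by simp
        moreover have "inv ?u \<otimes> (?u \<otimes> a i) = a i"
          using \<open>?u \<in> Units R\<close> cl(1) uc by (simp add: m_assoc[symmetric])
        ultimately show False using a(2)[OF i] by simp
      qed
      then show ?thesis by blast
    qed simp
  qed
  then show ?thesis using fl a(2) by auto
qed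

section \<open>Quotient rings\<close>

lemma (in ideal) quotient_carrier: "carrier (R Quot I) = (+>) I ` carrier R"
  unfolding FactRing_def A_RCOSETS_def' by auto

lemma (in ideal) rcos_eq_iff:
  "x \<in> carrier R \<Longrightarrow> y \<in> carrier R \<Longrightarrow> I +> x = I +> y \<longleftrightarrow> x \<ominus> y \<in> I"
  using quotient_eq_iff_same_a_r_cos[OF is_ideal] by blast

lemma (in ideal) rcos_eq_zero_iff:
  assumes "x \<in> carrier R"
  shows "I +> x = \<zero>\<^bsub>R Quot I\<^esub> \<longleftrightarrow> x \<in> I"
  using a_rcos_zero[OF is_ideal] rcos_const_imp_mem[OF assms] by (auto simp: FactRing_def)

lemma (in ideal) hom_factors:
  assumes S: "ring S" and h: "h \<in> ring_hom R S" and ker: "\<And>x. x \<in> I \<Longrightarrow> h x = \<zero>\<^bsub>S\<^esub>"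
  obtains g where "g \<in> ring_hom (R Quot I) S" "\<And>x. x \<in> carrier R \<Longrightarrow> g (I +> x) = h x"
proof -
  interpret S: ring S by fact
  interpret h: ring_hom_ring R S h by (intro ring_hom_ringI2 ring_axioms S h)
  interpret p: ring_hom_ring R "R Quot I" "(+>) I" by (rule rcos_ring_hom_ring)
  define g where "g C = h (SOME x. x \<in> carrier R \<and> I +> x = C)" for C
  have g: "g (I +> x) = h x" if x: "x \<in> carrier R" for x
  proof -
    define y where "y = (SOME y. y \<in> carrier R \<and> I +> y = I +> x)"
    have y: "y \<in> carrier R" "I +> y = I +> x"
      using someI_ex[of "\<lambda>y. y \<in> carrier R \<and> I +> y = I +> x"] x unfolding y_def by blast+
    have "y \<ominus> x \<in> I" using y rcos_eq_iff[OF y(1) x] by blast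
    then have "h (y \<ominus> x) = \<zero>\<^bsub>S\<^esub>" by (rule ker)
    then have "h y \<ominus>\<^bsub>S\<^esub> h x = \<zero>\<^bsub>S\<^esub>" using x y(1) by (simp add: a_minus_def S.minus_eq)
    then have "h y = h x" using x y(1) by simp
    then show ?thesis unfolding g_def y_def .
  qed
  have "g \<in> ring_hom (R Quot I) S"
  proof (rule ring_hom_memI)
    fix C assume "C \<in> carrier (R Quot I)"
    then show "g C \<in> carrier S" using g unfolding quotient_carrier by auto
  next
    fix C D assume "C \<in> carrier (R Quot I)" "D \<in> carrier (R Quot I)"
    then obtain x y where *: "x \<in> carrier R" "C = I +> x" "y \<in> carrier R" "D = I +> y"
      unfolding quotient_carrier by auto
    have "g (C \<otimes>\<^bsub>R Quot I\<^esub> D) = g (I +> (x \<otimes> y))" using * by simp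
    also have "\<dots> = h (x \<otimes> y)" using * by (intro g) simp
    also have "\<dots> = g C \<otimes>\<^bsub>S\<^esub> g D" using * by (simp add: g)
    finally show "g (C \<otimes>\<^bsub>R Quot I\<^esub> D) = g C \<otimes>\<^bsub>S\<^esub> g D" .
    have "g (C \<oplus>\<^bsub>R Quot I\<^esub> D) = g (I +> (x \<oplus> y))" using * by simp
    also have "\<dots> = h (x \<oplus> y)" using * by (intro g) simp
    also have "\<dots> = g C \<oplus>\<^bsub>S\<^esub> g D" using * by (simp add: g)
    finally show "g (C \<oplus>\<^bsub>R Quot I\<^esub> D) = g C \<oplus>\<^bsub>S\<^esub> g D" .
  next
    have "g \<one>\<^bsub>R Quot I\<^esub> = g (I +> \<one>)" by simp
    also have "\<dots> = h \<one>" by (intro g) simp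
    finally show "g \<one>\<^bsub>R Quot I\<^esub> = \<one>\<^bsub>S\<^esub>" by simp
  qed
  then show thesis using that g by blast
qed

lemma (in ideal) finsum_in_ideal:
  assumes "f \<in> A \<rightarrow> I"
  shows "finsum R f A \<in> I"
  using assms
proof (induction A rule: infinite_finite_induct)
  case (insert x A)
  then have "f \<in> A \<rightarrow> carrier R" "f x \<in> carrier R" using Icarr by (auto simp: Pi_iff)
  then show ?case using insert by simp
qed simp_all

lemma (in cring) unit_factor_left:
  assumes "x \<otimes> y \<in> Units R" "x \<in> carrier R" "y \<in> carrier R"
  shows "x \<in> Units R"
proof -
  have "x \<otimes> (y \<otimes> inv (x \<otimes> y)) = \<one>" using assms Units_r_inv[OF assms(1)] by (simp add: m_assoc[symmetric])
  moreover have "y \<otimes> inv (x \<otimes> y) \<in> carrier R" using assms by simp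
  ultimately show ?thesis using assms(2) m_comm unfolding Units_def by fastforce
qed

lemma (in flag_ring) hom_field_image_subfield:
  assumes "\<psi> \<in> ring_hom R L" "field L"
  shows "subfield (\<psi> ` carrier R) L"
proof -
  interpret L: field L by fact
  interpret h: ring_hom_ring R L \<psi> using assms(1) by (intro ring_hom_ringI2 ring_axioms L.ring_axioms)
  have sub: "subring (\<psi> ` carrier R) L" by (rule h.img_is_subring[OF carrier_is_subring])
  show ?thesis
  proof (rule L.subfieldI'[OF sub])
    fix k assume k: "k \<in> \<psi> ` carrier R - {\<zero>\<^bsub>L\<^esub>}"
    then obtain x where x: "x \<in> carrier R" "k = \<psi> x" "\<psi> x \<noteq> \<zero>\<^bsub>L\<^esub>" by auto
    then have u: "x \<in> Units R" using hom_field_eq_zero_iff[OF assms x(1)] by blast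
    then have "\<psi> x \<otimes>\<^bsub>L\<^esub> \<psi> (inv x) = \<one>\<^bsub>L\<^esub>"
      using h.hom_mult[of x "inv x"] x(1) by simp
    then have "inv\<^bsub>L\<^esub> k = \<psi> (inv x)" using x u by (intro L.comm_inv_char) auto
    then show "inv\<^bsub>L\<^esub> k \<in> \<psi> ` carrier R" using u by simp
  qed
qed

section \<open>Adjoining an element to the residue field\<close>

text \<open>The image of R under \<phi> is its residue field, seen as a subfield of L. Being
  algebraic over it makes every element of L a root of a monic polynomial with coefficients lifted
  to R.\<close>

locale residue_hom = flag_ring R a l + L: field L
  for R (structure) and a l and L (structure) +
  fixes \<phi>
  assumes res_hom: "\<phi> \<in> ring_hom R L"
    and res_algebraic: "\<beta> \<in> carrier L \<Longrightarrow> (L.algebraic over (\<phi> ` carrier R)) \<beta>"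
begin

sublocale U: UP_pre_univ_prop R L \<phi> "UP R"
  using res_hom
  by (auto intro!: UP_pre_univ_prop.intro ring_hom_cringI UP_cring.intro is_cring L.is_cring)

abbreviation "P \<equiv> UP R"

lemma image_subfield: "subfield (\<phi> ` carrier R) L"
  by (rule hom_field_image_subfield[OF res_hom L.field_axioms])

lemma res_zero_iff: "x \<in> carrier R \<Longrightarrow> \<phi> x = \<zero>\<^bsub>L\<^esub> \<longleftrightarrow> x \<notin> Units R"
  by (rule hom_field_eq_zero_iff[OF res_hom L.field_axioms])

abbreviation "cf \<equiv> up_ring.coeff P"
abbreviation "mn \<equiv> up_ring.monom P"
abbreviation "ev \<equiv> UnivPoly.eval R L \<phi>"

lemma ev_hom: "\<alpha> \<in> carrier L \<Longrightarrow> ring_hom_ring P L (ev \<alpha>)"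
  by (intro ring_hom_ringI2 U.UP_ring L.ring_axioms U.eval_ring_hom)

lemma ev_mon: "\<alpha> \<in> carrier L \<Longrightarrow> c \<in> carrier R \<Longrightarrow> ev \<alpha> (mn c n) = \<phi> c \<otimes>\<^bsub>L\<^esub> \<alpha> [^]\<^bsub>L\<^esub> n"
  by (rule U.eval_monom)

lemma ev_smult:
  assumes "\<alpha> \<in> carrier L" "c \<in> carrier R" "p \<in> carrier P"
  shows "ev \<alpha> (c \<odot>\<^bsub>P\<^esub> p) = \<phi> c \<otimes>\<^bsub>L\<^esub> ev \<alpha> p"
proof -
  interpret e: ring_hom_ring P L "ev \<alpha>" by (rule ev_hom[OF assms(1)])
  have "ev \<alpha> (c \<odot>\<^bsub>P\<^esub> p) = ev \<alpha> (mn c 0 \<otimes>\<^bsub>P\<^esub> p)"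
    using assms by (simp add: U.monom_mult_is_smult)
  also have "\<dots> = ev \<alpha> (mn c 0) \<otimes>\<^bsub>L\<^esub> ev \<alpha> p" using assms by (intro e.hom_mult) auto
  also have "ev \<alpha> (mn c 0) = \<phi> c" using assms by (simp add: U.eval_const)
  finally show ?thesis .
qed

text \<open>A bridge between two kinds of polynomials: algebraicity is phrased with coefficient
  lists, leading coefficient first, while division with remainder is available for
  \<open>UP R\<close>. The bound \<open>length cs\<close> saves the degree.\<close>

lemma list_eval_as_ev:
  assumes "\<alpha> \<in> carrier L" "set cs \<subseteq> \<phi> ` carrier R"
  shows "\<exists>q\<in>carrier P. (\<forall>i\<ge>length cs. cf q i = \<zero>) \<and> ev \<alpha> q = L.eval cs \<alpha>"
  using assms(2)
proof (induction cs)
  case Nil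
  interpret e: ring_hom_ring P L "ev \<alpha>" by (rule ev_hom[OF assms(1)])
  show ?case by (intro bexI[of _ "\<zero>\<^bsub>P\<^esub>"]) auto
next
  case (Cons c cs)
  interpret e: ring_hom_ring P L "ev \<alpha>" by (rule ev_hom[OF assms(1)])
  obtain q where q: "q \<in> carrier P" "\<forall>i\<ge>length cs. cf q i = \<zero>" "ev \<alpha> q = L.eval cs \<alpha>"
    using Cons by auto
  obtain r where r: "r \<in> carrier R" "c = \<phi> r" using Cons.prems by auto
  have "ev \<alpha> (mn r (length cs) \<oplus>\<^bsub>P\<^esub> q) = ev \<alpha> (mn r (length cs)) \<oplus>\<^bsub>L\<^esub> ev \<alpha> q"
    using q r by (intro e.hom_add) auto
  also have "\<dots> = L.eval (c # cs) \<alpha>" using q r ev_mon[OF assms(1)] by simp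
  finally show ?case using q r
    by (intro bexI[of _ "mn r (length cs) \<oplus>\<^bsub>P\<^esub> q"]) auto
qed

text \<open>Serves \<open>ev_inverse\<close>, where the inverse arises as a polynomial in
  \<open>ev \<alpha> p\<close> rather than in \<alpha>.\<close>

lemma list_eval_in_ev_range:
  assumes "\<alpha> \<in> carrier L" "p \<in> carrier P" "set cs \<subseteq> \<phi> ` carrier R"
  shows "\<exists>q\<in>carrier P. ev \<alpha> q = L.eval cs (ev \<alpha> p)"
  using assms(3)
proof (induction cs)
  case Nil
  interpret e: ring_hom_ring P L "ev \<alpha>" by (rule ev_hom[OF assms(1)])
  show ?case by (intro bexI[of _ "\<zero>\<^bsub>P\<^esub>"]) auto
next
  case (Cons c cs)
  interpret e: ring_hom_cring P L "ev \<alpha>"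
    using ev_hom[OF assms(1)] U.UP_cring L.is_cring
    by (intro ring_hom_cringI) (auto simp: ring_hom_ring_def ring_hom_ring_axioms_def)
  obtain q where q: "q \<in> carrier P" "ev \<alpha> q = L.eval cs (ev \<alpha> p)"
    using Cons by auto
  obtain r where r: "r \<in> carrier R" "c = \<phi> r" using Cons.prems by auto
  let ?t = "mn r 0 \<otimes>\<^bsub>P\<^esub> p [^]\<^bsub>P\<^esub> length cs"
  have t: "?t \<in> carrier P" using r assms by auto
  have "ev \<alpha> ?t = ev \<alpha> (mn r 0) \<otimes>\<^bsub>L\<^esub> ev \<alpha> (p [^]\<^bsub>P\<^esub> length cs)"
    using r assms by (intro e.hom_mult) auto
  also have "\<dots> = c \<otimes>\<^bsub>L\<^esub> ev \<alpha> p [^]\<^bsub>L\<^esub> length cs"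
    using r assms e.hom_pow[OF assms(2)] by (simp add: U.eval_const)
  finally have t': "ev \<alpha> ?t = c \<otimes>\<^bsub>L\<^esub> ev \<alpha> p [^]\<^bsub>L\<^esub> length cs" .
  have "ev \<alpha> (?t \<oplus>\<^bsub>P\<^esub> q) = ev \<alpha> ?t \<oplus>\<^bsub>L\<^esub> ev \<alpha> q"
    using q t by (intro e.hom_add) auto
  then have "ev \<alpha> (?t \<oplus>\<^bsub>P\<^esub> q) = L.eval (c # cs) (ev \<alpha> p)" unfolding t' q(2) by simp
  then show ?case using q t by (intro bexI[of _ "?t \<oplus>\<^bsub>P\<^esub> q"]) auto
qed

text \<open>The value \<open>ev \<alpha> p\<close> is algebraic over the residue field, so adjoining
  it gives a field, and its inverse is a polynomial in it.\<close>

lemma ev_inverse: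
  assumes \<alpha>: "\<alpha> \<in> carrier L" and p: "p \<in> carrier P" "ev \<alpha> p \<noteq> \<zero>\<^bsub>L\<^esub>"
  obtains q where "q \<in> carrier P" "ev \<alpha> p \<otimes>\<^bsub>L\<^esub> ev \<alpha> q = \<one>\<^bsub>L\<^esub>"
proof -
  let ?F = "\<phi> ` carrier R" and ?b = "ev \<alpha> p"
  interpret e: ring_hom_ring P L "ev \<alpha>" by (rule ev_hom[OF \<alpha>])
  have b: "?b \<in> carrier L" using p by simp
  have F: "subring ?F L" using subfieldE(1)[OF image_subfield] .
  have E: "subfield (L.simple_extension ?F ?b) L"
    using L.simple_extension_is_subfield[OF image_subfield b] res_algebraic[OF b] by blast
  have "?b \<in> L.simple_extension ?F ?b" by (rule L.simple_extension_mem[OF F b])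
  then have i: "inv\<^bsub>L\<^esub> ?b \<in> L.simple_extension ?F ?b" and ii: "?b \<otimes>\<^bsub>L\<^esub> inv\<^bsub>L\<^esub> ?b = \<one>\<^bsub>L\<^esub>"
    using L.subfield_m_inv[OF E] p by auto
  from i obtain cs where "cs \<in> carrier (?F[X]\<^bsub>L\<^esub>)" "inv\<^bsub>L\<^esub> ?b = L.eval cs ?b"
    using L.simple_extension_as_eval_img[OF subringE(1)[OF F] b] by auto
  moreover from this have "set cs \<subseteq> ?F"
    unfolding univ_poly_carrier[symmetric] polynomial_def by auto
  ultimately obtain q where "q \<in> carrier P" "ev \<alpha> q = inv\<^bsub>L\<^esub> ?b"
    using list_eval_in_ev_range[OF \<alpha> p(1)] by metis
  then show thesis using that ii by simp
qed

section \<open>Monic polynomials over R with a prescribed root in L\<close>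

text \<open>The polynomial has coefficients in R, not in the residue field. The least such d is the
  degree of the minimal polynomial of \<alpha> over the residue field.\<close>

definition monic_root_degree :: "'c \<Rightarrow> nat \<Rightarrow> bool" where
  "monic_root_degree \<alpha> d \<longleftrightarrow> (\<exists>q\<in>carrier P. (\<forall>i\<ge>d. cf q i = \<zero>) \<and>
     ev \<alpha> (mn \<one> d \<oplus>\<^bsub>P\<^esub> q) = \<zero>\<^bsub>L\<^esub>)"

lemma monic_root_degreeI:
  assumes \<alpha>: "\<alpha> \<in> carrier L" and c: "c \<in> Units R"
    and q: "q \<in> carrier P" "\<forall>i\<ge>d. cf q i = \<zero>"
    and ev: "ev \<alpha> (mn c d \<oplus>\<^bsub>P\<^esub> q) = \<zero>\<^bsub>L\<^esub>"
  shows "monic_root_degree \<alpha> d"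
proof -
  let ?q = "inv c \<odot>\<^bsub>P\<^esub> q"
  interpret e: ring_hom_ring P L "ev \<alpha>" by (rule ev_hom[OF \<alpha>])
  have m: "mn c d \<oplus>\<^bsub>P\<^esub> q \<in> carrier P" using c q by auto
  have eq: "mn \<one> d \<oplus>\<^bsub>P\<^esub> ?q = inv c \<odot>\<^bsub>P\<^esub> (mn c d \<oplus>\<^bsub>P\<^esub> q)"
    using c q m Units_closed[OF c] by (intro U.up_eqI) (auto simp: r_distr)
  have "ev \<alpha> (mn \<one> d \<oplus>\<^bsub>P\<^esub> ?q) = \<phi> (inv c) \<otimes>\<^bsub>L\<^esub> \<zero>\<^bsub>L\<^esub>"
    unfolding eq ev[symmetric] using c by (intro ev_smult \<alpha> m) auto
  also have "\<dots> = \<zero>\<^bsub>L\<^esub>" using c U.hom_closed by simp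
  finally show ?thesis using c q unfolding monic_root_degree_def by (intro bexI[of _ ?q]) auto
qed

text \<open>Lift an algebraic relation coefficientwise. Its leading coefficient is nonzero in L, so
  the lift is a unit and can be divided out.\<close>

lemma ex_monic_root_degree:
  assumes \<alpha>: "\<alpha> \<in> carrier L"
  shows "\<exists>d. monic_root_degree \<alpha> d"
proof -
  let ?F = "\<phi> ` carrier R"
  have F: "subring ?F L" using subfieldE(1)[OF image_subfield] .
  obtain p where p: "p \<in> carrier (?F[X]\<^bsub>L\<^esub>)" "p \<noteq> []" "L.eval p \<alpha> = \<zero>\<^bsub>L\<^esub>"
    using L.algebraicE[OF F \<alpha> res_algebraic[OF \<alpha>]] by blast
  then obtain c cs where cs: "p = c # cs" by (cases p) auto
  have sub: "set cs \<subseteq> ?F" "c \<in> ?F" "c \<noteq> \<zero>\<^bsub>L\<^esub>"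
    using p(1) unfolding cs univ_poly_carrier[symmetric] polynomial_def by auto
  then obtain u where u: "u \<in> carrier R" "c = \<phi> u" by auto
  then have uu: "u \<in> Units R" using res_zero_iff sub by auto
  obtain q where q: "q \<in> carrier P" "\<forall>i\<ge>length cs. cf q i = \<zero>" "ev \<alpha> q = L.eval cs \<alpha>"
    using list_eval_as_ev[OF \<alpha> sub(1)] by blast
  interpret e: ring_hom_ring P L "ev \<alpha>" by (rule ev_hom[OF \<alpha>])
  have "ev \<alpha> (mn u (length cs) \<oplus>\<^bsub>P\<^esub> q) = ev \<alpha> (mn u (length cs)) \<oplus>\<^bsub>L\<^esub> ev \<alpha> q"
    using q u by (intro e.hom_add) auto
  also have "\<dots> = L.eval p \<alpha>" using q u cs ev_mon[OF \<alpha>] by simp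
  finally show ?thesis using monic_root_degreeI[OF \<alpha> uu q(1,2)] p(3) by auto
qed

text \<open>A unit as top coefficient could be normalised to 1, contradicting the minimality of d.
  So the top coefficient is a non-unit, its term vanishes in L, and the rest of \<open>r\<close>
  again has \<alpha> as a root.\<close>

lemma ev_zero_imp_nonunits:
  assumes \<alpha>: "\<alpha> \<in> carrier L" and min: "\<And>e. e < d \<Longrightarrow> \<not> monic_root_degree \<alpha> e"
    and r: "r \<in> carrier P" "\<forall>i\<ge>d. cf r i = \<zero>" "ev \<alpha> r = \<zero>\<^bsub>L\<^esub>"
  shows "cf r i \<notin> Units R"
proof -
  interpret e: ring_hom_ring P L "ev \<alpha>" by (rule ev_hom[OF \<alpha>])
  have z: "\<zero> \<notin> Units R" using one_not_zero unfolding Units_def by auto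
  have "\<forall>i. cf r i \<notin> Units R"
    if "e \<le> d" "r \<in> carrier P" "\<forall>i\<ge>e. cf r i = \<zero>" "ev \<alpha> r = \<zero>\<^bsub>L\<^esub>" for e r
    using that
  proof (induction e arbitrary: r)
    case 0
    then show ?case using z by simp
  next
    case (Suc e)
    define c where "c = cf r e"
    define r1 where "r1 = r \<ominus>\<^bsub>P\<^esub> mn c e"
    have c: "c \<in> carrier R" using Suc.prems unfolding c_def by simp
    have r1: "r1 \<in> carrier P" using c Suc.prems unfolding r1_def by simp
    have r1c: "cf r1 i = (if i = e then \<zero> else cf r i)" for i
      using c Suc.prems(2) unfolding r1_def
      by (auto simp: c_def a_minus_def r_neg)
    have r1z: "\<forall>i\<ge>e. cf r1 i = \<zero>" using r1c Suc.prems(3) by auto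
    have eq: "mn c e \<oplus>\<^bsub>P\<^esub> r1 = r"
      using c Suc.prems(2) r1 r1c by (intro U.up_eqI) (auto simp: c_def)
    have nu: "c \<notin> Units R"
      using monic_root_degreeI[OF \<alpha> _ r1 r1z] min[of e] Suc.prems(1,4) eq by auto
    then have "ev \<alpha> (mn c e) = \<zero>\<^bsub>L\<^esub>" using ev_mon[OF \<alpha> c] res_zero_iff[OF c] \<alpha> by simp
    moreover have "ev \<alpha> r = ev \<alpha> (mn c e) \<oplus>\<^bsub>L\<^esub> ev \<alpha> r1"
      unfolding eq[symmetric] using c r1 by (intro e.hom_add) auto
    ultimately have "ev \<alpha> r1 = \<zero>\<^bsub>L\<^esub>" using Suc.prems(4) r1 by simp
    then have "\<forall>i. cf r1 i \<notin> Units R" using Suc.IH[OF _ r1 r1z] Suc.prems(1) by simp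
    then show ?case using r1c nu unfolding c_def by metis
  qed
  then show ?thesis using r by blast
qed

end

context residue_hom
begin

text \<open>Degrees add here despite zero divisors because \<open>f\<close> is monic. Consequently a
  nonzero multiple of \<open>f\<close> cannot be a constant when d > 0.\<close>

lemma coeff_mult_monic:
  assumes g: "g \<in> carrier P" and f: "f \<in> carrier P" "cf f d = \<one>" "\<forall>i>d. cf f i = \<zero>"
  shows "cf (g \<otimes>\<^bsub>P\<^esub> f) (deg R g + d) = cf g (deg R g)"
proof -
  let ?n = "deg R g"
  have "cf (g \<otimes>\<^bsub>P\<^esub> f) (?n + d) = (\<Oplus>i\<in>{..?n + d}. cf g i \<otimes> cf f (?n + d - i))"
    using g f by simp
  also have "\<dots> = (\<Oplus>i\<in>{..?n + d}. if ?n = i then cf g i else \<zero>)"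
  proof (rule finsum_cong')
    fix i assume i: "i \<in> {..?n + d}"
    consider "i < ?n" | "i = ?n" | "i > ?n" by linarith
    then show "cf g i \<otimes> cf f (?n + d - i) = (if ?n = i then cf g i else \<zero>)"
    proof cases
      case 1
      then have "cf f (?n + d - i) = \<zero>" using f(3) by simp
      then show ?thesis using 1 g by simp
    next
      case 2
      then show ?thesis using f g by simp
    next
      case 3
      then have "cf g i = \<zero>" using U.deg_aboveD g by simp
      then show ?thesis using 3 f by simp
    qed
  qed (use g in auto)
  also have "\<dots> = cf g ?n" using g by (intro finsum_singleton) auto
  finally show ?thesis .
qed

text \<open>Each coefficient lowers the flag of R. Multiplying by powers of X and summing carries
  this over to the flag of constant polynomials.\<close>

lemma flag_constants:
  assumes "p \<in> carrier P" "\<And>i. cf p i \<notin> Units R" "j < l"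
  shows "p \<otimes>\<^bsub>P\<^esub> mn (a j) 0 \<in> flag P ((\<lambda>c. mn c 0) \<circ> a) j"
proof -
  let ?b = "(\<lambda>c. mn c 0) \<circ> a"
  have aj: "a j \<in> carrier R" using gen_closed[OF assms(3)] .
  have hom: "(\<lambda>c. mn c 0) \<in> ring_hom R P" by (rule U.const_ring_hom)
  interpret F: ideal "flag P ?b j" P
    using gen_closed assms(3) by (intro U.P.flag_ideal) auto
  have "mn (cf p i) i \<otimes>\<^bsub>P\<^esub> mn (a j) 0 \<in> flag P ?b j" for i
  proof -
    have c: "cf p i \<in> carrier R" using assms(1) by simp
    have "cf p i \<otimes> a j \<in> flag R a j"
      using nonunit_iff_lowers[OF c] assms(2,3) unfolding lowers_flag_def by blast
    then have "mn (cf p i \<otimes> a j) 0 \<in> flag P ?b j"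
      using flag_hom[OF hom ring_axioms U.P.ring_axioms, of j a "cf p i \<otimes> a j"] gen_closed assms(3)
      by fastforce
    then have "mn (cf p i \<otimes> a j) 0 \<otimes>\<^bsub>P\<^esub> mn \<one> i \<in> flag P ?b j"
      by (intro F.I_r_closed) auto
    moreover have "mn (cf p i \<otimes> a j) 0 \<otimes>\<^bsub>P\<^esub> mn \<one> i = mn (cf p i \<otimes> a j) i"
      using U.monom_mult[of "cf p i \<otimes> a j" \<one> 0 i] c aj by simp
    moreover have "mn (cf p i \<otimes> a j) i = mn (cf p i) i \<otimes>\<^bsub>P\<^esub> mn (a j) 0"
      using U.monom_mult[of "cf p i" "a j" i 0] c aj by simp
    ultimately show ?thesis by simp
  qed
  then have "(\<Oplus>\<^bsub>P\<^esub>i\<in>{..deg R p}. mn (cf p i) i \<otimes>\<^bsub>P\<^esub> mn (a j) 0) \<in> flag P ?b j"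
    by (intro F.finsum_in_ideal) auto
  also have "(\<Oplus>\<^bsub>P\<^esub>i\<in>{..deg R p}. mn (cf p i) i \<otimes>\<^bsub>P\<^esub> mn (a j) 0) =
      (\<Oplus>\<^bsub>P\<^esub>i\<in>{..deg R p}. mn (cf p i) i) \<otimes>\<^bsub>P\<^esub> mn (a j) 0"
    using assms(1) aj by (intro U.P.finsum_ldistr[symmetric]) auto
  also have "(\<Oplus>\<^bsub>P\<^esub>i\<in>{..deg R p}. mn (cf p i) i) = p"
    by (rule U.up_repr[OF assms(1)])
  finally show ?thesis .
qed

text \<open>The ring is \<open>R[X]/(f)\<close>, where \<open>f\<close> is a monic lift of the
  minimal polynomial of \<alpha>. Its residue field is the one generated by \<alpha>, so the images
  of the same generators still form a flag.\<close>

theorem adjoin_root: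
  assumes \<alpha>: "\<alpha> \<in> carrier L"
  obtains S :: "(nat \<Rightarrow> 'a) set ring" and \<iota> \<psi> where
    "flag_ring S (\<iota> \<circ> a) l" "\<iota> \<in> ring_hom R S" "inj_on \<iota> (carrier R)" "\<psi> \<in> ring_hom S L"
    "\<And>x. x \<in> carrier R \<Longrightarrow> \<psi> (\<iota> x) = \<phi> x" "\<alpha> \<in> \<psi> ` carrier S"
proof -
  interpret e: ring_hom_ring P L "ev \<alpha>" by (rule ev_hom[OF \<alpha>])
  define d where "d = (LEAST d. monic_root_degree \<alpha> d)"
  have "monic_root_degree \<alpha> d" unfolding d_def by (rule LeastI_ex[OF ex_monic_root_degree[OF \<alpha>]])
  then obtain q0 where q0: "q0 \<in> carrier P" "\<forall>i\<ge>d. cf q0 i = \<zero>"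
    "ev \<alpha> (mn \<one> d \<oplus>\<^bsub>P\<^esub> q0) = \<zero>\<^bsub>L\<^esub>" unfolding monic_root_degree_def by blast
  have min: "\<not> monic_root_degree \<alpha> e" if "e < d" for e
    using not_less_Least that unfolding d_def by blast
  define f where "f = mn \<one> d \<oplus>\<^bsub>P\<^esub> q0"
  have f: "f \<in> carrier P" "cf f d = \<one>" "\<forall>i>d. cf f i = \<zero>" "ev \<alpha> f = \<zero>\<^bsub>L\<^esub>"
    using q0 unfolding f_def by auto
  have fnz: "f \<noteq> \<zero>\<^bsub>P\<^esub>" using f(2) one_not_zero by auto
  have degf: "deg R f = d"
    using f one_not_zero by (intro le_antisym U.deg_aboveI U.deg_belowI) auto
  \<comment> \<open>Positive degree keeps nonzero constants out of the ideal of \<open>f\<close>,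
    which makes \<iota> injective below.\<close>
  have d0: "d \<noteq> 0"
  proof
    assume "d = 0"
    then have "f = \<one>\<^bsub>P\<^esub>" using f by (intro U.up_eqI) auto
    then show False using f(4) e.hom_one by simp
  qed
  define I where "I = PIdl\<^bsub>P\<^esub> f"
  have I: "ideal I P" unfolding I_def by (rule U.P.cgenideal_ideal[OF f(1)])
  interpret I: ideal I P by (rule I)
  let ?S = "P Quot I"
  let ?\<pi> = "(+>\<^bsub>P\<^esub>) I"
  interpret S: cring ?S by (rule I.quotient_is_cring[OF U.UP_cring])
  interpret \<pi>: ring_hom_ring P ?S ?\<pi> by (rule I.rcos_ring_hom_ring)
  have evI: "ev \<alpha> p = \<zero>\<^bsub>L\<^esub>" if "p \<in> I" for p
    using that f unfolding I_def cgenideal_def by auto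
  obtain \<psi> where \<psi>: "\<psi> \<in> ring_hom ?S L" "\<And>p. p \<in> carrier P \<Longrightarrow> \<psi> (?\<pi> p) = ev \<alpha> p"
    using I.hom_factors[OF L.ring_axioms e.homh evI] by blast
  define \<iota> where "\<iota> c = ?\<pi> (mn c 0)" for c
  have \<iota>c: "\<iota> = ?\<pi> \<circ> (\<lambda>c. mn c 0)" unfolding \<iota>_def by auto
  have \<iota>: "\<iota> \<in> ring_hom R ?S"
    unfolding \<iota>c by (rule ring_hom_trans[OF U.const_ring_hom \<pi>.homh])
  have fl: "?\<pi> x \<in> flag ?S (\<iota> \<circ> a) j" if "x \<in> flag P ((\<lambda>c. mn c 0) \<circ> a) j" "j \<le> l" for x j
    using flag_hom[OF \<pi>.homh U.P.ring_axioms S.ring_axioms, of j "(\<lambda>c. mn c 0) \<circ> a" x] that gen_closed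
    unfolding \<iota>c by (simp add: comp_assoc)
  \<comment> \<open>Modulo \<open>f\<close> the polynomial may be replaced by its remainder, which
    also has the root \<alpha> and degree below d. All coefficients of the remainder are therefore
    non-units.\<close>
  have lowers: "lowers_flag ?S (\<iota> \<circ> a) l (?\<pi> p)" if p: "p \<in> carrier P" "ev \<alpha> p = \<zero>\<^bsub>L\<^esub>" for p
  proof -
    obtain q r k where qr: "q \<in> carrier P" "r \<in> carrier P"
      "cf f (deg R f) [^] (k::nat) \<odot>\<^bsub>P\<^esub> p = f \<otimes>\<^bsub>P\<^esub> q \<oplus>\<^bsub>P\<^esub> r"
      "r = \<zero>\<^bsub>P\<^esub> \<or> deg R r < deg R f"
      using U.long_div_theorem[OF f(1) p(1) fnz] by blast
    have pe: "p = f \<otimes>\<^bsub>P\<^esub> q \<oplus>\<^bsub>P\<^esub> r"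
      using qr(3) f(2) p(1) unfolding degf by simp
    have rd: "\<forall>i\<ge>d. cf r i = \<zero>" using qr(2,4) U.deg_aboveD unfolding degf by auto
    have "ev \<alpha> p = ev \<alpha> (f \<otimes>\<^bsub>P\<^esub> q) \<oplus>\<^bsub>L\<^esub> ev \<alpha> r" unfolding pe using qr f by (intro e.hom_add) auto
    then have evr: "ev \<alpha> r = \<zero>\<^bsub>L\<^esub>" using qr f p(2) by simp
    have nu: "cf r i \<notin> Units R" for i by (rule ev_zero_imp_nonunits[OF \<alpha> min qr(2) rd evr])
    have "f \<otimes>\<^bsub>P\<^esub> q \<in> I" using U.P.m_comm[OF f(1) qr(1)] qr(1) unfolding I_def cgenideal_def by blast
    then have "?\<pi> (f \<otimes>\<^bsub>P\<^esub> q) = \<zero>\<^bsub>?S\<^esub>" using I.rcos_eq_zero_iff[of "f \<otimes>\<^bsub>P\<^esub> q"] qr(1) f(1) by blast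
    moreover have "?\<pi> p = ?\<pi> (f \<otimes>\<^bsub>P\<^esub> q) \<oplus>\<^bsub>?S\<^esub> ?\<pi> r"
      unfolding pe using qr f by (intro \<pi>.hom_add) auto
    ultimately have pr: "?\<pi> p = ?\<pi> r" using qr(2) by simp
    show ?thesis
      unfolding lowers_flag_def
    proof (intro allI impI)
      fix j assume j: "j < l"
      have "?\<pi> p \<otimes>\<^bsub>?S\<^esub> (\<iota> \<circ> a) j = ?\<pi> (r \<otimes>\<^bsub>P\<^esub> mn (a j) 0)"
        unfolding pr \<iota>_def o_def using qr(2) gen_closed[OF j] by (intro \<pi>.hom_mult[symmetric]) auto
      also have "\<dots> \<in> flag ?S (\<iota> \<circ> a) j" using flag_constants[OF qr(2) nu j] fl j by simp
      finally show "?\<pi> p \<otimes>\<^bsub>?S\<^esub> (\<iota> \<circ> a) j \<in> flag ?S (\<iota> \<circ> a) j" .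
    qed
  qed
  have gen: "(\<iota> \<circ> a) j \<in> carrier ?S" if "j < l" for j
    using gen_closed[OF that] \<iota> by (simp add: ring_hom_memE)
  have one: "\<one>\<^bsub>?S\<^esub> \<in> flag ?S (\<iota> \<circ> a) l"
    using flag_hom[OF \<iota> ring_axioms S.ring_axioms gen_closed one_in_flag] ring_hom_one[OF \<iota>] by simp
  have "flag_ring ?S (\<iota> \<circ> a) l"
  proof
    show "\<one>\<^bsub>?S\<^esub> \<noteq> \<zero>\<^bsub>?S\<^esub>"
      using ring_hom_one[OF \<psi>(1)] ring_hom_zero[OF \<psi>(1) S.ring_axioms L.ring_axioms] L.one_not_zero by auto
    show "(\<iota> \<circ> a) j \<in> carrier ?S" if "j < l" for j by (rule gen[OF that])
    show "\<one>\<^bsub>?S\<^esub> \<in> flag ?S (\<iota> \<circ> a) l" by (rule one)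
    fix x assume "x \<in> carrier ?S"
    then obtain p where p: "p \<in> carrier P" "x = ?\<pi> p" unfolding I.quotient_carrier by auto
    show "x \<in> Units ?S \<or> lowers_flag ?S (\<iota> \<circ> a) l x"
    proof (cases "ev \<alpha> p = \<zero>\<^bsub>L\<^esub>")
      case True
      then show ?thesis using lowers p by simp
    next
      case False
      then obtain q where q: "q \<in> carrier P" "ev \<alpha> p \<otimes>\<^bsub>L\<^esub> ev \<alpha> q = \<one>\<^bsub>L\<^esub>"
        using ev_inverse[OF \<alpha> p(1)] by blast
      \<comment> \<open>Since q inverts p only after evaluation, the error \<open>y\<close> has root
        \<alpha>. It thus lowers the flag, and \<open>1 - y = p q\<close> becomes a unit.\<close>
      define y where "y = \<one>\<^bsub>P\<^esub> \<ominus>\<^bsub>P\<^esub> p \<otimes>\<^bsub>P\<^esub> q"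
      have y: "y \<in> carrier P" using p q unfolding y_def by simp
      have "p \<otimes>\<^bsub>P\<^esub> q \<oplus>\<^bsub>P\<^esub> y = \<one>\<^bsub>P\<^esub>" unfolding y_def using p q by algebra
      moreover have "ev \<alpha> (p \<otimes>\<^bsub>P\<^esub> q \<oplus>\<^bsub>P\<^esub> y) = \<one>\<^bsub>L\<^esub> \<oplus>\<^bsub>L\<^esub> ev \<alpha> y"
        using p q y by simp
      ultimately have "\<one>\<^bsub>L\<^esub> \<oplus>\<^bsub>L\<^esub> ev \<alpha> y = \<one>\<^bsub>L\<^esub>" by simp
      then have "ev \<alpha> y = \<zero>\<^bsub>L\<^esub>"
        using y L.add.l_cancel_one'[of "\<one>\<^bsub>L\<^esub>" "ev \<alpha> y"] by simp
      then have "lowers_flag ?S (\<iota> \<circ> a) l (?\<pi> y)" using lowers y by simp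
      then have "\<one>\<^bsub>?S\<^esub> \<ominus>\<^bsub>?S\<^esub> ?\<pi> y \<in> Units ?S"
        using S.one_minus_unit[OF gen one \<pi>.hom_closed[OF y]] by simp
      moreover have "\<one>\<^bsub>?S\<^esub> \<ominus>\<^bsub>?S\<^esub> ?\<pi> y = ?\<pi> (\<one>\<^bsub>P\<^esub> \<ominus>\<^bsub>P\<^esub> y)"
        using y by (simp add: a_minus_def)
      moreover have "\<one>\<^bsub>P\<^esub> \<ominus>\<^bsub>P\<^esub> y = p \<otimes>\<^bsub>P\<^esub> q" unfolding y_def using p q by algebra
      ultimately have "x \<otimes>\<^bsub>?S\<^esub> ?\<pi> q \<in> Units ?S" using p q by simp
      then have "x \<in> Units ?S"
        by (rule S.unit_factor_left) (use p q \<pi>.hom_closed in \<open>simp_all only:\<close>)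
      then show ?thesis ..
    qed
  qed
  moreover have "inj_on \<iota> (carrier R)"
  proof (rule inj_onI)
    fix x y assume xy: "x \<in> carrier R" "y \<in> carrier R" "\<iota> x = \<iota> y"
    define c where "c = x \<ominus> y"
    have c: "c \<in> carrier R" using xy unfolding c_def by simp
    have "mn x 0 \<ominus>\<^bsub>P\<^esub> mn y 0 = mn c 0"
      using xy unfolding c_def by (simp add: a_minus_def)
    then have "mn c 0 \<in> I" using xy I.rcos_eq_iff[of "mn x 0" "mn y 0"] unfolding \<iota>_def by auto
    then obtain g where g: "g \<in> carrier P" "mn c 0 = g \<otimes>\<^bsub>P\<^esub> f"
      unfolding I_def cgenideal_def by auto
    have "cf g (deg R g) = cf (mn c 0) (deg R g + d)"
      unfolding g(2) by (rule coeff_mult_monic[OF g(1) f(1-3), symmetric])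
    also have "\<dots> = \<zero>" using c d0 by simp
    finally have "g = \<zero>\<^bsub>P\<^esub>" using U.lcoeff_nonzero g(1) by blast
    then have "mn c 0 = \<zero>\<^bsub>P\<^esub>" using g f by simp
    then have "cf (mn c 0) 0 = \<zero>" by simp
    then have "c = \<zero>" using c by simp
    then show "x = y" using xy unfolding c_def by simp
  qed
  moreover have "\<psi> (\<iota> x) = \<phi> x" if "x \<in> carrier R" for x
    using \<psi>(2)[of "mn x 0"] that \<alpha> unfolding \<iota>_def by (simp add: U.eval_const)
  moreover have "\<alpha> \<in> \<psi> ` carrier ?S"
    using \<psi>(2)[of "mn \<one> 1"] U.eval_monom1[OF \<alpha>] unfolding I.quotient_carrier
    by (metis U.monom_closed image_eqI one_closed)
  ultimately show thesis using that \<iota> \<psi>(1) by blast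
qed

end

section \<open>Closing the residue field\<close>

lemma flag_ring_cong:
  assumes "flag_ring R a l" "\<And>i. i < l \<Longrightarrow> a i = b i"
  shows "flag_ring R b l"
proof -
  interpret flag_ring R a l by fact
  have fl: "flag R a i = flag R b i" if "i \<le> l" for i using assms(2) that by (intro flag_cong) simp
  have lf: "lowers_flag R a l x = lowers_flag R b l x" for x
    unfolding lowers_flag_def using assms(2) fl by simp
  show ?thesis
    using one_not_zero gen_closed one_in_flag unit_or_lowers fl[of l] lf assms(2)
    by unfold_locales auto
qed

lemma (in cring) inj_imp_image_ring_is_cring:
  assumes "inj_on f (carrier R)"
  shows "cring (image_ring f R)"
  using ring_iso_imp_img_cring[OF inj_imp_image_ring_iso[OF assms]]
  by (simp add: image_ring_def image_group_def monoid.defs)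

lemma image_ring_hom: "inj_on f (carrier R) \<Longrightarrow> f \<in> ring_hom R (image_ring f R)"
  using inj_imp_image_ring_iso unfolding ring_iso_def by blast

lemma (in flag_ring) image_ring_flag_ring:
  assumes "inj_on f (carrier R)"
  shows "flag_ring (image_ring f R) (f \<circ> a) l"
proof (rule flag_ring_hom_image[OF image_ring_hom[OF assms] _ inj_imp_image_ring_is_cring[OF assms]])
  show "f ` carrier R = carrier (image_ring f R)" by (simp add: image_ring_carrier)
  show "\<one>\<^bsub>image_ring f R\<^esub> \<noteq> \<zero>\<^bsub>image_ring f R\<^esub>"
    using one_not_zero inj_onD[OF assms] by (auto simp: image_ring_one image_ring_zero)
qed

lemma hom_from_image_ring:
  fixes R (structure)
  assumes "ring R" "inj_on f (carrier R)" "h \<in> ring_hom R S"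
    and g: "\<And>x. x \<in> carrier R \<Longrightarrow> g (f x) = h x"
  shows "g \<in> ring_hom (image_ring f R) S" (is "_ \<in> ring_hom ?I S")
proof -
  note f = image_ring_hom[OF assms(2)]
  interpret ring R by fact
  show ?thesis
  proof (rule ring_hom_memI)
    fix u assume "u \<in> carrier ?I"
    then show "g u \<in> carrier S" using g ring_hom_closed[OF assms(3)] by (auto simp: image_ring_carrier)
  next
    fix u v assume "u \<in> carrier ?I" "v \<in> carrier ?I"
    then obtain x y where *: "x \<in> carrier R" "u = f x" "y \<in> carrier R" "v = f y"
      by (auto simp: image_ring_carrier)
    have "u \<otimes>\<^bsub>?I\<^esub> v = f (x \<otimes> y)" "u \<oplus>\<^bsub>?I\<^esub> v = f (x \<oplus> y)"
      using * ring_hom_mult[OF f] ring_hom_add[OF f] by auto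
    then show "g (u \<otimes>\<^bsub>?I\<^esub> v) = g u \<otimes>\<^bsub>S\<^esub> g v" "g (u \<oplus>\<^bsub>?I\<^esub> v) = g u \<oplus>\<^bsub>S\<^esub> g v"
      using * ring_hom_mult[OF assms(3)] ring_hom_add[OF assms(3)] by (simp_all add: g)
  next
    show "g \<one>\<^bsub>?I\<^esub> = \<one>\<^bsub>S\<^esub>" using g ring_hom_one[OF assms(3)] by (simp add: image_ring_one)
  qed
qed

section \<open>Cardinality of a flag ring compared with its residue field\<close>

text \<open>Modulo \<open>flag i\<close>, the product \<open>r \<otimes> a i\<close> depends only on the residue of \<open>r\<close>.\<close>

lemma (in flag_ring) flag_Suc_residues:
  assumes "\<phi> \<in> ring_hom R L" "field L" "i < l"
  obtains g where "flag R a (Suc i) = g ` (flag R a i \<times> \<phi> ` carrier R)"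
proof -
  interpret L: field L by fact
  interpret h: ring_hom_ring R L \<phi> using assms(1) by (intro ring_hom_ringI2 ring_axioms L.ring_axioms)
  interpret F: ideal "flag R a i" R using flag_ideal' assms(3) by simp
  have ai: "a i \<in> carrier R" using gen_closed assms(3) .
  define \<rho> where "\<rho> = inv_into (carrier R) \<phi>"
  have \<rho>: "\<rho> t \<in> carrier R" "\<phi> (\<rho> t) = t" if "t \<in> \<phi> ` carrier R" for t
    using inv_into_into[OF that] f_inv_into_f[OF that] unfolding \<rho>_def by auto
  let ?g = "\<lambda>(y, t). y \<oplus> \<rho> t \<otimes> a i"
  have "flag R a (Suc i) \<subseteq> ?g ` (flag R a i \<times> \<phi> ` carrier R)"
  proof
    fix x assume "x \<in> flag R a (Suc i)"
    then obtain y r where x: "x = y \<oplus> r \<otimes> a i" "y \<in> flag R a i" "r \<in> carrier R" by auto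
    define n where "n = r \<ominus> \<rho> (\<phi> r)"
    have rr: "\<rho> (\<phi> r) \<in> carrier R" "\<phi> (\<rho> (\<phi> r)) = \<phi> r" using \<rho> x by auto
    have n: "n \<in> carrier R" using x rr unfolding n_def by simp
    have "\<phi> n = \<zero>\<^bsub>L\<^esub>" unfolding n_def using x rr by (simp add: a_minus_def L.r_neg)
    then have "n \<otimes> a i \<in> flag R a i"
      using hom_field_eq_zero_iff[OF assms(1,2) n] nonunit_iff_lowers[OF n] assms(3)
      unfolding lowers_flag_def by blast
    then have "y \<oplus> n \<otimes> a i \<in> flag R a i" using x F.a_closed by simp
    moreover have "x = (y \<oplus> n \<otimes> a i) \<oplus> \<rho> (\<phi> r) \<otimes> a i"
      unfolding x(1) n_def using F.Icarr[OF x(2)] x(3) rr ai by algebra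
    ultimately show "x \<in> ?g ` (flag R a i \<times> \<phi> ` carrier R)"
      using x(3) by (intro image_eqI[of _ _ "(y \<oplus> n \<otimes> a i, \<phi> r)"]) auto
  qed
  moreover have "?g ` (flag R a i \<times> \<phi> ` carrier R) \<subseteq> flag R a (Suc i)"
    using \<rho>(1) by fastforce
  ultimately show thesis using that by blast
qed

lemma (in flag_ring) finite_residues_imp_finite:
  assumes "\<phi> \<in> ring_hom R L" "field L" "finite (\<phi> ` carrier R)"
  shows "finite (carrier R)"
proof -
  have "finite (flag R a i)" if "i \<le> l" for i
    using that
  proof (induction i)
    case (Suc i)
    then obtain g where "flag R a (Suc i) = g ` (flag R a i \<times> \<phi> ` carrier R)"
      using flag_Suc_residues[OF assms(1,2), of i] by auto
    then show ?case using Suc assms(3) by simp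
  qed simp
  then show ?thesis using flag_top by (metis order_refl)
qed

text \<open>Each of the finitely many steps multiplies the cardinality by at most that of the
  residue field, which absorbs such products because it is infinite.\<close>

lemma (in flag_ring) card_le_residues:
  assumes "\<phi> \<in> ring_hom R L" "field L" "infinite (\<phi> ` carrier R)"
  shows "|carrier R| \<le>o |\<phi> ` carrier R|"
proof -
  have "|flag R a i| \<le>o |\<phi> ` carrier R|" if "i \<le> l" for i
    using that
  proof (induction i)
    case 0
    have "\<phi> ` carrier R \<noteq> {}" by auto
    then show ?case by (simp add: card_of_singl_ordLeq)
  next
    case (Suc i)
    then obtain g where g: "flag R a (Suc i) = g ` (flag R a i \<times> \<phi> ` carrier R)"
      using flag_Suc_residues[OF assms(1,2), of i] by auto
    have "|flag R a i \<times> \<phi> ` carrier R| \<le>o |\<phi> ` carrier R|"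
      by (rule card_of_Times_ordLeq_infinite[OF assms(3) Suc.IH card_of_mono1])
        (use Suc.prems in simp_all)
    then show ?case unfolding g using card_of_image ordLeq_transitive by blast
  qed
  then show ?thesis using flag_top by (metis order_refl)
qed

text \<open>A bound independent of the ring: it lets every extension with residues in L fit into one
  fixed type.\<close>

lemma (in flag_ring) card_le_field:
  assumes "\<phi> \<in> ring_hom R L" "field L" "infinite (carrier L)"
  shows "|carrier R| \<le>o |carrier L|"
proof (cases "finite (\<phi> ` carrier R)")
  case True
  then have "finite (carrier R)" using finite_residues_imp_finite assms by blast
  then show ?thesis using assms(3) by (simp add: ordLess_imp_ordLeq)
next
  case False
  have "\<phi> ` carrier R \<subseteq> carrier L" using assms(1) by (auto simp: ring_hom_memE)
  then show ?thesis using card_le_residues[OF assms(1,2) False] card_of_mono1 ordLeq_transitive by blast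
qed

section \<open>Zorn's lemma for ring extensions, by way of graphs of the operations\<close>

text \<open>Carrier and both operations become a single set, so that extension of rings is inclusion
  of sets and the limit of a chain is a plain union.\<close>

definition ring_graph :: "('v, 'm) ring_scheme \<Rightarrow> ('v \<times> 'v \<times> 'v \<times> 'v) set" where
  "ring_graph A = {(x, y, x \<oplus>\<^bsub>A\<^esub> y, x \<otimes>\<^bsub>A\<^esub> y) | x y. x \<in> carrier A \<and> y \<in> carrier A}"

text \<open>Reads a ring back from its graph. Zero and one are not stored there; all rings compared
  below share the given \<open>z\<close> and \<open>e\<close>.\<close>

definition graph_ring :: "'v \<Rightarrow> 'v \<Rightarrow> ('v \<times> 'v \<times> 'v \<times> 'v) set \<Rightarrow> 'v ring" where
  "graph_ring z e G =
    \<lparr>carrier = fst ` G, monoid.mult = (\<lambda>x y. THE p. \<exists>s. (x, y, s, p) \<in> G), one = e,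
     ring.zero = z, ring.add = (\<lambda>x y. THE s. \<exists>p. (x, y, s, p) \<in> G)\<rparr>"

lemma mem_ring_graph:
  "(x, y, s, p) \<in> ring_graph A \<longleftrightarrow>
    x \<in> carrier A \<and> y \<in> carrier A \<and> s = x \<oplus>\<^bsub>A\<^esub> y \<and> p = x \<otimes>\<^bsub>A\<^esub> y"
  unfolding ring_graph_def by auto

lemma fst_ring_graph: "fst ` ring_graph A = carrier A"
  unfolding ring_graph_def by force

lemma ring_graph_subset:
  assumes "ring_graph A \<subseteq> ring_graph B"
  shows "carrier A \<subseteq> carrier B"
    and "x \<in> carrier A \<Longrightarrow> y \<in> carrier A \<Longrightarrow> x \<oplus>\<^bsub>A\<^esub> y = x \<oplus>\<^bsub>B\<^esub> y"
    and "x \<in> carrier A \<Longrightarrow> y \<in> carrier A \<Longrightarrow> x \<otimes>\<^bsub>A\<^esub> y = x \<otimes>\<^bsub>B\<^esub> y"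
proof -
  have *: "x \<in> carrier B \<and> x \<oplus>\<^bsub>A\<^esub> y = x \<oplus>\<^bsub>B\<^esub> y \<and> x \<otimes>\<^bsub>A\<^esub> y = x \<otimes>\<^bsub>B\<^esub> y"
    if "x \<in> carrier A" "y \<in> carrier A" for x y
  proof -
    have "(x, y, x \<oplus>\<^bsub>A\<^esub> y, x \<otimes>\<^bsub>A\<^esub> y) \<in> ring_graph A" using that by (simp add: mem_ring_graph)
    then have "(x, y, x \<oplus>\<^bsub>A\<^esub> y, x \<otimes>\<^bsub>A\<^esub> y) \<in> ring_graph B" using assms by (rule rev_subsetD)
    then show ?thesis by (simp add: mem_ring_graph)
  qed
  show "carrier A \<subseteq> carrier B" using * by blast
  show "x \<in> carrier A \<Longrightarrow> y \<in> carrier A \<Longrightarrow> x \<oplus>\<^bsub>A\<^esub> y = x \<oplus>\<^bsub>B\<^esub> y" using * by blast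
  show "x \<in> carrier A \<Longrightarrow> y \<in> carrier A \<Longrightarrow> x \<otimes>\<^bsub>A\<^esub> y = x \<otimes>\<^bsub>B\<^esub> y" using * by blast
qed

lemma ring_graph_subset_hom:
  "ring_graph A \<subseteq> ring_graph B \<Longrightarrow> \<one>\<^bsub>A\<^esub> = \<one>\<^bsub>B\<^esub> \<Longrightarrow> id \<in> ring_hom A B"
  using ring_graph_subset[of A B] by (intro ring_hom_memI) auto

definition flag_extension ::
    "'v \<Rightarrow> 'v \<Rightarrow> (nat \<Rightarrow> 'v) \<Rightarrow> nat \<Rightarrow> ('c, 'k) ring_scheme \<Rightarrow> ('v \<Rightarrow> 'c) \<Rightarrow> 'v ring \<Rightarrow> bool" where
  "flag_extension z e a l L \<psi> A \<longleftrightarrow>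
     flag_ring A a l \<and> \<psi> \<in> ring_hom A L \<and> \<zero>\<^bsub>A\<^esub> = z \<and> \<one>\<^bsub>A\<^esub> = e"

text \<open>Any three elements of the union lie in one member of the chain, so the ring laws hold
  there already. Likewise an element is a unit, or lowers the flag, as soon as it does so in some
  member.\<close>

lemma flag_extension_union:
  assumes ne: "\<A> \<noteq> {}" and ext: "\<And>A. A \<in> \<A> \<Longrightarrow> flag_extension z e a l L \<psi> A"
    and chain: "\<And>A B. A \<in> \<A> \<Longrightarrow> B \<in> \<A> \<Longrightarrow> ring_graph A \<subseteq> ring_graph B \<or> ring_graph B \<subseteq> ring_graph A"
  obtains U where "flag_extension z e a l L \<psi> U" "ring_graph U = \<Union> (ring_graph ` \<A>)"
proof -
  define G where "G = \<Union> (ring_graph ` \<A>)"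
  define U where "U = graph_ring z e G"
  have flA: "flag_ring A a l" and hom: "\<psi> \<in> ring_hom A L" and zA: "\<zero>\<^bsub>A\<^esub> = z" and eA: "\<one>\<^bsub>A\<^esub> = e"
    if "A \<in> \<A>" for A using ext[OF that] unfolding flag_extension_def by auto
  have crA: "cring A" if "A \<in> \<A>" for A using flA[OF that] by (simp add: flag_ring_def)
  have carU: "carrier U = \<Union> (carrier ` \<A>)"
    unfolding U_def graph_ring_def G_def by (simp add: image_UN fst_ring_graph)
  have zU: "\<zero>\<^bsub>U\<^esub> = z" and eU: "\<one>\<^bsub>U\<^esub> = e" unfolding U_def graph_ring_def by simp_all
  have two: "\<exists>C\<in>\<A>. ring_graph A \<subseteq> ring_graph C \<and> ring_graph B \<subseteq> ring_graph C"
    if "A \<in> \<A>" "B \<in> \<A>" for A B using chain[OF that] that by blast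
  have uniq: "s = x \<oplus>\<^bsub>A\<^esub> y \<and> p = x \<otimes>\<^bsub>A\<^esub> y"
    if A: "A \<in> \<A>" and xy: "x \<in> carrier A" "y \<in> carrier A" and xyG: "(x, y, s, p) \<in> G" for A x y s p
  proof -
    obtain B where B: "B \<in> \<A>" "(x, y, s, p) \<in> ring_graph B" using xyG unfolding G_def by blast
    obtain C where "C \<in> \<A>" and C: "ring_graph A \<subseteq> ring_graph C" "ring_graph B \<subseteq> ring_graph C"
      using two[OF A B(1)] by blast
    show ?thesis
      using B(2) ring_graph_subset(2,3)[OF C(1) xy] ring_graph_subset(2,3)[OF C(2), of x y]
      by (simp add: mem_ring_graph)
  qed
  have mem: "(x, y, x \<oplus>\<^bsub>A\<^esub> y, x \<otimes>\<^bsub>A\<^esub> y) \<in> G" if "A \<in> \<A>" "x \<in> carrier A" "y \<in> carrier A" for A x y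
    using that unfolding G_def by (auto simp: mem_ring_graph)
  have addU: "x \<oplus>\<^bsub>U\<^esub> y = x \<oplus>\<^bsub>A\<^esub> y" if "A \<in> \<A>" "x \<in> carrier A" "y \<in> carrier A" for A x y
  proof -
    have "(THE s. \<exists>p. (x, y, s, p) \<in> G) = x \<oplus>\<^bsub>A\<^esub> y"
      by (rule the_equality) (use uniq[OF that] mem[OF that] in blast)+
    then show ?thesis unfolding U_def graph_ring_def by simp
  qed
  have multU: "x \<otimes>\<^bsub>U\<^esub> y = x \<otimes>\<^bsub>A\<^esub> y" if "A \<in> \<A>" "x \<in> carrier A" "y \<in> carrier A" for A x y
  proof -
    have "(THE p. \<exists>s. (x, y, s, p) \<in> G) = x \<otimes>\<^bsub>A\<^esub> y"
      by (rule the_equality) (use uniq[OF that] mem[OF that] in blast)+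
    then show ?thesis unfolding U_def graph_ring_def by simp
  qed
  have three: "\<exists>A\<in>\<A>. x \<in> carrier A \<and> y \<in> carrier A \<and> w \<in> carrier A"
    if "x \<in> carrier U" "y \<in> carrier U" "w \<in> carrier U" for x y w
  proof -
    obtain A B C where *: "A \<in> \<A>" "x \<in> carrier A" "B \<in> \<A>" "y \<in> carrier B" "C \<in> \<A>" "w \<in> carrier C"
      using \<open>x \<in> carrier U\<close> \<open>y \<in> carrier U\<close> \<open>w \<in> carrier U\<close> unfolding carU by blast
    obtain D where D: "D \<in> \<A>" "ring_graph A \<subseteq> ring_graph D" "ring_graph B \<subseteq> ring_graph D"
      using two *(1,3) by blast
    obtain E where "E \<in> \<A>" "ring_graph D \<subseteq> ring_graph E" "ring_graph C \<subseteq> ring_graph E"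
      using two *(5) D(1) by blast
    then show ?thesis using ring_graph_subset(1) D * by (meson subsetD)
  qed
  obtain A0 where A0: "A0 \<in> \<A>" using ne by blast
  have zc: "z \<in> carrier A" "e \<in> carrier A" if "A \<in> \<A>" for A
    using cring.cring_simprules(2,6)[OF crA[OF that]] zA[OF that] eA[OF that] by auto
  have clU: "x \<oplus>\<^bsub>U\<^esub> y \<in> carrier U" "x \<otimes>\<^bsub>U\<^esub> y \<in> carrier U" if x: "x \<in> carrier U" and y: "y \<in> carrier U" for x y
  proof -
    obtain A where A: "A \<in> \<A>" "x \<in> carrier A" "y \<in> carrier A" using three[OF x y y] by blast
    interpret A: cring A using crA[OF A(1)] .
    show "x \<oplus>\<^bsub>U\<^esub> y \<in> carrier U" "x \<otimes>\<^bsub>U\<^esub> y \<in> carrier U"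
      using A addU[OF A] multU[OF A] unfolding carU by auto
  qed
  have "cring U"
  proof (rule cringI)
    show "abelian_group U"
    proof (rule abelian_groupI)
      show "\<zero>\<^bsub>U\<^esub> \<in> carrier U" using zc A0 unfolding zU carU by blast
      fix x y w assume x: "x \<in> carrier U" and y: "y \<in> carrier U" and w: "w \<in> carrier U"
      obtain A where A: "A \<in> \<A>" "x \<in> carrier A" "y \<in> carrier A" "w \<in> carrier A" using three[OF x y w] by blast
      interpret A: cring A using crA[OF A(1)] .
      show "x \<oplus>\<^bsub>U\<^esub> y \<in> carrier U" by (rule clU[OF x y])
      show "x \<oplus>\<^bsub>U\<^esub> y \<oplus>\<^bsub>U\<^esub> w = x \<oplus>\<^bsub>U\<^esub> (y \<oplus>\<^bsub>U\<^esub> w)"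
        using A by (simp add: addU[OF A(1)] A.a_assoc)
      show "x \<oplus>\<^bsub>U\<^esub> y = y \<oplus>\<^bsub>U\<^esub> x" using A by (simp add: addU[OF A(1)] A.a_comm)
      show "\<zero>\<^bsub>U\<^esub> \<oplus>\<^bsub>U\<^esub> x = x" using A by (simp add: zU zA[OF A(1), symmetric] addU[OF A(1)])
      have "\<ominus>\<^bsub>A\<^esub> x \<in> carrier U" "\<ominus>\<^bsub>A\<^esub> x \<oplus>\<^bsub>U\<^esub> x = \<zero>\<^bsub>U\<^esub>"
        using A by (auto simp: carU zU zA[OF A(1), symmetric] addU[OF A(1)] A.l_neg)
      then show "\<exists>v\<in>carrier U. v \<oplus>\<^bsub>U\<^esub> x = \<zero>\<^bsub>U\<^esub>" by blast
    qed
    show "Group.comm_monoid U"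
    proof (rule comm_monoidI)
      show "\<one>\<^bsub>U\<^esub> \<in> carrier U" using zc A0 unfolding eU carU by blast
      fix x y w assume x: "x \<in> carrier U" and y: "y \<in> carrier U" and w: "w \<in> carrier U"
      obtain A where A: "A \<in> \<A>" "x \<in> carrier A" "y \<in> carrier A" "w \<in> carrier A" using three[OF x y w] by blast
      interpret A: cring A using crA[OF A(1)] .
      show "x \<otimes>\<^bsub>U\<^esub> y \<in> carrier U" by (rule clU[OF x y])
      show "x \<otimes>\<^bsub>U\<^esub> y \<otimes>\<^bsub>U\<^esub> w = x \<otimes>\<^bsub>U\<^esub> (y \<otimes>\<^bsub>U\<^esub> w)"
        using A by (simp add: multU[OF A(1)] A.m_assoc)
      show "x \<otimes>\<^bsub>U\<^esub> y = y \<otimes>\<^bsub>U\<^esub> x" using A by (simp add: multU[OF A(1)] A.m_comm)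
      show "\<one>\<^bsub>U\<^esub> \<otimes>\<^bsub>U\<^esub> x = x" using A by (simp add: eU eA[OF A(1), symmetric] multU[OF A(1)])
    qed
    fix x y w assume x: "x \<in> carrier U" and y: "y \<in> carrier U" and w: "w \<in> carrier U"
    obtain A where A: "A \<in> \<A>" "x \<in> carrier A" "y \<in> carrier A" "w \<in> carrier A" using three[OF x y w] by blast
    interpret A: cring A using crA[OF A(1)] .
    show "(x \<oplus>\<^bsub>U\<^esub> y) \<otimes>\<^bsub>U\<^esub> w = x \<otimes>\<^bsub>U\<^esub> w \<oplus>\<^bsub>U\<^esub> y \<otimes>\<^bsub>U\<^esub> w"
      using A by (simp add: multU[OF A(1)] addU[OF A(1)] A.l_distr)
  qed
  then interpret U: cring U .
  have idA: "id \<in> ring_hom A U" if "A \<in> \<A>" for A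
    using that by (intro ring_hom_memI) (auto simp: carU addU multU eU eA)
  have "flag_ring U a l"
  proof
    interpret A: flag_ring A0 a l using flA[OF A0] .
    show "\<one>\<^bsub>U\<^esub> \<noteq> \<zero>\<^bsub>U\<^esub>" using A.one_not_zero unfolding eU zU eA[OF A0] zA[OF A0] .
    show "a i \<in> carrier U" if "i < l" for i using A.gen_closed[OF that] A0 unfolding carU by blast
    show "\<one>\<^bsub>U\<^esub> \<in> flag U a l"
      using flag_hom[OF idA[OF A0] A.ring_axioms U.ring_axioms A.gen_closed A.one_in_flag] eU eA[OF A0]
      by simp
    fix x assume "x \<in> carrier U"
    then obtain B where B: "B \<in> \<A>" "x \<in> carrier B" unfolding carU by blast
    interpret B: flag_ring B a l using flA[OF B(1)] .
    show "x \<in> Units U \<or> lowers_flag U a l x"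
      using B.unit_or_lowers[OF B(2)] ring_hom_Units[OF idA[OF B(1)] B.is_cring U.is_cring, of x]
        lowers_flag_hom[OF idA[OF B(1)] B.ring_axioms U.ring_axioms B.gen_closed B(2)] by auto
  qed
  moreover have "\<psi> \<in> ring_hom U L"
  proof (rule ring_hom_memI)
    fix x assume "x \<in> carrier U"
    then show "\<psi> x \<in> carrier L" using ring_hom_closed[OF hom] unfolding carU by blast
  next
    fix x y assume x: "x \<in> carrier U" and y: "y \<in> carrier U"
    obtain A where A: "A \<in> \<A>" "x \<in> carrier A" "y \<in> carrier A" using three[OF x y y] by blast
    show "\<psi> (x \<otimes>\<^bsub>U\<^esub> y) = \<psi> x \<otimes>\<^bsub>L\<^esub> \<psi> y" "\<psi> (x \<oplus>\<^bsub>U\<^esub> y) = \<psi> x \<oplus>\<^bsub>L\<^esub> \<psi> y"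
      using addU[OF A] multU[OF A] ring_hom_mult[OF hom] ring_hom_add[OF hom] A by simp_all
  next
    show "\<psi> \<one>\<^bsub>U\<^esub> = \<one>\<^bsub>L\<^esub>" using ring_hom_one[OF hom[OF A0]] eA[OF A0] eU by simp
  qed
  moreover have "ring_graph U = G"
  proof
    show "G \<subseteq> ring_graph U"
      unfolding G_def using addU multU carU by (auto simp: mem_ring_graph)
    show "ring_graph U \<subseteq> G"
    proof clarify
      fix x y s p assume m: "(x, y, s, p) \<in> ring_graph U"
      then have x: "x \<in> carrier U" and y: "y \<in> carrier U" by (auto simp: mem_ring_graph)
      obtain A where A: "A \<in> \<A>" "x \<in> carrier A" "y \<in> carrier A" using three[OF x y y] by blast
      show "(x, y, s, p) \<in> G" using m mem[OF A] addU[OF A] multU[OF A] by (simp add: mem_ring_graph)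
    qed
  qed
  ultimately show thesis using that zU eU unfolding flag_extension_def G_def by blast
qed

lemma maximal_flag_extension:
  assumes "flag_extension z e a l L \<psi> M"
  obtains S where "flag_extension z e a l L \<psi> S" "ring_graph M \<subseteq> ring_graph S"
    "\<And>A. flag_extension z e a l L \<psi> A \<Longrightarrow> ring_graph S \<subseteq> ring_graph A \<Longrightarrow> ring_graph A = ring_graph S"
proof -
  let ?ext = "flag_extension z e a l L \<psi>"
  let ?F = "ring_graph ` {A. ?ext A \<and> ring_graph M \<subseteq> ring_graph A}"
  have "\<exists>G\<in>?F. \<forall>H\<in>?F. G \<subseteq> H \<longrightarrow> H = G"
  proof (rule subset_Zorn_nonempty)
    show "?F \<noteq> {}" using assms by blast
    fix C assume C: "C \<noteq> {}" "subset.chain ?F C"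
    \<comment> \<open>Rings that differ only outside their carriers share a graph. Taking all rings
      whose graph lies in C avoids choosing among them.\<close>
    define \<A> where "\<A> = {A. ?ext A \<and> ring_graph M \<subseteq> ring_graph A \<and> ring_graph A \<in> C}"
    have img: "ring_graph ` \<A> = C"
      using C(2) unfolding pred_on.chain_def \<A>_def by auto
    obtain U where U: "?ext U" "ring_graph U = \<Union> (ring_graph ` \<A>)"
    proof (rule flag_extension_union[of \<A> z e a l L \<psi>])
      show "\<A> \<noteq> {}" using img C(1) by blast
      show "?ext A" if "A \<in> \<A>" for A using that unfolding \<A>_def by simp
      show "ring_graph A \<subseteq> ring_graph B \<or> ring_graph B \<subseteq> ring_graph A" if "A \<in> \<A>" "B \<in> \<A>" for A B
        using that C(2) unfolding pred_on.chain_def \<A>_def by blast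
    qed
    have "ring_graph M \<subseteq> ring_graph U" unfolding U(2) using img C(1) unfolding \<A>_def by blast
    then show "\<Union> C \<in> ?F" using U img by auto
  qed
  then obtain S where S: "?ext S" "ring_graph M \<subseteq> ring_graph S"
    and max: "\<And>A. ?ext A \<Longrightarrow> ring_graph M \<subseteq> ring_graph A \<Longrightarrow>
      ring_graph S \<subseteq> ring_graph A \<Longrightarrow> ring_graph A = ring_graph S" by auto
  show thesis by (rule that[OF S]) (use max S(2) in blast)
qed

text \<open>Otherwise an infinite type would be the union of two sets of smaller
  cardinality.\<close>

lemma card_diff_of_smaller:
  fixes B :: "'w set"
  assumes "infinite (UNIV :: 'w set)" "|B| <o |UNIV :: 'w set|"
  shows "|UNIV :: 'w set| \<le>o |UNIV - B|"
proof (rule ccontr)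
  assume "\<not> |UNIV :: 'w set| \<le>o |UNIV - B|"
  then have "|UNIV - B| <o |UNIV :: 'w set|" by (simp add: ordLess_or_ordLeq not_ordLeq_iff_ordLess)
  then have "|B \<union> (UNIV - B)| <o |UNIV :: 'w set|"
    using card_of_Un_ordLess_infinite[OF assms] by blast
  moreover have "B \<union> (UNIV - B) = UNIV" by blast
  ultimately show False using ordLess_irreflexive by fastforce
qed

text \<open>Elements are represented as pairs whose first component is the residue, so that extensions
  compatible with the residue map are just extensions of rings; the second component provides
  room, since every extension has at most as many elements as \<open>L\<close>.\<close>

theorem residue_field_extension:
  fixes L :: "('c, 'k) ring_scheme"
  assumes M: "flag_ring M a l" and L: "field L" and inf: "infinite (carrier L)"
    and \<phi>: "\<phi> \<in> ring_hom M L"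
    and alg: "\<And>\<beta>. \<beta> \<in> carrier L \<Longrightarrow> (ring.algebraic L over (\<phi> ` carrier M)) \<beta>"
  obtains S :: "('c \<times> 'c set) ring" and \<iota> \<psi> where
    "flag_ring S (\<iota> \<circ> a) l" "\<iota> \<in> ring_hom M S" "inj_on \<iota> (carrier M)"
    "\<psi> \<in> ring_hom S L" "\<psi> ` carrier S = carrier L"
proof -
  interpret M: flag_ring M a l by fact
  interpret L: field L by fact
  have "|carrier L| \<le>o |UNIV :: 'c set|" by (rule card_of_mono1) simp
  then have lt: "|carrier L| <o |UNIV :: 'c set set|"
    using card_of_Pow[of "UNIV :: 'c set"] by (metis Pow_UNIV ordLeq_ordLess_trans)
  have infW: "infinite (UNIV :: 'c set set)"
    using inf by (metis Finite_Set.finite_set finite_subset subset_UNIV)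
  \<comment> \<open>Labels come from \<open>'c set\<close>, which is strictly larger than L. After
    at most as many as L has elements are used up, enough remain for another ring of that
    size.\<close>
  have room: "\<exists>w. inj_on w Y \<and> w ` Y \<subseteq> UNIV - (B :: 'c set set)"
    if "|Y| \<le>o |carrier L|" "|B| \<le>o |carrier L|" for Y :: "'x set" and B
  proof -
    have "|UNIV :: 'c set set| \<le>o |UNIV - B|"
      using that(2) lt by (intro card_diff_of_smaller infW) (rule ordLeq_ordLess_trans)
    then have "|Y| \<le>o |UNIV - B|"
      using ordLeq_transitive[OF that(1) ordLeq_transitive[OF ordLess_imp_ordLeq[OF lt]]] by blast
    then show ?thesis using card_of_ordLeq[of Y "UNIV - B"] by blast
  qed
  obtain w :: "'a \<Rightarrow> 'c set" where w: "inj_on w (carrier M)"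
    using room[OF M.card_le_field[OF \<phi> L inf], of "{}"] by auto
  define j where "j x = (\<phi> x, w x)" for x
  have j: "inj_on j (carrier M)" using w unfolding j_def inj_on_def by blast
  define M1 where "M1 = image_ring j M"
  define b where "b = j \<circ> a"
  have M1: "flag_ring M1 b l" unfolding M1_def b_def by (rule M.image_ring_flag_ring[OF j])
  have fM1: "fst \<in> ring_hom M1 L"
    unfolding M1_def by (rule hom_from_image_ring[OF M.ring_axioms j \<phi>]) (simp add: j_def)
  let ?ext = "flag_extension \<zero>\<^bsub>M1\<^esub> \<one>\<^bsub>M1\<^esub> b l L fst"
  obtain S where S: "?ext S" and sub: "ring_graph M1 \<subseteq> ring_graph S"
    and max: "\<And>A. ?ext A \<Longrightarrow> ring_graph S \<subseteq> ring_graph A \<Longrightarrow>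
      ring_graph A = ring_graph S"
    using maximal_flag_extension[of "\<zero>\<^bsub>M1\<^esub>" "\<one>\<^bsub>M1\<^esub>" b l L fst M1] M1 fM1
    unfolding flag_extension_def by blast
  have flS: "flag_ring S b l" and fS: "fst \<in> ring_hom S L" and zS: "\<zero>\<^bsub>S\<^esub> = \<zero>\<^bsub>M1\<^esub>" and oS: "\<one>\<^bsub>S\<^esub> = \<one>\<^bsub>M1\<^esub>"
    using S unfolding flag_extension_def by auto
  have idS: "id \<in> ring_hom M1 S" by (rule ring_graph_subset_hom[OF sub oS[symmetric]])
  interpret S: flag_ring S b l by (rule flS)
  have "\<phi> ` carrier M \<subseteq> fst ` carrier S"
    using ring_graph_subset(1)[OF sub] unfolding M1_def image_ring_carrier j_def by force
  then have algS: "(ring.algebraic L over (fst ` carrier S)) \<beta>" if "\<beta> \<in> carrier L" for \<beta>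
    using L.algebraic_mono[OF _ alg[OF that]] by blast
  interpret residue_hom S b l L fst
    by unfold_locales (use fS algS in auto)
  have "fst ` carrier S = carrier L"
  proof (rule ccontr)
    assume "fst ` carrier S \<noteq> carrier L"
    then obtain \<alpha> where \<alpha>: "\<alpha> \<in> carrier L" "\<alpha> \<notin> fst ` carrier S"
      using ring_hom_closed[OF fS] by blast
    obtain T :: "(nat \<Rightarrow> 'c \<times> 'c set) set ring" and \<iota> \<psi> where T: "flag_ring T (\<iota> \<circ> b) l"
      "\<iota> \<in> ring_hom S T" "inj_on \<iota> (carrier S)" "\<psi> \<in> ring_hom T L"
      "\<And>x. x \<in> carrier S \<Longrightarrow> \<psi> (\<iota> x) = fst x" "\<alpha> \<in> \<psi> ` carrier T"
      using adjoin_root[OF \<alpha>(1)] by blast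
    interpret T: flag_ring T "\<iota> \<circ> b" l by (rule T(1))
    have "|snd ` carrier S| \<le>o |carrier L|"
      using S.card_le_field[OF fS L inf] card_of_image ordLeq_transitive by blast
    then obtain w :: "(nat \<Rightarrow> 'c \<times> 'c set) set \<Rightarrow> 'c set"
      where w: "inj_on w (carrier T)" "w ` carrier T \<subseteq> UNIV - snd ` carrier S"
      using room[OF T.card_le_field[OF T(4) L inf]] by blast
    define k where "k y = (if y \<in> \<iota> ` carrier S then inv_into (carrier S) \<iota> y else (\<psi> y, w y))" for y
    have k\<iota>: "k (\<iota> x) = x" if "x \<in> carrier S" for x using that T(3) unfolding k_def by simp
    have k: "inj_on k (carrier T)"
    proof (rule inj_onI)
      fix y y' assume y: "y \<in> carrier T" "y' \<in> carrier T" "k y = k y'"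
      have out: "k y \<notin> carrier S" if "y \<in> carrier T" "y \<notin> \<iota> ` carrier S" for y
      proof
        assume "k y \<in> carrier S"
        then have "w y \<in> snd ` carrier S" using that(2) unfolding k_def by (metis image_eqI snd_conv)
        then show False using w(2) that(1) by blast
      qed
      have inS: "k y \<in> carrier S" if "y \<in> \<iota> ` carrier S" for y using that k\<iota> by auto
      consider "y \<in> \<iota> ` carrier S" "y' \<in> \<iota> ` carrier S" | "y \<notin> \<iota> ` carrier S" "y' \<notin> \<iota> ` carrier S"
        using out[OF y(1)] out[OF y(2)] y(3) inS[of y] inS[of y'] by argo
      then show "y = y'"
      proof cases
        case 1
        then show ?thesis using y(3) k\<iota> by auto
      next
        case 2
        then show ?thesis using y w(1) unfolding k_def inj_on_def by auto
      qed
    qed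
    have fk: "fst (k y) = \<psi> y" if "y \<in> carrier T" for y
      using T(5) k\<iota> unfolding k_def by (cases "y \<in> \<iota> ` carrier S") (auto simp: f_inv_into_f)
    define A where "A = image_ring k T"
    have kh: "k \<in> ring_hom T A" unfolding A_def by (rule image_ring_hom[OF k])
    have \<iota>c: "\<iota> x \<in> carrier T" if "x \<in> carrier S" for x using ring_hom_closed[OF T(2) that] .
    have "flag_ring A (k \<circ> (\<iota> \<circ> b)) l" unfolding A_def by (rule T.image_ring_flag_ring[OF k])
    then have "flag_ring A b l" by (rule flag_ring_cong) (simp add: k\<iota> S.gen_closed)
    moreover have "fst \<in> ring_hom A L"
      unfolding A_def by (rule hom_from_image_ring[OF T.ring_axioms k T(4) fk])
    moreover have "\<zero>\<^bsub>A\<^esub> = \<zero>\<^bsub>M1\<^esub>"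
      using k\<iota>[OF S.zero_closed] ring_hom_zero[OF T(2) S.ring_axioms T.ring_axioms]
      by (simp add: A_def image_ring_zero zS)
    moreover have "\<one>\<^bsub>A\<^esub> = \<one>\<^bsub>M1\<^esub>"
      using k\<iota>[OF S.one_closed] ring_hom_one[OF T(2)] by (simp add: A_def image_ring_one oS)
    ultimately have "?ext A" unfolding flag_extension_def by blast
    moreover have "ring_graph S \<subseteq> ring_graph A"
    proof clarify
      fix x y s p assume "(x, y, s, p) \<in> ring_graph S"
      then have *: "x \<in> carrier S" "y \<in> carrier S" "s = x \<oplus>\<^bsub>S\<^esub> y" "p = x \<otimes>\<^bsub>S\<^esub> y"
        by (auto simp: mem_ring_graph)
      have "x \<in> carrier A" "y \<in> carrier A"
        using * k\<iota> \<iota>c ring_hom_closed[OF kh] by metis+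
      moreover have "x \<oplus>\<^bsub>A\<^esub> y = s"
        using ring_hom_add[OF kh \<iota>c \<iota>c, of x y] ring_hom_add[OF T(2), of x y] k\<iota>[of "x \<oplus>\<^bsub>S\<^esub> y"] k\<iota>[of x] k\<iota>[of y] * by simp
      moreover have "x \<otimes>\<^bsub>A\<^esub> y = p"
        using ring_hom_mult[OF kh \<iota>c \<iota>c, of x y] ring_hom_mult[OF T(2), of x y] k\<iota>[of "x \<otimes>\<^bsub>S\<^esub> y"] k\<iota>[of x] k\<iota>[of y] * by simp
      ultimately show "(x, y, s, p) \<in> ring_graph A" by (simp add: mem_ring_graph)
    qed
    \<comment> \<open>Maximality of S identifies A with S, although A contains an element with
      residue \<alpha>.\<close>
    ultimately have "ring_graph A = ring_graph S" by (rule max)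
    then have "carrier A = carrier S" using fst_ring_graph by metis
    moreover obtain y where "y \<in> carrier T" "\<alpha> = \<psi> y" using T(6) by blast
    ultimately show False using fk[of y] ring_hom_closed[OF kh, of y] \<alpha>(2) by force
  qed
  moreover have "id \<circ> j \<in> ring_hom M S"
    using image_ring_hom[OF j] idS unfolding M1_def by (rule ring_hom_trans)
  ultimately show thesis using that[of S j fst] flS j fS unfolding b_def by simp
qed

section \<open>Algebraically closed fields, and the size of an algebraic closure\<close>

lemma (in ring) eval_replicate_zero:
  assumes "x \<in> carrier R"
  shows "set q \<subseteq> carrier R \<Longrightarrow> eval (replicate n \<zero> @ q) x = eval q x"
proof (induction n)
  case (Suc n)
  then show ?case using assms by (simp add: eval_in_carrier)
qed simp

lemma (in algebraically_closed) exists_root: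
  assumes "p \<in> carrier (poly_ring L)" "degree p > 0"
  shows "\<exists>x\<in>carrier L. eval p x = \<zero>"
proof -
  have "size (roots p) \<noteq> 0"
    using roots_over_carrier[OF assms(1)] assms(2) unfolding splitted_def by simp
  then obtain x where "x \<in># roots p" by (metis multiset_nonemptyE size_empty)
  then show ?thesis using roots_mem_iff_is_root[OF assms(1)] unfolding is_root_def by auto
qed

text \<open>In a field with \<open>q\<close> elements the polynomial \<open>x ^ q - x + 1\<close> has no root.\<close>

lemma (in algebraically_closed) infinite_carrier: "infinite (carrier L)"
proof
  assume fin: "finite (carrier L)"
  define G where "G = Multiplicative_Group.mult_of L"
  interpret G: group G unfolding G_def by (rule field_mult_group)
  have carG: "carrier G = carrier L - {\<zero>}" unfolding G_def by simp
  have "card {\<zero>, \<one>} \<le> card (carrier L)" by (rule card_mono[OF fin]) auto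
  then have two: "2 \<le> card (carrier L)" by simp
  define q where "q = card (carrier L)"
  have ordG: "order G = q - 1" unfolding order_def carG q_def using fin by simp
  have fermat: "x [^] q = x" if x: "x \<in> carrier L" for x
  proof (cases "x = \<zero>")
    case True
    then show ?thesis using two by (simp add: q_def nat_pow_zero)
  next
    case False
    then have "x [^]\<^bsub>G\<^esub> (q - 1) = \<one>\<^bsub>G\<^esub>" using G.pow_order_eq_1[of x] x carG ordG by simp
    then have "x [^] (q - 1) = \<one>" unfolding G_def by (simp add: Multiplicative_Group.nat_pow_mult_of)
    then have "x [^] Suc (q - 1) = x" using x by simp
    then show ?thesis using two by (simp add: q_def)
  qed
  \<comment> \<open>Coefficients run from the top: after the leading 1 there are
    \<open>q - 2\<close> zeros for the degrees q - 1 down to 2, then \<open>\<ominus> \<one>\<close>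
    and \<open>\<one>\<close>. The subtraction is exact because q is at least 2.\<close>
  define p where "p = \<one> # replicate (q - 2) \<zero> @ [\<ominus> \<one>, \<one>]"
  have p: "p \<in> carrier (poly_ring L)"
    unfolding p_def univ_poly_carrier[symmetric] polynomial_def by auto
  have "degree p = q" using two unfolding p_def q_def by simp
  then obtain x where x: "x \<in> carrier L" "eval p x = \<zero>"
    using exists_root[OF p(1)] two unfolding q_def by auto
  have "length (replicate (q - 2) \<zero> @ [\<ominus> \<one>, \<one>]) = q" using two unfolding q_def by simp
  then have "eval p x = x [^] q \<oplus> eval [\<ominus> \<one>, \<one>] x"
    unfolding p_def using x(1) eval_replicate_zero[OF x(1), of "[\<ominus> \<one>, \<one>]" "q - 2"] by simp
  also have "\<dots> = x \<oplus> ((\<ominus> \<one>) \<otimes> x \<oplus> \<one>)" unfolding fermat[OF x(1)] using x(1) by simp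
  also have "\<dots> = \<one>" using x(1) by algebra
  finally show False using x(2) by simp
qed

text \<open>Every element of the closure is a root of a nonzero polynomial over the base. There are
  at most as many polynomials as coefficient lists, and each has finitely many roots. As the base
  may be finite, the bound is stated against an arbitrary infinite \<open>W\<close>.\<close>

lemma (in field) small_algebraic_closure:
  obtains L :: "(('a list \<times> nat) multiset \<Rightarrow> 'a) ring" and i where
    "algebraically_closed L" "i \<in> ring_hom R L"
    "\<And>\<beta>. \<beta> \<in> carrier L \<Longrightarrow> (ring.algebraic L over (i ` carrier R)) \<beta>"
    "\<And>W :: 'w set. infinite W \<Longrightarrow> |carrier R| \<le>o |W| \<Longrightarrow> |carrier L| \<le>o |W|"
proof -
  define L where "L = alg_closure"
  define K :: "(('a list \<times> nat) multiset \<Rightarrow> 'a) set" where "K = indexed_const ` carrier R"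
  have ac: "algebraic_closure L K" and i: "indexed_const \<in> ring_hom R L"
    using alg_closureE unfolding L_def K_def by auto
  interpret L: algebraic_closure L K by (rule ac)
  have "|carrier L| \<le>o |W|" if W: "infinite W" "|carrier R| \<le>o |W|" for W :: "'w set"
  proof -
    let ?P = "{p \<in> carrier (K[X]\<^bsub>L\<^esub>). p \<noteq> []}"
    have K: "subring K L" using subfieldE(1)[OF L.subfield_axioms] .
    have "|K| \<le>o |W|" unfolding K_def using card_of_image W(2) ordLeq_transitive by blast
    then have "|lists K| \<le>o |lists W|" by simp
    then have lK: "|lists K| \<le>o |W|"
      using card_of_lists_infinite[OF W(1)] ordLeq_ordIso_trans by blast
    have "?P \<subseteq> lists K" unfolding univ_poly_carrier[symmetric] polynomial_def by auto
    then have P: "|?P| \<le>o |W|" using card_of_mono1 lK ordLeq_transitive by blast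
    have fin: "finite {x. L.is_root p x}" if "p \<in> ?P" for p
      using L.finite_number_of_roots L.carrier_polynomial_shell[OF K] that by blast
    have "\<forall>p\<in>?P. |{x. L.is_root p x}| \<le>o |W|"
    proof
      fix p assume "p \<in> ?P"
      from fin[OF this] show "|{x. L.is_root p x}| \<le>o |W|"
        using W(1) by (simp add: ordLess_imp_ordLeq)
    qed
    then have "|\<Union>p\<in>?P. {x. L.is_root p x}| \<le>o |W|" by (rule card_of_UNION_ordLeq_infinite[OF W(1) P])
    moreover have "carrier L \<subseteq> (\<Union>p\<in>?P. {x. L.is_root p x})"
    proof
      fix x assume x: "x \<in> carrier L"
      obtain p where "p \<in> carrier (K[X]\<^bsub>L\<^esub>)" "p \<noteq> []" "L.eval p x = \<zero>\<^bsub>L\<^esub>"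
        using L.algebraicE[OF K x L.algebraic_extension[OF x]] by blast
      then show "x \<in> (\<Union>p\<in>?P. {x. L.is_root p x})" using x unfolding L.is_root_def by blast
    qed
    ultimately show ?thesis using card_of_mono1 ordLeq_transitive by blast
  qed
  then show thesis
    using that[of L indexed_const] i L.algebraic_extension L.algebraically_closed_axioms
    unfolding K_def by blast
qed

text \<open>L is an algebraic closure of the residue field of M. The extension first lives in a type
  built from that closure, but it has at most as many elements as L and can be copied into any
  infinite type \<open>'w\<close> that is large enough for M.\<close>

theorem algebraically_closed_residue_extension:
  fixes M :: "('b, 'm) ring_scheme"
  assumes M: "flag_ring M a l" and small: "|carrier M| \<le>o |UNIV :: 'w set|" and inf: "infinite (UNIV :: 'w set)"
  obtains S :: "'w ring" and L :: "(('b set list \<times> nat) multiset \<Rightarrow> 'b set) ring" and \<iota> \<psi> where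
    "flag_ring S (\<iota> \<circ> a) l" "\<iota> \<in> ring_hom M S" "inj_on \<iota> (carrier M)"
    "algebraically_closed L" "\<psi> \<in> ring_hom S L" "\<psi> ` carrier S = carrier L"
proof -
  interpret M: flag_ring M a l by fact
  define \<nn> where "\<nn> = carrier M - Units M"
  interpret n: maximalideal \<nn> M unfolding \<nn>_def by (rule M.nonunits_maximal)
  define K where "K = M Quot \<nn>"
  interpret K: field K unfolding K_def by (rule n.quotient_is_field[OF M.is_cring])
  have "carrier K = (+>\<^bsub>M\<^esub>) \<nn> ` carrier M" unfolding K_def by (rule n.quotient_carrier)
  then have cK: "|carrier K| \<le>o |UNIV :: 'w set|"
    using card_of_image small ordLeq_transitive by metis
  obtain L :: "(('b set list \<times> nat) multiset \<Rightarrow> 'b set) ring" and i where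
    L: "algebraically_closed L" "i \<in> ring_hom K L"
    "\<And>\<beta>. \<beta> \<in> carrier L \<Longrightarrow> (ring.algebraic L over (i ` carrier K)) \<beta>"
    "|carrier L| \<le>o |UNIV :: 'w set|"
    using K.small_algebraic_closure inf cK by metis
  interpret L: algebraically_closed L by (rule L(1))
  define \<phi> where "\<phi> = i \<circ> (+>\<^bsub>M\<^esub>) \<nn>"
  have \<phi>: "\<phi> \<in> ring_hom M L"
    unfolding \<phi>_def using n.rcos_ring_hom L(2) unfolding K_def by (rule ring_hom_trans)
  have "\<phi> ` carrier M = i ` carrier K" unfolding \<phi>_def K_def n.quotient_carrier by (simp add: image_comp)
  then have alg: "(ring.algebraic L over (\<phi> ` carrier M)) \<beta>" if "\<beta> \<in> carrier L" for \<beta>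
    using L(3)[OF that] by simp
  obtain T :: "((('b set list \<times> nat) multiset \<Rightarrow> 'b set) \<times> (('b set list \<times> nat) multiset \<Rightarrow> 'b set) set) ring"
    and \<iota> \<psi> where T: "flag_ring T (\<iota> \<circ> a) l" "\<iota> \<in> ring_hom M T" "inj_on \<iota> (carrier M)"
    "\<psi> \<in> ring_hom T L" "\<psi> ` carrier T = carrier L"
    using residue_field_extension[OF M L.field_axioms L.infinite_carrier \<phi> alg] by blast
  interpret T: flag_ring T "\<iota> \<circ> a" l by (rule T(1))
  have "|carrier T| \<le>o |UNIV :: 'w set|"
    using T.card_le_field[OF T(4) L.field_axioms L.infinite_carrier] L(4) ordLeq_transitive by blast
  then obtain g :: "_ \<Rightarrow> 'w" where g: "inj_on g (carrier T)" using card_of_ordLeq by metis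
  let ?S = "image_ring g T"
  have gh: "g \<in> ring_hom T ?S" by (rule image_ring_hom[OF g])
  define \<psi>' where "\<psi>' = \<psi> \<circ> inv_into (carrier T) g"
  have \<psi>': "\<psi>' (g x) = \<psi> x" if "x \<in> carrier T" for x using that g unfolding \<psi>'_def by simp
  have "flag_ring ?S ((g \<circ> \<iota>) \<circ> a) l" using T.image_ring_flag_ring[OF g] by (simp add: comp_assoc)
  moreover have "g \<circ> \<iota> \<in> ring_hom M ?S" using T(2) gh by (rule ring_hom_trans)
  moreover have "inj_on (g \<circ> \<iota>) (carrier M)"
    using T(3) g ring_hom_closed[OF T(2)] by (intro comp_inj_on) (auto intro: inj_on_subset)
  moreover have "\<psi>' \<in> ring_hom ?S L" by (rule hom_from_image_ring[OF T.ring_axioms g T(4) \<psi>'])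
  moreover have "\<psi>' ` carrier ?S = carrier L"
    unfolding image_ring_carrier image_image T(5)[symmetric] using \<psi>' by (rule image_cong[OF refl])
  ultimately show thesis using that L(1) by blast
qed

section \<open>Ultrapowers\<close>

locale ultrafilter =
  fixes \<U> :: "'i set set"
  assumes empty_notin: "{} \<notin> \<U>"
    and upward: "A \<in> \<U> \<Longrightarrow> A \<subseteq> B \<Longrightarrow> B \<in> \<U>"
    and inter: "A \<in> \<U> \<Longrightarrow> B \<in> \<U> \<Longrightarrow> A \<inter> B \<in> \<U>"
    and dichotomy: "A \<in> \<U> \<or> - A \<in> \<U>"
begin

lemma UNIV_in: "UNIV \<in> \<U>"
  using dichotomy[of UNIV] empty_notin by simp

end

lemma exists_ultrafilter:
  fixes \<B> :: "'i set set"
  assumes fip: "\<And>F. finite F \<Longrightarrow> F \<subseteq> \<B> \<Longrightarrow> \<Inter> F \<noteq> {}"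
  obtains \<U> where "ultrafilter \<U>" "\<B> \<subseteq> \<U>"
proof -
  let ?P = "\<lambda>\<U>. \<forall>F. finite F \<longrightarrow> F \<subseteq> \<U> \<longrightarrow> \<Inter> F \<noteq> {}"
  let ?A = "{\<U>. \<B> \<subseteq> \<U> \<and> ?P \<U>}"
  have "\<exists>\<U>\<in>?A. \<forall>\<V>\<in>?A. \<U> \<subseteq> \<V> \<longrightarrow> \<V> = \<U>"
  proof (rule subset_Zorn_nonempty)
    show "?A \<noteq> {}" using fip by blast
    fix C assume C: "C \<noteq> {}" "subset.chain ?A C"
    have "\<Inter> F \<noteq> {}" if F: "finite F" "F \<subseteq> \<Union> C" for F
    proof -
      obtain \<V> where "\<V> \<in> C" "F \<subseteq> \<V>" by (rule finite_subset_Union_chain[OF F C])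
      then show ?thesis using C(2) F(1) unfolding pred_on.chain_def by blast
    qed
    moreover have "\<B> \<subseteq> \<Union> C" using C unfolding pred_on.chain_def by blast
    ultimately show "\<Union> C \<in> ?A" by simp
  qed
  then obtain \<U> where "\<U> \<in> ?A" and max: "\<forall>\<V>\<in>?A. \<U> \<subseteq> \<V> \<longrightarrow> \<V> = \<U>" by (rule bexE)
  then have B: "\<B> \<subseteq> \<U>" and P: "\<And>F. finite F \<Longrightarrow> F \<subseteq> \<U> \<Longrightarrow> \<Inter> F \<noteq> {}" by auto
  \<comment> \<open>By maximality, each non-member is disjoint from a finite intersection of
    members. Every filter law below follows by combining such intersections.\<close>
  have out: "\<exists>F. finite F \<and> F \<subseteq> \<U> \<and> A \<inter> \<Inter> F = {}" if "A \<notin> \<U>" for A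
  proof (rule ccontr)
    assume "\<not> ?thesis"
    then have n: "A \<inter> \<Inter> F \<noteq> {}" if "finite F" "F \<subseteq> \<U>" for F using that by blast
    have "\<Inter> F \<noteq> {}" if F: "finite F" "F \<subseteq> insert A \<U>" for F
    proof -
      have "finite (F - {A})" "F - {A} \<subseteq> \<U>" using F by auto
      then have "A \<inter> \<Inter> (F - {A}) \<noteq> {}" by (rule n)
      then show ?thesis by blast
    qed
    then have "insert A \<U> \<in> ?A" using B by blast
    then have "insert A \<U> = \<U>" using max[rule_format, of "insert A \<U>"] by blast
    then show False using that by blast
  qed
  have "ultrafilter \<U>"
  proof
    show "{} \<notin> \<U>" using P[of "{{}}"] by auto
    show "C \<in> \<U>" if A: "A \<in> \<U>" "A \<subseteq> C" for A C
    proof (rule ccontr)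
      assume "C \<notin> \<U>"
      from out[OF this] obtain F where F: "finite F" "F \<subseteq> \<U>" "C \<inter> \<Inter> F = {}" by auto
      have "\<Inter> (insert A F) = {}" using F(3) A(2) by auto
      then show False using P[of "insert A F"] A(1) F by simp
    qed
    show "A \<inter> C \<in> \<U>" if A: "A \<in> \<U>" "C \<in> \<U>" for A C
    proof (rule ccontr)
      assume "A \<inter> C \<notin> \<U>"
      from out[OF this] obtain F where F: "finite F" "F \<subseteq> \<U>" "A \<inter> C \<inter> \<Inter> F = {}" by auto
      have "\<Inter> (insert A (insert C F)) = {}" using F(3) by auto
      then show False using P[of "insert A (insert C F)"] A F by simp
    qed
    show "A \<in> \<U> \<or> - A \<in> \<U>" for A
    proof (rule ccontr)
      assume "\<not> ?thesis"
      then have "A \<notin> \<U>" "- A \<notin> \<U>" by auto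
      then obtain F G where F: "finite F" "F \<subseteq> \<U>" "A \<inter> \<Inter> F = {}"
        and G: "finite G" "G \<subseteq> \<U>" "- A \<inter> \<Inter> G = {}"
        using out[of A] out[of "- A"] by auto
      have "\<Inter> (F \<union> G) = {}" unfolding Inter_Un_distrib using F(3) G(3) by blast
      then show False using P[of "F \<union> G"] F G by simp
    qed
  qed
  then show thesis using that B by blast
qed

section \<open>Rings of functions and their ultrapowers\<close>

definition fun_ring :: "('a, 'm) ring_scheme \<Rightarrow> ('i \<Rightarrow> 'a) ring" where
  "fun_ring R = \<lparr>carrier = {f. \<forall>i. f i \<in> carrier R}, monoid.mult = (\<lambda>f g i. f i \<otimes>\<^bsub>R\<^esub> g i),
     one = (\<lambda>i. \<one>\<^bsub>R\<^esub>), ring.zero = (\<lambda>i. \<zero>\<^bsub>R\<^esub>), ring.add = (\<lambda>f g i. f i \<oplus>\<^bsub>R\<^esub> g i)\<rparr>"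

lemma fun_ring_simps:
  "f \<in> carrier (fun_ring R) \<longleftrightarrow> (\<forall>i. f i \<in> carrier R)"
  "f \<otimes>\<^bsub>fun_ring R\<^esub> g = (\<lambda>i. f i \<otimes>\<^bsub>R\<^esub> g i)" "f \<oplus>\<^bsub>fun_ring R\<^esub> g = (\<lambda>i. f i \<oplus>\<^bsub>R\<^esub> g i)"
  "\<one>\<^bsub>fun_ring R\<^esub> = (\<lambda>i. \<one>\<^bsub>R\<^esub>)" "\<zero>\<^bsub>fun_ring R\<^esub> = (\<lambda>i. \<zero>\<^bsub>R\<^esub>)"
  unfolding fun_ring_def by simp_all

lemma (in cring) fun_ring_cring: "cring (fun_ring R)"
proof (intro cringI abelian_groupI comm_monoidI)
  fix f assume f: "f \<in> carrier (fun_ring R)"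
  show "\<exists>g\<in>carrier (fun_ring R). g \<oplus>\<^bsub>fun_ring R\<^esub> f = \<zero>\<^bsub>fun_ring R\<^esub>"
    using f by (intro bexI[of _ "\<lambda>i. \<ominus> f i"]) (simp_all add: fun_ring_simps l_neg)
qed (simp_all add: fun_ring_simps fun_eq_iff a_ac m_ac r_distr)

lemma (in cring) fun_ring_minus:
  fixes f g :: "'i \<Rightarrow> 'a"
  assumes "f \<in> carrier (fun_ring R)" "g \<in> carrier (fun_ring R)"
  shows "f \<ominus>\<^bsub>fun_ring R\<^esub> g = (\<lambda>i. f i \<ominus> g i)"
proof -
  interpret F: cring "fun_ring R :: ('i \<Rightarrow> 'a) ring" by (rule fun_ring_cring)
  have "(\<lambda>i. \<ominus> g i) \<in> carrier (fun_ring R)" using assms(2) by (simp add: fun_ring_simps)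
  moreover have "(\<lambda>i. \<ominus> g i) \<oplus>\<^bsub>fun_ring R\<^esub> g = \<zero>\<^bsub>fun_ring R\<^esub>"
    using assms(2) by (simp add: fun_ring_simps l_neg)
  ultimately have "\<ominus>\<^bsub>fun_ring R\<^esub> g = (\<lambda>i. \<ominus> g i)" using assms(2) F.minus_equality by simp
  then show ?thesis by (simp add: a_minus_def fun_ring_simps)
qed

text \<open>The generators and their number are the same at every index, so the coefficients chosen
  pointwise assemble into functions, however large the index set.\<close>

lemma (in cring) flag_pointwise:
  assumes "\<And>i. f i \<in> flag R a n"
  shows "f \<in> flag (fun_ring R) ((\<lambda>c i. c) \<circ> a) n"
  using assms
proof (induction n arbitrary: f)
  case 0
  then show ?case by (auto simp: fun_ring_simps)
next
  case (Suc n)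
  then have "\<forall>i. \<exists>x r. f i = x \<oplus> r \<otimes> a n \<and> x \<in> flag R a n \<and> r \<in> carrier R" by simp
  then obtain x r where xr: "\<And>i. f i = x i \<oplus> r i \<otimes> a n" "\<And>i. x i \<in> flag R a n" "\<And>i. r i \<in> carrier R"
    by metis
  have "f = x \<oplus>\<^bsub>fun_ring R\<^esub> r \<otimes>\<^bsub>fun_ring R\<^esub> ((\<lambda>c i. c) \<circ> a) n" using xr(1) by (auto simp: fun_ring_simps)
  moreover have "x \<in> flag (fun_ring R) ((\<lambda>c i. c) \<circ> a) n" using Suc.IH xr(2) by blast
  moreover have "r \<in> carrier (fun_ring R)" using xr(3) by (simp add: fun_ring_simps)
  ultimately show ?case by (auto simp del: o_apply)
qed

locale flag_ring_ultrapower = flag_ring R a l + ultrafilter \<U>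
  for R (structure) and a l and \<U> :: "'i set set"
begin

abbreviation FR :: "('i \<Rightarrow> 'a) ring" where "FR \<equiv> fun_ring R"

definition null_functions :: "('i \<Rightarrow> 'a) set" where
  "null_functions = {f \<in> carrier FR. {i. f i = \<zero>} \<in> \<U>}"

lemma null_ideal: "ideal null_functions FR"
proof -
  interpret F: cring FR by (rule fun_ring_cring)
  show ?thesis
  proof (rule F.ideal_subsetI)
    show "null_functions \<subseteq> carrier FR" unfolding null_functions_def by blast
    show "\<zero>\<^bsub>FR\<^esub> \<in> null_functions"
      unfolding null_functions_def using UNIV_in by (simp add: fun_ring_simps)
  next
    fix f g :: "'i \<Rightarrow> 'a" assume "f \<in> null_functions" "g \<in> null_functions"
    then have "f \<oplus>\<^bsub>FR\<^esub> g \<in> carrier FR" "{i. f i = \<zero>} \<inter> {i. g i = \<zero>} \<in> \<U>"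
      unfolding null_functions_def using inter by auto
    moreover have "{i. f i = \<zero>} \<inter> {i. g i = \<zero>} \<subseteq> {i. (f \<oplus>\<^bsub>FR\<^esub> g) i = \<zero>}"
      by (auto simp: fun_ring_simps)
    ultimately show "f \<oplus>\<^bsub>FR\<^esub> g \<in> null_functions"
      unfolding null_functions_def using upward by blast
  next
    fix f g :: "'i \<Rightarrow> 'a" assume f: "f \<in> null_functions" and g: "g \<in> carrier FR"
    then have "g \<otimes>\<^bsub>FR\<^esub> f \<in> carrier FR" "{i. f i = \<zero>} \<in> \<U>"
      unfolding null_functions_def by auto
    moreover have "{i. f i = \<zero>} \<subseteq> {i. (g \<otimes>\<^bsub>FR\<^esub> f) i = \<zero>}"
      using g by (auto simp: fun_ring_simps)
    ultimately show "g \<otimes>\<^bsub>FR\<^esub> f \<in> null_functions"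
      unfolding null_functions_def using upward by blast
  qed
qed

definition ultrapower :: "('i \<Rightarrow> 'a) set ring" where
  "ultrapower = FR Quot null_functions"

definition germ :: "('i \<Rightarrow> 'a) \<Rightarrow> ('i \<Rightarrow> 'a) set" where
  "germ f = null_functions +>\<^bsub>FR\<^esub> f"

lemma ultrapower_cring: "cring ultrapower"
  unfolding ultrapower_def by (rule ideal.quotient_is_cring[OF null_ideal fun_ring_cring])

lemma germ_hom: "germ \<in> ring_hom FR ultrapower"
  using ideal.rcos_ring_hom[OF null_ideal] unfolding ultrapower_def germ_def[abs_def] .

lemma ultrapower_carrier: "carrier ultrapower = germ ` carrier FR"
  unfolding ultrapower_def ideal.quotient_carrier[OF null_ideal] germ_def[abs_def] ..

lemma germ_eq_iff:
  assumes "f \<in> carrier FR" "g \<in> carrier FR"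
  shows "germ f = germ g \<longleftrightarrow> {i. f i = g i} \<in> \<U>"
proof -
  have "{i. f i \<ominus> g i = \<zero>} = {i. f i = g i}" using assms by (simp add: fun_ring_simps)
  moreover have "(\<lambda>i. f i \<ominus> g i) \<in> carrier FR" using assms by (simp add: fun_ring_simps)
  ultimately have "f \<ominus>\<^bsub>FR\<^esub> g \<in> null_functions \<longleftrightarrow> {i. f i = g i} \<in> \<U>"
    unfolding fun_ring_minus[OF assms] null_functions_def by simp
  then show ?thesis unfolding germ_def using ideal.rcos_eq_iff[OF null_ideal assms] by simp
qed

lemma germ_unit:
  assumes f: "f \<in> carrier FR" and u: "{i. f i \<in> Units R} \<in> \<U>"
  shows "germ f \<in> Units ultrapower"
proof -
  interpret F: cring FR by (rule fun_ring_cring)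
  interpret P: cring ultrapower by (rule ultrapower_cring)
  \<comment> \<open>The value \<open>\<zero>\<close> is only a default: the product has to be 1
    merely on the set where f is a unit, which lies in \<U>.\<close>
  define g where "g i = (if f i \<in> Units R then inv (f i) else \<zero>)" for i
  have g: "g \<in> carrier FR" unfolding g_def by (simp add: fun_ring_simps)
  have "{i. f i \<in> Units R} \<subseteq> {i. (f \<otimes>\<^bsub>FR\<^esub> g) i = \<one>\<^bsub>FR\<^esub> i}"
    unfolding g_def by (auto simp: fun_ring_simps)
  then have "germ (f \<otimes>\<^bsub>FR\<^esub> g) = germ \<one>\<^bsub>FR\<^esub>"
    using germ_eq_iff f g upward[OF u] by simp
  then have "germ f \<otimes>\<^bsub>ultrapower\<^esub> germ g = \<one>\<^bsub>ultrapower\<^esub>"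
    using ring_hom_mult[OF germ_hom f g] ring_hom_one[OF germ_hom] by simp
  then show ?thesis
    using P.unit_factor_left[of "germ f" "germ g"] ring_hom_closed[OF germ_hom] f g by simp
qed

definition diagonal :: "'a \<Rightarrow> ('i \<Rightarrow> 'a) set" where
  "diagonal = germ \<circ> (\<lambda>c i. c)"

lemma diagonal_hom: "diagonal \<in> ring_hom R ultrapower"
proof -
  have "(\<lambda>c i. c) \<in> ring_hom R FR"
    by (intro ring_hom_memI) (auto simp: fun_ring_simps)
  then show ?thesis unfolding diagonal_def using germ_hom by (rule ring_hom_trans)
qed

lemma diagonal_inj: "inj_on diagonal (carrier R)"
proof (rule inj_onI)
  fix x y assume "x \<in> carrier R" "y \<in> carrier R" "diagonal x = diagonal y"
  then have "{i :: 'i. x = y} \<in> \<U>" unfolding diagonal_def by (simp add: germ_eq_iff fun_ring_simps)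
  then show "x = y" using empty_notin by (cases "x = y") auto
qed

text \<open>By the dichotomy of \<U>, a function is a unit almost everywhere or a non-unit almost
  everywhere.\<close>

lemma ultrapower_flag_ring: "flag_ring ultrapower (diagonal \<circ> a) l"
proof -
  interpret F: cring FR by (rule fun_ring_cring)
  interpret P: cring ultrapower by (rule ultrapower_cring)
  let ?b = "(\<lambda>c (i :: 'i). c) \<circ> a"
  have bc: "?b j \<in> carrier FR" if "j < l" for j
    using gen_closed[OF that] by (simp add: fun_ring_simps)
  have eq: "germ \<circ> ?b = diagonal \<circ> a" unfolding diagonal_def by (simp add: comp_assoc)
  show ?thesis
  proof
    show "\<one>\<^bsub>ultrapower\<^esub> \<noteq> \<zero>\<^bsub>ultrapower\<^esub>"
    proof
      assume "\<one>\<^bsub>ultrapower\<^esub> = \<zero>\<^bsub>ultrapower\<^esub>"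
      then have "germ \<one>\<^bsub>FR\<^esub> = germ \<zero>\<^bsub>FR\<^esub>"
        using ring_hom_one[OF germ_hom] ring_hom_zero[OF germ_hom F.ring_axioms P.ring_axioms] by simp
      then show False using germ_eq_iff[OF F.one_closed F.zero_closed] one_not_zero empty_notin
        by (simp add: fun_ring_simps)
    qed
    show "(diagonal \<circ> a) j \<in> carrier ultrapower" if "j < l" for j
      using ring_hom_closed[OF diagonal_hom gen_closed[OF that]] by simp
    show "\<one>\<^bsub>ultrapower\<^esub> \<in> flag ultrapower (diagonal \<circ> a) l"
      using flag_hom[OF diagonal_hom ring_axioms P.ring_axioms gen_closed one_in_flag]
        ring_hom_one[OF diagonal_hom] by simp
    fix x assume "x \<in> carrier ultrapower"
    then obtain f where f: "f \<in> carrier FR" "x = germ f" unfolding ultrapower_carrier by blast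
    show "x \<in> Units ultrapower \<or> lowers_flag ultrapower (diagonal \<circ> a) l x"
    proof (cases "{i. f i \<in> Units R} \<in> \<U>")
      case True
      then show ?thesis using germ_unit f by blast
    next
      case False
      then have c: "- {i. f i \<in> Units R} \<in> \<U>" using dichotomy by blast
      \<comment> \<open>Zero is a non-unit, so after this change on a negligible set the function
        lowers the flag at every index.\<close>
      define g where "g i = (if f i \<in> Units R then \<zero> else f i)" for i
      have g: "g \<in> carrier FR" "\<And>i. g i \<in> carrier R" "\<And>i. g i \<notin> Units R"
        using f(1) one_not_zero unfolding g_def Units_def by (auto simp: fun_ring_simps)
      have "- {i. f i \<in> Units R} \<subseteq> {i. f i = g i}" unfolding g_def by auto
      then have x: "x = germ g" using germ_eq_iff[OF f(1) g(1)] upward[OF c] f(2) by simp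
      have "lowers_flag FR ?b l g"
        unfolding lowers_flag_def
      proof (intro allI impI)
        fix j assume "j < l"
        then have "g i \<otimes> a j \<in> flag R a j" for i
          using nonunit_iff_lowers g(2,3) unfolding lowers_flag_def by blast
        then have "(\<lambda>i. g i \<otimes> a j) \<in> flag FR ?b j" by (rule flag_pointwise)
        then show "g \<otimes>\<^bsub>FR\<^esub> ?b j \<in> flag FR ?b j" by (simp add: fun_ring_simps)
      qed
      then have "lowers_flag ultrapower (germ \<circ> ?b) l (germ g)"
        using lowers_flag_hom[OF germ_hom F.ring_axioms P.ring_axioms, of l ?b g] bc g(1) by blast
      then show ?thesis unfolding x eq by blast
    qed
  qed
qed

end

text \<open>An infinite R is no larger than its residue field, so its finite lists can be coded by
  distinct residues. Representatives of distinct residues differ by units.\<close>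

lemma (in flag_ring) unit_separated_lists:
  assumes "infinite (carrier R)"
  obtains c :: "'a list \<Rightarrow> 'a" where
    "\<And>u. u \<in> lists (carrier R) \<Longrightarrow> c u \<in> carrier R"
    "\<And>u v. u \<in> lists (carrier R) \<Longrightarrow> v \<in> lists (carrier R) \<Longrightarrow> u \<noteq> v \<Longrightarrow> c u \<ominus> c v \<in> Units R"
proof -
  interpret n: maximalideal \<nn> R by (rule nonunits_maximal)
  have K: "field (R Quot \<nn>)" by (rule n.quotient_is_field[OF is_cring])
  let ?p = "(+>) \<nn>"
  have inf: "infinite (?p ` carrier R)"
    using finite_residues_imp_finite[OF n.rcos_ring_hom K] assms by blast
  have "|lists (carrier R)| \<le>o |?p ` carrier R|"
    using card_of_lists_infinite[OF assms] card_le_residues[OF n.rcos_ring_hom K inf]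
      ordIso_ordLeq_trans by blast
  then obtain e where e: "inj_on e (lists (carrier R))" "e ` lists (carrier R) \<subseteq> ?p ` carrier R"
    using card_of_ordLeq by metis
  define c where "c u = inv_into (carrier R) ?p (e u)" for u
  have c: "c u \<in> carrier R" "?p (c u) = e u" if "u \<in> lists (carrier R)" for u
  proof -
    have "e u \<in> ?p ` carrier R" using e(2) that by blast
    then show "c u \<in> carrier R" "?p (c u) = e u"
      unfolding c_def by (rule inv_into_into, rule f_inv_into_f)
  qed
  have "c u \<ominus> c v \<in> Units R" if uv: "u \<in> lists (carrier R)" "v \<in> lists (carrier R)" "u \<noteq> v" for u v
  proof (rule ccontr)
    assume "c u \<ominus> c v \<notin> Units R"
    then have "c u \<ominus> c v \<in> \<nn>" using c uv by simp
    then have "?p (c u) = ?p (c v)" using n.rcos_eq_iff[OF c(1) c(1)] uv by blast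
    then show False using c uv e(1) unfolding inj_on_def by metis
  qed
  then show thesis using that c(1) by blast
qed

text \<open>The ultrafilter on finite lists is chosen regular, i.e. it contains all the sets
  \<open>{u. x \<in> set u}\<close>; this makes the residue field of the ultrapower larger than \<open>R\<close>.\<close>

theorem (in flag_ring) large_residue_extension:
  obtains M :: "('a list \<Rightarrow> 'a) set ring" and \<iota> where
    "flag_ring M (\<iota> \<circ> a) l" "\<iota> \<in> ring_hom R M" "inj_on \<iota> (carrier R)"
    "|carrier M| \<le>o |UNIV :: ('a list \<Rightarrow> 'a) set|"
    "infinite (carrier R) \<Longrightarrow> \<exists>F. \<forall>Y\<in>Pow (carrier R). F Y \<in> carrier M \<and>
       (\<forall>Z\<in>Pow (carrier R). Y \<noteq> Z \<longrightarrow> F Y \<ominus>\<^bsub>M\<^esub> F Z \<in> Units M)"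
proof -
  \<comment> \<open>Finitely many of these sets always meet: some list contains any given finite set
    of elements.\<close>
  define \<B> where "\<B> = range (\<lambda>x. {u :: 'a list. x \<in> set u})"
  have "\<Inter> F \<noteq> {}" if F: "finite F" "F \<subseteq> \<B>" for F
  proof -
    obtain T where T: "finite T" "F = (\<lambda>x. {u. x \<in> set u}) ` T"
      using finite_subset_image[OF F[unfolded \<B>_def]] by blast
    obtain u where "set u = T" using finite_list[OF T(1)] by blast
    then have "u \<in> \<Inter> F" using T(2) by auto
    then show ?thesis by blast
  qed
  then obtain \<U> where U: "ultrafilter \<U>" "\<B> \<subseteq> \<U>" using exists_ultrafilter by blast
  interpret ultrafilter \<U> by (rule U(1))
  interpret flag_ring_ultrapower R a l \<U> ..
  interpret F: cring "fun_ring R :: ('a list \<Rightarrow> 'a) ring" by (rule fun_ring_cring)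
  have card: "|carrier ultrapower| \<le>o |UNIV :: ('a list \<Rightarrow> 'a) set|"
    unfolding ultrapower_carrier
    by (rule ordLeq_transitive[OF card_of_image card_of_mono1]) simp
  have "\<exists>F. \<forall>Y\<in>Pow (carrier R). F Y \<in> carrier ultrapower \<and>
       (\<forall>Z\<in>Pow (carrier R). Y \<noteq> Z \<longrightarrow> F Y \<ominus>\<^bsub>ultrapower\<^esub> F Z \<in> Units ultrapower)"
    if inf: "infinite (carrier R)"
  proof -
    obtain c :: "'a list \<Rightarrow> 'a" where c: "\<And>u. u \<in> lists (carrier R) \<Longrightarrow> c u \<in> carrier R"
      "\<And>u v. u \<in> lists (carrier R) \<Longrightarrow> v \<in> lists (carrier R) \<Longrightarrow> u \<noteq> v \<Longrightarrow> c u \<ominus> c v \<in> Units R"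
      using unit_separated_lists[OF inf] by blast
    \<comment> \<open>\<open>f Y\<close> codes the trace of \<open>Y\<close> on a finite list. If x
      belongs to exactly one of \<open>Y\<close> and \<open>Z\<close>, their traces differ on all
      lists containing x, a set in \<U>. So distinct subsets of R give germs with unit
      difference.\<close>
    define f where "f Y u = c (filter (\<lambda>x. x \<in> Y) u)" for Y u
    have f: "f Y \<in> carrier (fun_ring R)" if "Y \<subseteq> carrier R" for Y
      using that unfolding f_def fun_ring_simps by (auto intro!: c(1))
    have "germ (f Y) \<ominus>\<^bsub>ultrapower\<^esub> germ (f Z) \<in> Units ultrapower"
      if YZ: "Y \<subseteq> carrier R" "Z \<subseteq> carrier R" "Y \<noteq> Z" for Y Z
    proof -
      interpret g: ring_hom_ring "fun_ring R" ultrapower germ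
        using germ_hom ultrapower_cring
        by (intro ring_hom_ringI2 F.ring_axioms) (auto simp: cring_def)
      obtain x where x: "(x \<in> Y) \<noteq> (x \<in> Z)" using YZ(3) by blast
      have sub: "{u. x \<in> set u} \<subseteq> {u. (f Y \<ominus>\<^bsub>fun_ring R\<^esub> f Z) u \<in> Units R}"
      proof clarify
        fix u assume "x \<in> set u"
        then have "x \<in> set (filter (\<lambda>x. x \<in> Y) u) \<longleftrightarrow> x \<in> Y" "x \<in> set (filter (\<lambda>x. x \<in> Z) u) \<longleftrightarrow> x \<in> Z"
          by auto
        then have "filter (\<lambda>x. x \<in> Y) u \<noteq> filter (\<lambda>x. x \<in> Z) u" using x by metis
        moreover have "filter (\<lambda>x. x \<in> Y) u \<in> lists (carrier R)" "filter (\<lambda>x. x \<in> Z) u \<in> lists (carrier R)"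
          using YZ by auto
        ultimately show "(f Y \<ominus>\<^bsub>fun_ring R\<^esub> f Z) u \<in> Units R"
          unfolding fun_ring_minus[OF f f, OF YZ(1,2)] f_def using c(2) by blast
      qed
      have "{u. x \<in> set u} \<in> \<U>" using U(2) unfolding \<B>_def by blast
      then have "germ (f Y \<ominus>\<^bsub>fun_ring R\<^esub> f Z) \<in> Units ultrapower"
        using germ_unit[OF F.minus_closed[OF f f, OF YZ(1,2)] upward[OF _ sub]] by blast
      then show ?thesis using f YZ by (simp add: a_minus_def)
    qed
    then show ?thesis
      using f ring_hom_closed[OF germ_hom] by (intro exI[of _ "\<lambda>Y. germ (f Y)"]) simp
  qed
  then show thesis using that ultrapower_flag_ring diagonal_hom diagonal_inj card by blast
qed

section \<open>Essential extensions and the socle\<close>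

text \<open>Over a field the only non-unit is 0, so the socle is the whole field and its generator
  is a unit. This exception returns when the length is raised.\<close>

definition socle_generator :: "('a, 'm) ring_scheme \<Rightarrow> 'a \<Rightarrow> bool" where
  "socle_generator R s \<longleftrightarrow> s \<in> carrier R \<and> annihilator R (carrier R - Units R) = PIdl\<^bsub>R\<^esub> s"

lemma (in cring) annihilator_ideal:
  assumes "I \<subseteq> carrier R"
  shows "ideal (annihilator R I) R"
  using assms
  by (intro ideal_subsetI) (auto simp: annihilator_def l_distr m_assoc subset_iff)

lemma (in cring) socle_generatorI:
  assumes "s \<in> carrier R" "\<And>y. y \<in> carrier R - Units R \<Longrightarrow> s \<otimes> y = \<zero>"
    and "\<And>x. x \<in> carrier R \<Longrightarrow> (\<And>y. y \<in> carrier R - Units R \<Longrightarrow> x \<otimes> y = \<zero>) \<Longrightarrow>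
      \<exists>r\<in>carrier R. x = r \<otimes> s"
  shows "socle_generator R s"
proof -
  have "annihilator R (carrier R - Units R) \<subseteq> PIdl s"
    using assms(3) unfolding annihilator_def cgenideal_def by blast
  moreover have "PIdl s \<subseteq> annihilator R (carrier R - Units R)"
    using assms(1,2) unfolding annihilator_def cgenideal_def by (auto simp: m_assoc)
  ultimately show ?thesis using assms(1) unfolding socle_generator_def by blast
qed

lemma (in cring) socle_generatorD:
  assumes "socle_generator R s"
  shows "s \<in> carrier R" "y \<in> carrier R - Units R \<Longrightarrow> s \<otimes> y = \<zero>"
    and "x \<in> carrier R \<Longrightarrow> (\<And>y. y \<in> carrier R - Units R \<Longrightarrow> x \<otimes> y = \<zero>) \<Longrightarrow> \<exists>r\<in>carrier R. x = r \<otimes> s"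
proof -
  show s: "s \<in> carrier R" using assms unfolding socle_generator_def by blast
  show "s \<otimes> y = \<zero>" if "y \<in> carrier R - Units R"
    using assms cgenideal_self[OF s] that unfolding socle_generator_def annihilator_def by blast
  show "\<exists>r\<in>carrier R. x = r \<otimes> s"
    if "x \<in> carrier R" "\<And>y. y \<in> carrier R - Units R \<Longrightarrow> x \<otimes> y = \<zero>"
  proof -
    have "x \<in> annihilator R (carrier R - Units R)" using that unfolding annihilator_def by blast
    then show ?thesis using assms unfolding socle_generator_def cgenideal_def by blast
  qed
qed

lemma (in flag_ring) socle_generator_imp_gorenstein:
  assumes "socle_generator R s"
  shows "artinian_local_gorenstein_ring R (carrier R - Units R)"
proof -
  have s: "s \<in> carrier R" and ann: "annihilator R (carrier R - Units R) = PIdl s"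
    using assms unfolding socle_generator_def by auto
  have "principalideal (annihilator R (carrier R - Units R)) R"
    unfolding ann
    by (rule principalidealI) (use s cgenideal_ideal cgenideal_eq_genideal in auto)
  then show ?thesis
    using is_artinian_local
    by (simp add: artinian_local_gorenstein_ring_def artinian_local_gorenstein_ring_axioms_def)
qed

text \<open>If the socle contained independent elements \<open>s\<close> and \<open>t\<close>, the ideals generated by the
  elements \<open>t + c s\<close>, for \<open>c\<close> in a system of representatives of the residue field, would meet
  pairwise in \<open>0\<close>; but there are fewer elements in \<open>R\<close> than residues.\<close>

lemma (in flag_ring) essential_extension_socle_generator:
  assumes L: "field L" and \<psi>: "\<psi> \<in> ring_hom R L" "\<psi> ` carrier R = carrier L"
    and ess: "\<And>J. ideal J R \<Longrightarrow> J \<noteq> {\<zero>} \<Longrightarrow> \<exists>x\<in>B. x \<in> J \<and> x \<noteq> \<zero>"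
    and card: "\<not> |carrier L| \<le>o |B|"
  shows "\<exists>s. socle_generator R s"
proof (rule ccontr)
  assume none: "\<nexists>s. socle_generator R s"
  let ?n = "carrier R - Units R"
  interpret L: field L by fact
  interpret h: ring_hom_ring R L \<psi> using \<psi>(1) by (intro ring_hom_ringI2 ring_axioms L.ring_axioms)
  note zero_iff = hom_field_eq_zero_iff[OF \<psi>(1) L]
  have ann: "x \<in> annihilator R ?n \<longleftrightarrow> x \<in> carrier R \<and> (\<forall>y\<in>?n. x \<otimes> y = \<zero>)" for x
    unfolding annihilator_def by blast
  interpret N: ideal "annihilator R ?n" R by (rule annihilator_ideal) blast
  have gen: "\<exists>t\<in>annihilator R ?n. t \<notin> PIdl s" if "s \<in> annihilator R ?n" for s
  proof (rule ccontr)
    assume "\<not> ?thesis"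
    moreover have "PIdl s \<subseteq> annihilator R ?n"
      using that N.I_l_closed unfolding cgenideal_def by blast
    ultimately have "annihilator R ?n = PIdl s" by blast
    then show False using none that N.Icarr unfolding socle_generator_def by blast
  qed
  obtain s where s: "s \<in> annihilator R ?n" "s \<noteq> \<zero>"
    using gen[OF N.zero_closed] cgenideal_def[of R \<zero>] cgenideal_self[OF zero_closed] by force
  obtain t where t: "t \<in> annihilator R ?n" "t \<notin> PIdl s" using gen[OF s(1)] by blast
  have sc: "s \<in> carrier R" and tc: "t \<in> carrier R" using s t N.Icarr by auto
  have kill: "y \<otimes> x = \<zero>" if "x \<in> annihilator R ?n" "y \<in> ?n" for x y
    using that m_comm unfolding ann by fastforce
  have unit_mult: "x = \<zero>" if "y \<in> Units R" "x \<in> carrier R" "y \<otimes> x = \<zero>" for x y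
    using that by (metis Units_closed Units_inv_closed Units_l_inv l_one m_assoc r_null)
  define c where "c \<beta> = (SOME x. x \<in> carrier R \<and> \<psi> x = \<beta>)" for \<beta>
  have c: "c \<beta> \<in> carrier R" "\<psi> (c \<beta>) = \<beta>" if "\<beta> \<in> carrier L" for \<beta>
  proof -
    have "\<beta> \<in> \<psi> ` carrier R" using that unfolding \<psi>(2) .
    then have "\<exists>x. x \<in> carrier R \<and> \<psi> x = \<beta>" by auto
    from someI_ex[OF this] show "c \<beta> \<in> carrier R" "\<psi> (c \<beta>) = \<beta>" unfolding c_def by auto
  qed
  \<comment> \<open>The ideal of \<open>t \<oplus> c \<beta> \<otimes> s\<close> is nonzero and
    therefore meets B in a nonzero multiple. Non-units kill the socle, so the factor is a
    unit.\<close>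
  have "\<exists>x u. x \<in> B \<and> u \<in> Units R \<and> x = u \<otimes> (t \<oplus> c \<beta> \<otimes> s)" if \<beta>: "\<beta> \<in> carrier L" for \<beta>
  proof -
    let ?v = "t \<oplus> c \<beta> \<otimes> s"
    have v: "?v \<in> annihilator R ?n" using s(1) t(1) c(1)[OF \<beta>] N.a_closed N.I_l_closed by simp
    have vc: "?v \<in> carrier R" using v N.Icarr by blast
    have "?v \<noteq> \<zero>"
    proof
      assume "?v = \<zero>"
      then have "\<ominus> (c \<beta> \<otimes> s) = t" using tc sc c(1)[OF \<beta>] by (intro minus_equality) auto
      then have "t = (\<ominus> c \<beta>) \<otimes> s" using sc c(1)[OF \<beta>] by (simp add: l_minus)
      then show False using t(2) c(1)[OF \<beta>] unfolding cgenideal_def by blast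
    qed
    then have "PIdl ?v \<noteq> {\<zero>}" using cgenideal_self[OF vc] by blast
    then obtain x where x: "x \<in> B" "x \<in> PIdl ?v" "x \<noteq> \<zero>" using ess cgenideal_ideal[OF vc] by blast
    then obtain u where u: "u \<in> carrier R" "x = u \<otimes> ?v" unfolding cgenideal_def by blast
    then have "u \<in> Units R" using kill[OF v, of u] x(3) by blast
    then show ?thesis using x u by blast
  qed
  then obtain f u where fu: "\<And>\<beta>. \<beta> \<in> carrier L \<Longrightarrow> f \<beta> \<in> B"
    "\<And>\<beta>. \<beta> \<in> carrier L \<Longrightarrow> u \<beta> \<in> Units R"
    "\<And>\<beta>. \<beta> \<in> carrier L \<Longrightarrow> f \<beta> = u \<beta> \<otimes> (t \<oplus> c \<beta> \<otimes> s)" by metis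
  have "inj_on f (carrier L)"
  proof (rule inj_onI)
    fix \<beta> \<gamma> assume \<beta>: "\<beta> \<in> carrier L" and \<gamma>: "\<gamma> \<in> carrier L" and eq: "f \<beta> = f \<gamma>"
    \<comment> \<open>The equation \<open>f \<beta> = f \<gamma>\<close> becomes
      \<open>d \<otimes> t = e \<otimes> s\<close>. A unit d would put t into the ideal of s, so d
      kills t; then \<open>e \<otimes> s = \<zero>\<close> makes e a non-unit too. Passing to
      residues, first the factors agree, then \<beta> and \<gamma>.\<close>
    define d where "d = u \<beta> \<ominus> u \<gamma>"
    define e where "e = u \<gamma> \<otimes> c \<gamma> \<ominus> u \<beta> \<otimes> c \<beta>"
    have cl: "u \<beta> \<in> carrier R" "u \<gamma> \<in> carrier R" "c \<beta> \<in> carrier R" "c \<gamma> \<in> carrier R"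
      using fu(2) \<beta> \<gamma> c(1) by auto
    have de: "d \<in> carrier R" "e \<in> carrier R" using cl unfolding d_def e_def by auto
    have "d \<otimes> t \<ominus> e \<otimes> s = u \<beta> \<otimes> (t \<oplus> c \<beta> \<otimes> s) \<ominus> u \<gamma> \<otimes> (t \<oplus> c \<gamma> \<otimes> s)"
      unfolding d_def e_def using cl sc tc by algebra
    also have "\<dots> = \<zero>" using fu(3)[OF \<beta>] fu(3)[OF \<gamma>] eq cl sc tc by simp
    finally have dt: "d \<otimes> t = e \<otimes> s" using de sc tc by simp
    have "d \<notin> Units R"
    proof
      assume d: "d \<in> Units R"
      have "inv d \<otimes> (d \<otimes> t) = (inv d \<otimes> d) \<otimes> t" using d tc by (intro m_assoc[symmetric]) auto
      then have "t = inv d \<otimes> (d \<otimes> t)" using d tc by simp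
      also have "\<dots> = (inv d \<otimes> e) \<otimes> s" unfolding dt using d de sc by (simp add: m_assoc)
      finally show False using t(2) d de unfolding cgenideal_def by blast
    qed
    then have d0: "\<psi> d = \<zero>\<^bsub>L\<^esub>" and "d \<otimes> t = \<zero>" using zero_iff[OF de(1)] kill[OF t(1)] de(1) by auto
    then have "e \<notin> Units R" using unit_mult[of e s] dt sc s(2) by auto
    then have e0: "\<psi> e = \<zero>\<^bsub>L\<^esub>" using zero_iff[OF de(2)] by blast
    have "\<psi> (u \<beta>) \<ominus>\<^bsub>L\<^esub> \<psi> (u \<gamma>) = \<zero>\<^bsub>L\<^esub>" using d0 cl unfolding d_def by (simp add: a_minus_def)
    then have u1: "\<psi> (u \<beta>) = \<psi> (u \<gamma>)" using cl by simp
    have "\<psi> (u \<gamma>) \<otimes>\<^bsub>L\<^esub> \<gamma> \<ominus>\<^bsub>L\<^esub> \<psi> (u \<beta>) \<otimes>\<^bsub>L\<^esub> \<beta> = \<zero>\<^bsub>L\<^esub>"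
      using e0 cl c(2) \<beta> \<gamma> unfolding e_def by (simp add: a_minus_def)
    then have "\<psi> (u \<gamma>) \<otimes>\<^bsub>L\<^esub> \<gamma> = \<psi> (u \<gamma>) \<otimes>\<^bsub>L\<^esub> \<beta>" unfolding u1 using cl \<beta> \<gamma> by simp
    moreover have "\<psi> (u \<gamma>) \<noteq> \<zero>\<^bsub>L\<^esub>" using zero_iff[OF cl(2)] fu(2)[OF \<gamma>] by blast
    ultimately show "\<beta> = \<gamma>" using L.m_lcancel cl \<beta> \<gamma> by auto
  qed
  moreover have "f ` carrier L \<subseteq> B" using fu(1) by blast
  ultimately show False using card card_of_ordLeq[of "carrier L" B] by blast
qed

theorem (in flag_ring) gorenstein_quotient:
  assumes L: "field L" and \<psi>: "\<psi> \<in> ring_hom R L" "\<psi> ` carrier R = carrier L"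
    and Q: "ring Q" "\<one>\<^bsub>Q\<^esub> \<noteq> \<zero>\<^bsub>Q\<^esub>" and h: "h \<in> ring_hom Q R" "inj_on h (carrier Q)"
    and card: "\<not> |carrier L| \<le>o |carrier Q|"
  obtains T :: "'a set ring" and b s \<psi>' h' where
    "|carrier T| \<le>o |carrier R|" "flag_ring T b l" "socle_generator T s" "\<psi>' \<in> ring_hom T L" "\<psi>' ` carrier T = carrier L"
    "h' \<in> ring_hom Q T" "inj_on h' (carrier Q)"
proof -
  interpret L: field L by fact
  interpret Q: ring Q by fact
  interpret h: ring_hom_ring Q R h using h(1) by (intro ring_hom_ringI2 ring_axioms Q.ring_axioms)
  let ?B = "h ` carrier Q - {\<zero>}"
  obtain V where V: "ideal V R" "V \<inter> ?B = {}" and max: "\<And>K. ideal K R \<Longrightarrow> V \<subset> K \<Longrightarrow> K \<inter> ?B \<noteq> {}"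
    using exists_maximal_ideal_avoiding[OF zeroideal, of ?B] by blast
  interpret V: ideal V R by (rule V(1))
  let ?T = "R Quot V"
  let ?\<pi> = "(+>) V"
  interpret T: cring ?T by (rule V.quotient_is_cring[OF is_cring])
  interpret \<pi>: ring_hom_ring R ?T ?\<pi> by (rule V.rcos_ring_hom_ring)
  have hV: "q = \<zero>\<^bsub>Q\<^esub>" if "q \<in> carrier Q" "h q \<in> V" for q
    using V(2) that h(2) inj_onD[OF h(2), of q "\<zero>\<^bsub>Q\<^esub>"] by auto
  \<comment> \<open>V misses the image of 1 and hence consists of non-units, so \<psi> descends to
    the quotient and the residue field stays L.\<close>
  have "V \<noteq> carrier R" using hV[of "\<one>\<^bsub>Q\<^esub>"] Q(2) by auto
  then have Vn: "V \<subseteq> carrier R - Units R" by (rule ideal_subset_nonunits[OF V(1)])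
  have one: "\<one>\<^bsub>?T\<^esub> \<noteq> \<zero>\<^bsub>?T\<^esub>"
    using V.rcos_eq_zero_iff[OF one_closed] Vn Units_one_closed \<pi>.hom_one by auto
  have fT: "flag_ring ?T (?\<pi> \<circ> a) l"
    by (rule flag_ring_hom_image[OF \<pi>.homh V.quotient_carrier[symmetric] T.is_cring one])
  have "\<psi> x = \<zero>\<^bsub>L\<^esub>" if "x \<in> V" for x using hom_field_eq_zero_iff[OF \<psi>(1) L] Vn that by blast
  then obtain \<psi>' where \<psi>': "\<psi>' \<in> ring_hom ?T L" "\<And>x. x \<in> carrier R \<Longrightarrow> \<psi>' (?\<pi> x) = \<psi> x"
    using V.hom_factors[OF L.ring_axioms \<psi>(1)] by blast
  have \<psi>'s: "\<psi>' ` carrier ?T = carrier L"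
    unfolding V.quotient_carrier image_image \<psi>(2)[symmetric] using \<psi>'(2) by (rule image_cong[OF refl])
  have h': "?\<pi> \<circ> h \<in> ring_hom Q ?T" using h(1) \<pi>.homh by (rule ring_hom_trans)
  have h'0: "q = \<zero>\<^bsub>Q\<^esub>" if "q \<in> carrier Q" "?\<pi> (h q) = \<zero>\<^bsub>?T\<^esub>" for q
    using V.rcos_eq_zero_iff[of "h q"] hV that by simp
  have h'i: "inj_on (?\<pi> \<circ> h) (carrier Q)"
  proof (rule inj_onI)
    fix p q assume pq: "p \<in> carrier Q" "q \<in> carrier Q" "(?\<pi> \<circ> h) p = (?\<pi> \<circ> h) q"
    then have "h p \<ominus> h q \<in> V" using V.rcos_eq_iff[of "h p" "h q"] by simp
    moreover have "h p \<ominus> h q = h (p \<ominus>\<^bsub>Q\<^esub> q)" using pq by (simp add: a_minus_def Q.minus_eq)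
    ultimately have "p \<ominus>\<^bsub>Q\<^esub> q = \<zero>\<^bsub>Q\<^esub>" using hV[of "p \<ominus>\<^bsub>Q\<^esub> q"] pq by simp
    then show "p = q" using pq by simp
  qed
  let ?C = "(?\<pi> \<circ> h) ` carrier Q"
  have ess: "\<exists>x\<in>?C. x \<in> J \<and> x \<noteq> \<zero>\<^bsub>?T\<^esub>" if J: "ideal J ?T" "J \<noteq> {\<zero>\<^bsub>?T\<^esub>}" for J
  proof -
    interpret J: ideal J ?T by (rule J(1))
    \<comment> \<open>A nonzero J has a preimage strictly above V, and maximality of V places a
      nonzero element of the embedded ring in it.\<close>
    let ?K = "{x \<in> carrier R. ?\<pi> x \<in> J}"
    have K: "ideal ?K R" by (rule \<pi>.ideal_vimage[OF J(1)])
    have sub: "V \<subseteq> ?K"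
    proof
      fix x assume x: "x \<in> V"
      then have "?\<pi> x = \<zero>\<^bsub>?T\<^esub>" using V.rcos_eq_zero_iff V.Icarr by blast
      then show "x \<in> ?K" using J.zero_closed V.Icarr[OF x] by simp
    qed
    obtain y where y: "y \<in> J" "y \<noteq> \<zero>\<^bsub>?T\<^esub>" using J.zero_closed J(2) by blast
    then obtain x where "x \<in> carrier R" "y = ?\<pi> x" using J.Icarr unfolding V.quotient_carrier by blast
    then have "x \<in> ?K" "x \<notin> V" using y V.rcos_eq_zero_iff by auto
    then have "?K \<inter> ?B \<noteq> {}" using max[OF K] sub by blast
    then obtain q where "q \<in> carrier Q" "?\<pi> (h q) \<in> J" "h q \<noteq> \<zero>" by auto
    then show ?thesis using h'0[of q] by (intro bexI[of _ "(?\<pi> \<circ> h) q"]) auto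
  qed
  have "\<not> |carrier L| \<le>o |?C|" using card card_of_image ordLeq_transitive by blast
  then obtain s where "socle_generator ?T s"
    using flag_ring.essential_extension_socle_generator[OF fT L \<psi>'(1) \<psi>'s ess] by blast
  moreover have "|carrier ?T| \<le>o |carrier R|" unfolding V.quotient_carrier by (rule card_of_image)
  ultimately show thesis using that fT \<psi>'(1) \<psi>'s h' h'i by blast
qed

section \<open>Raising the length\<close>

text \<open>The ring \<open>R[t]\<close> with \<open>t\<^sup>2 = s\<close>; the pair \<open>(x, u)\<close> stands for \<open>x + u t\<close>.\<close>

definition adjoin_sqrt :: "('a, 'm) ring_scheme \<Rightarrow> 'a \<Rightarrow> ('a \<times> 'a) ring" where
  "adjoin_sqrt R s = \<lparr>carrier = carrier R \<times> carrier R,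
     monoid.mult = (\<lambda>(x, u) (y, v). (x \<otimes>\<^bsub>R\<^esub> y \<oplus>\<^bsub>R\<^esub> u \<otimes>\<^bsub>R\<^esub> v \<otimes>\<^bsub>R\<^esub> s, x \<otimes>\<^bsub>R\<^esub> v \<oplus>\<^bsub>R\<^esub> u \<otimes>\<^bsub>R\<^esub> y)),
     one = (\<one>\<^bsub>R\<^esub>, \<zero>\<^bsub>R\<^esub>), ring.zero = (\<zero>\<^bsub>R\<^esub>, \<zero>\<^bsub>R\<^esub>),
     ring.add = (\<lambda>(x, u) (y, v). (x \<oplus>\<^bsub>R\<^esub> y, u \<oplus>\<^bsub>R\<^esub> v))\<rparr>"

lemma adjoin_sqrt_simps:
  "carrier (adjoin_sqrt R s) = carrier R \<times> carrier R"
  "(x, u) \<otimes>\<^bsub>adjoin_sqrt R s\<^esub> (y, v) = (x \<otimes>\<^bsub>R\<^esub> y \<oplus>\<^bsub>R\<^esub> u \<otimes>\<^bsub>R\<^esub> v \<otimes>\<^bsub>R\<^esub> s, x \<otimes>\<^bsub>R\<^esub> v \<oplus>\<^bsub>R\<^esub> u \<otimes>\<^bsub>R\<^esub> y)"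
  "(x, u) \<oplus>\<^bsub>adjoin_sqrt R s\<^esub> (y, v) = (x \<oplus>\<^bsub>R\<^esub> y, u \<oplus>\<^bsub>R\<^esub> v)"
  "\<one>\<^bsub>adjoin_sqrt R s\<^esub> = (\<one>\<^bsub>R\<^esub>, \<zero>\<^bsub>R\<^esub>)" "\<zero>\<^bsub>adjoin_sqrt R s\<^esub> = (\<zero>\<^bsub>R\<^esub>, \<zero>\<^bsub>R\<^esub>)"
  unfolding adjoin_sqrt_def by simp_all

lemma (in cring) adjoin_sqrt_cring:
  assumes s: "s \<in> carrier R"
  shows "cring (adjoin_sqrt R s)" (is "cring ?D")
proof (intro cringI abelian_groupI comm_monoidI)
  fix x assume "x \<in> carrier ?D"
  then obtain p u where "x = (p, u)" "p \<in> carrier R" "u \<in> carrier R" by (auto simp: adjoin_sqrt_simps)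
  then show "\<exists>y\<in>carrier ?D. y \<oplus>\<^bsub>?D\<^esub> x = \<zero>\<^bsub>?D\<^esub>"
    by (intro bexI[of _ "(\<ominus> p, \<ominus> u)"]) (auto simp: adjoin_sqrt_simps l_neg)
next
  fix x y z
  assume "x \<in> carrier ?D" "y \<in> carrier ?D" "z \<in> carrier ?D"
  then obtain p u q v r w where *: "x = (p, u)" "y = (q, v)" "z = (r, w)"
    "p \<in> carrier R" "u \<in> carrier R" "q \<in> carrier R" "v \<in> carrier R" "r \<in> carrier R" "w \<in> carrier R"
    by (auto simp: adjoin_sqrt_simps)
  have "(p \<otimes> q \<oplus> u \<otimes> v \<otimes> s) \<otimes> r \<oplus> (p \<otimes> v \<oplus> u \<otimes> q) \<otimes> w \<otimes> s =
      p \<otimes> (q \<otimes> r \<oplus> v \<otimes> w \<otimes> s) \<oplus> u \<otimes> (q \<otimes> w \<oplus> v \<otimes> r) \<otimes> s"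
    "(p \<otimes> q \<oplus> u \<otimes> v \<otimes> s) \<otimes> w \<oplus> (p \<otimes> v \<oplus> u \<otimes> q) \<otimes> r =
      p \<otimes> (q \<otimes> w \<oplus> v \<otimes> r) \<oplus> u \<otimes> (q \<otimes> r \<oplus> v \<otimes> w \<otimes> s)"
    using *(4-) s by algebra+
  then show "x \<otimes>\<^bsub>?D\<^esub> y \<otimes>\<^bsub>?D\<^esub> z =
      x \<otimes>\<^bsub>?D\<^esub> (y \<otimes>\<^bsub>?D\<^esub> z)"
    by (simp add: * adjoin_sqrt_simps)
  have "(p \<oplus> q) \<otimes> r \<oplus> (u \<oplus> v) \<otimes> w \<otimes> s = p \<otimes> r \<oplus> u \<otimes> w \<otimes> s \<oplus> (q \<otimes> r \<oplus> v \<otimes> w \<otimes> s)"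
    "(p \<oplus> q) \<otimes> w \<oplus> (u \<oplus> v) \<otimes> r = p \<otimes> w \<oplus> u \<otimes> r \<oplus> (q \<otimes> w \<oplus> v \<otimes> r)"
    using *(4-) s by algebra+
  then show "(x \<oplus>\<^bsub>?D\<^esub> y) \<otimes>\<^bsub>?D\<^esub> z =
      x \<otimes>\<^bsub>?D\<^esub> z \<oplus>\<^bsub>?D\<^esub> y \<otimes>\<^bsub>?D\<^esub> z"
    by (simp add: * adjoin_sqrt_simps)
  have "p \<otimes> q \<oplus> u \<otimes> v \<otimes> s = q \<otimes> p \<oplus> v \<otimes> u \<otimes> s" "p \<otimes> v \<oplus> u \<otimes> q = q \<otimes> u \<oplus> v \<otimes> p"
    using *(4-) s by algebra+
  then show "x \<otimes>\<^bsub>?D\<^esub> y = y \<otimes>\<^bsub>?D\<^esub> x"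
    by (simp add: * adjoin_sqrt_simps)
qed (use s in \<open>auto simp: adjoin_sqrt_simps a_ac\<close>)

text \<open>The element s need not generate the socle here, nor be nonzero. This admits both
  intended choices: a socle generator, and 0 over a field.\<close>

locale socle_extension = flag_ring R a "Suc k" for R (structure) and a k +
  fixes s
  assumes strict: "i < Suc k \<Longrightarrow> a i \<notin> flag R a i"
    and s_nonunit: "s \<in> carrier R - Units R"
    and s_socle: "y \<in> carrier R - Units R \<Longrightarrow> s \<otimes> y = \<zero>"
begin

text \<open>Strictness makes \<open>flag R a k\<close> a proper ideal. Conversely, write 1 as
  \<open>y \<oplus> r \<otimes> a k\<close> and multiply by a non-unit: both terms fall into
  \<open>flag R a k\<close>.\<close>

lemma flag_k: "flag R a k = \<nn>"
proof
  have "flag R a k \<noteq> carrier R" using strict[of k] gen_closed[of k] by auto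
  then show "flag R a k \<subseteq> \<nn>"
    using ideal_subset_nonunits[OF flag_ideal'[of k]] by simp
  interpret F: ideal "flag R a k" R using flag_ideal'[of k] by simp
  show "\<nn> \<subseteq> flag R a k"
  proof
    fix x assume x: "x \<in> \<nn>"
    obtain y r where yr: "\<one> = y \<oplus> r \<otimes> a k" "y \<in> flag R a k" "r \<in> carrier R"
      using one_in_flag by auto
    have ak: "a k \<in> carrier R" using gen_closed by simp
    have xc: "x \<in> carrier R" using x by blast
    have "x = x \<otimes> \<one>" using x by simp
    also have "\<dots> = x \<otimes> (y \<oplus> r \<otimes> a k)" unfolding yr(1)[symmetric] ..
    also have "\<dots> = x \<otimes> y \<oplus> r \<otimes> (x \<otimes> a k)" using xc yr(3) F.Icarr[OF yr(2)] ak by algebra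
    also have "\<dots> \<in> flag R a k"
    proof -
      have "x \<otimes> a k \<in> flag R a k" using nonunit_iff_lowers x unfolding lowers_flag_def by blast
      then show ?thesis using yr x F.I_l_closed F.a_closed by simp
    qed
    finally show "x \<in> flag R a k" .
  qed
qed

lemma s_closed: "s \<in> carrier R"
  using s_nonunit by blast

abbreviation "E \<equiv> adjoin_sqrt R s"

sublocale D: cring E
  by (rule adjoin_sqrt_cring[OF s_closed])

interpretation N: ideal \<nn> R
  by (rule nonunits_ideal)

section \<open>The quotient by t n, where n is the maximal ideal\<close>

text \<open>The pairs for \<open>u t\<close> with u a non-unit. They form an ideal because
  multiplying by t gives \<open>u s\<close>, which is 0 as s lies in the socle.\<close>

definition nil where "nil = {\<zero>} \<times> \<nn>"

lemma nil_ideal: "ideal nil E"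
proof (rule D.ideal_subsetI)
  show "nil \<subseteq> carrier E" unfolding nil_def by (auto simp: adjoin_sqrt_simps)
  show "\<zero>\<^bsub>E\<^esub> \<in> nil" unfolding nil_def using N.zero_closed by (simp add: adjoin_sqrt_simps)
  show "x \<oplus>\<^bsub>E\<^esub> y \<in> nil" if xy: "x \<in> nil" "y \<in> nil" for x y
  proof -
    obtain u v where "x = (\<zero>, u)" "y = (\<zero>, v)" "u \<in> \<nn>" "v \<in> \<nn>"
      using xy unfolding nil_def by auto
    then show ?thesis using N.a_closed[of u v] unfolding nil_def by (simp add: adjoin_sqrt_simps)
  qed
  show "r \<otimes>\<^bsub>E\<^esub> x \<in> nil" if x: "x \<in> nil" and r: "r \<in> carrier E" for x r
  proof -
    obtain v p u where *: "x = (\<zero>, v)" "v \<in> \<nn>" "r = (p, u)" "p \<in> carrier R" "u \<in> carrier R"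
      using x r unfolding nil_def by (auto simp: adjoin_sqrt_simps)
    have "v \<otimes> s = \<zero>" using s_socle[OF *(2)] m_comm[of v s] *(2) s_closed by auto
    then have "u \<otimes> v \<otimes> s = \<zero>" using * s_closed by (simp add: m_assoc)
    then show ?thesis using * N.I_l_closed[of v p] unfolding nil_def by (simp add: adjoin_sqrt_simps)
  qed
qed

definition ext where "ext = E Quot nil"
definition proj where "proj x = nil +>\<^bsub>E\<^esub> x"
definition emb where "emb p = proj (p, \<zero>)"
definition root where "root = proj (\<zero>, \<one>)"

lemma ext_cring: "cring ext"
  unfolding ext_def by (rule ideal.quotient_is_cring[OF nil_ideal D.is_cring])

sublocale T: cring ext
  by (rule ext_cring)

lemma proj_hom: "proj \<in> ring_hom E ext"
  using ideal.rcos_ring_hom[OF nil_ideal] unfolding ext_def proj_def[abs_def] .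

lemma ext_carrier: "carrier ext = proj ` (carrier R \<times> carrier R)"
  unfolding ext_def ideal.quotient_carrier[OF nil_ideal] proj_def[abs_def] adjoin_sqrt_simps ..

lemma ext_card: "|carrier ext| \<le>o |carrier R \<times> carrier R|"
  unfolding ext_carrier by (rule card_of_image)

lemma proj_closed: "p \<in> carrier R \<Longrightarrow> u \<in> carrier R \<Longrightarrow> proj (p, u) \<in> carrier ext"
  unfolding ext_carrier by blast

lemma proj_mult:
  assumes "p \<in> carrier R" "u \<in> carrier R" "q \<in> carrier R" "v \<in> carrier R"
  shows "proj (p, u) \<otimes>\<^bsub>ext\<^esub> proj (q, v) = proj (p \<otimes> q \<oplus> u \<otimes> v \<otimes> s, p \<otimes> v \<oplus> u \<otimes> q)"
  using ring_hom_mult[OF proj_hom, of "(p, u)" "(q, v)"] assms by (simp add: adjoin_sqrt_simps)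

lemma proj_add:
  assumes "p \<in> carrier R" "u \<in> carrier R" "q \<in> carrier R" "v \<in> carrier R"
  shows "proj (p, u) \<oplus>\<^bsub>ext\<^esub> proj (q, v) = proj (p \<oplus> q, u \<oplus> v)"
  using ring_hom_add[OF proj_hom, of "(p, u)" "(q, v)"] assms by (simp add: adjoin_sqrt_simps)

lemma proj_eq_iff:
  assumes "p \<in> carrier R" "u \<in> carrier R" "q \<in> carrier R" "v \<in> carrier R"
  shows "proj (p, u) = proj (q, v) \<longleftrightarrow> p = q \<and> u \<ominus> v \<in> \<nn>"
proof -
  have c: "(p, u) \<in> carrier E" "(q, v) \<in> carrier E"
    using assms by (auto simp: adjoin_sqrt_simps)
  have "(\<ominus> q, \<ominus> v) \<oplus>\<^bsub>E\<^esub> (q, v) = \<zero>\<^bsub>E\<^esub>"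
    using assms by (simp add: adjoin_sqrt_simps l_neg)
  then have "\<ominus>\<^bsub>E\<^esub> (q, v) = (\<ominus> q, \<ominus> v)"
    using c assms by (intro D.minus_equality) (auto simp: adjoin_sqrt_simps)
  then have "(p, u) \<ominus>\<^bsub>E\<^esub> (q, v) = (p \<ominus> q, u \<ominus> v)"
    unfolding a_minus_def[of E] by (simp add: adjoin_sqrt_simps a_minus_def)
  then have "proj (p, u) = proj (q, v) \<longleftrightarrow> p \<ominus> q = \<zero> \<and> u \<ominus> v \<in> \<nn>"
    using ideal.rcos_eq_iff[OF nil_ideal c] unfolding proj_def by (simp add: nil_def mem_Times_iff)
  then show ?thesis using assms by simp
qed

lemma ext_one: "\<one>\<^bsub>ext\<^esub> = proj (\<one>, \<zero>)" and ext_zero: "\<zero>\<^bsub>ext\<^esub> = proj (\<zero>, \<zero>)"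
  using ring_hom_one[OF proj_hom] ring_hom_zero[OF proj_hom D.ring_axioms T.ring_axioms]
  by (simp_all add: adjoin_sqrt_simps)

lemma proj_zero_iff:
  assumes "p \<in> carrier R" "u \<in> carrier R"
  shows "proj (p, u) = \<zero>\<^bsub>ext\<^esub> \<longleftrightarrow> p = \<zero> \<and> u \<notin> Units R"
proof -
  have "u \<ominus> \<zero> = u" using assms by (simp add: a_minus_def)
  then show ?thesis unfolding ext_zero using proj_eq_iff[of p u \<zero> \<zero>] assms by simp
qed

lemma emb_hom: "emb \<in> ring_hom R ext"
  unfolding emb_def using s_closed
  by (intro ring_hom_memI) (auto simp: proj_closed proj_mult proj_add ext_one)

lemma emb_closed: "p \<in> carrier R \<Longrightarrow> emb p \<in> carrier ext"
  using ring_hom_closed[OF emb_hom] .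

lemma emb_inj: "inj_on emb (carrier R)"
  unfolding emb_def by (intro inj_onI) (auto simp: proj_eq_iff)

lemma root_closed: "root \<in> carrier ext"
  unfolding root_def by (simp add: proj_closed)

lemma proj_eq_emb_root:
  assumes "p \<in> carrier R" "u \<in> carrier R"
  shows "proj (p, u) = emb p \<oplus>\<^bsub>ext\<^esub> emb u \<otimes>\<^bsub>ext\<^esub> root"
  using assms s_closed unfolding emb_def root_def by (simp add: proj_mult proj_add)

lemma emb_mult_proj:
  assumes "p \<in> carrier R" "q \<in> carrier R" "v \<in> carrier R"
  shows "proj (q, v) \<otimes>\<^bsub>ext\<^esub> emb p = proj (q \<otimes> p, v \<otimes> p)"
  using assms s_closed unfolding emb_def by (simp add: proj_mult)

lemma root_mult_proj:
  assumes "q \<in> carrier R" "v \<in> carrier R"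
  shows "proj (q, v) \<otimes>\<^bsub>ext\<^esub> root = proj (v \<otimes> s, q)"
  using assms s_closed unfolding root_def by (simp add: proj_mult)

lemma proj_kill_snd:
  assumes "p \<in> carrier R" "u \<in> \<nn>"
  shows "proj (p, u) = emb p"
proof -
  have "u \<ominus> \<zero> = u" using assms by (simp add: a_minus_def)
  then show ?thesis unfolding emb_def using assms proj_eq_iff[of p u p \<zero>] by simp
qed

text \<open>The first k entries generate the image of the maximal ideal of R. Next comes t, allowed
  there because n t = 0 and the square s of t is a non-unit. The final 1 replaces
  \<open>a k\<close>, so there is one step more than before.\<close>

definition gens where "gens i = (if i < k then emb (a i) else if i = k then root else \<one>\<^bsub>ext\<^esub>)"

lemma flag_gens: "i \<le> k \<Longrightarrow> flag ext gens i = flag ext (emb \<circ> a) i"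
  by (rule flag_cong) (simp add: gens_def)

lemma emb_flag: "i \<le> k \<Longrightarrow> x \<in> flag R a i \<Longrightarrow> emb x \<in> flag ext gens i"
  using flag_hom[OF emb_hom ring_axioms T.ring_axioms, of i a x] gen_closed
  by (simp add: flag_gens)

lemma gens_closed: "gens i \<in> carrier ext" if "i < Suc (Suc k)"
  using gen_closed emb_closed root_closed that unfolding gens_def by simp

lemma nonunit_lowers:
  assumes p: "p \<in> \<nn>" and u: "u \<in> carrier R"
  shows "lowers_flag ext gens (Suc (Suc k)) (proj (p, u))"
  unfolding lowers_flag_def
proof (intro allI impI)
  fix i assume "i < Suc (Suc k)"
  then consider "i < k" | "i = k" | "i = Suc k" by linarith
  then show "proj (p, u) \<otimes>\<^bsub>ext\<^esub> gens i \<in> flag ext gens i"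
  proof cases
    case 1
    then have "i < Suc k" by simp
    have ai: "a i \<in> carrier R" using gen_closed 1 by simp
    have "a i \<in> flag R a k" using gen_in_flag gen_closed 1 by simp
    then have "u \<otimes> a i \<in> \<nn>" unfolding flag_k using N.I_l_closed u by blast
    then have "proj (p, u) \<otimes>\<^bsub>ext\<^esub> gens i = emb (p \<otimes> a i)"
      using 1 ai p u by (simp add: gens_def emb_mult_proj proj_kill_snd)
    moreover have "p \<otimes> a i \<in> flag R a i"
      using nonunit_iff_lowers[of p] p \<open>i < Suc k\<close> unfolding lowers_flag_def by blast
    ultimately show ?thesis using emb_flag[of i] 1 by simp
  next
    case 2
    have "u \<otimes> s \<in> \<nn>" using N.I_l_closed s_nonunit u by blast
    moreover have "proj (p, u) \<otimes>\<^bsub>ext\<^esub> gens i = emb (u \<otimes> s)"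
      using 2 p u s_closed by (simp add: gens_def root_mult_proj proj_kill_snd)
    ultimately show ?thesis using emb_flag[of k "u \<otimes> s"] 2 flag_k by simp
  next
    case 3
    have "proj (p, u) \<otimes>\<^bsub>ext\<^esub> gens i = emb p \<oplus>\<^bsub>ext\<^esub> emb u \<otimes>\<^bsub>ext\<^esub> gens k"
      using 3 p u proj_closed proj_eq_emb_root by (simp add: gens_def)
    moreover have "emb p \<in> flag ext gens k" using emb_flag[of k p] flag_k p by simp
    ultimately show ?thesis using 3 emb_closed[OF u] by auto
  qed
qed

text \<open>The conjugate \<open>p - u t\<close> gives the norm \<open>p^2 - u^2 s\<close>, a unit
  minus a non-unit, hence a unit of the local ring R.\<close>

lemma unit_proj:
  assumes p: "p \<in> Units R" and u: "u \<in> carrier R"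
  shows "proj (p, u) \<in> Units ext"
proof -
  have pc: "p \<in> carrier R" by (rule Units_closed[OF p])
  let ?w = "p \<otimes> p \<oplus> \<ominus> (u \<otimes> u \<otimes> s)"
  have "u \<otimes> u \<otimes> s \<in> \<nn>" using N.I_l_closed[of s "u \<otimes> u"] s_nonunit u by simp
  then have n: "\<ominus> (u \<otimes> u \<otimes> s) \<in> \<nn>" using N.a_inv_closed by blast
  have wc: "?w \<in> carrier R" by (intro a_closed m_closed a_inv_closed pc u s_closed)
  have "?w \<in> Units R"
  proof (rule ccontr)
    assume "?w \<notin> Units R"
    then have "?w \<oplus> \<ominus> (\<ominus> (u \<otimes> u \<otimes> s)) \<in> \<nn>"
      using wc n N.a_closed N.a_inv_closed by blast
    moreover have "?w \<oplus> \<ominus> (\<ominus> (u \<otimes> u \<otimes> s)) = p \<otimes> p" using pc u s_closed by algebra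
    ultimately show False using p by simp
  qed
  then have "emb ?w \<in> Units ext" by (rule ring_hom_Units[OF emb_hom is_cring T.is_cring])
  moreover have "proj (p, u) \<otimes>\<^bsub>ext\<^esub> proj (p, \<ominus> u) = emb ?w"
  proof -
    have "u \<otimes> (\<ominus> u) \<otimes> s = \<ominus> (u \<otimes> u \<otimes> s)"
      unfolding r_minus[OF u u] by (rule l_minus[OF m_closed[OF u u] s_closed])
    moreover have "p \<otimes> (\<ominus> u) \<oplus> u \<otimes> p = \<zero>"
      unfolding r_minus[OF pc u] m_comm[OF u pc] by (rule l_neg[OF m_closed[OF pc u]])
    ultimately show ?thesis using pc u by (simp add: proj_mult emb_def)
  qed
  ultimately show ?thesis
    using T.unit_factor_left[of "proj (p, u)" "proj (p, \<ominus> u)"] proj_closed pc u by simp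
qed

lemma ext_flag_ring: "flag_ring ext gens (Suc (Suc k))"
proof
  show "\<one>\<^bsub>ext\<^esub> \<noteq> \<zero>\<^bsub>ext\<^esub>" using proj_zero_iff[of \<one> \<zero>] one_not_zero by (simp add: ext_one)
  show "gens i \<in> carrier ext" if "i < Suc (Suc k)" for i by (rule gens_closed[OF that])
  have "gens (Suc k) \<in> flag ext gens (Suc (Suc k))" by (rule T.gen_in_flag_Suc) (simp add: gens_closed)
  then show "\<one>\<^bsub>ext\<^esub> \<in> flag ext gens (Suc (Suc k))" unfolding gens_def by simp
  fix x assume "x \<in> carrier ext"
  then obtain p u where "x = proj (p, u)" "p \<in> carrier R" "u \<in> carrier R" unfolding ext_carrier by auto
  then show "x \<in> Units ext \<or> lowers_flag ext gens (Suc (Suc k)) x"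
    using nonunit_lowers unit_proj by blast
qed

lemma proj_unit_iff:
  assumes "p \<in> carrier R" "u \<in> carrier R"
  shows "proj (p, u) \<in> Units ext \<longleftrightarrow> p \<in> Units R"
  using unit_proj nonunit_lowers flag_ring.nonunit_iff_lowers[OF ext_flag_ring proj_closed] assms by blast

lemma root_nonunit: "root \<in> carrier ext - Units ext"
  using root_closed proj_unit_iff[of \<zero> \<one>] N.zero_closed by (simp add: root_def)

text \<open>The image of \<open>flag R a i\<close> is already an ideal of the extension, since t
  kills the non-units that it comes from. Strictness of the old flag thus carries over.\<close>

lemma flag_gens_subset: "i \<le> k \<Longrightarrow> flag ext gens i \<subseteq> emb ` flag R a i"
proof -
  assume i: "i \<le> k"
  interpret J: ideal "flag R a i" R using flag_ideal' i by simp
  have Jn: "flag R a i \<subseteq> \<nn>"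
    using flag_mono[of k a i] gen_closed i flag_k by simp
  have "ideal (emb ` flag R a i) ext"
  proof (rule T.ideal_subsetI)
    show "emb ` flag R a i \<subseteq> carrier ext" using emb_closed J.Icarr by blast
    show "\<zero>\<^bsub>ext\<^esub> \<in> emb ` flag R a i" using J.zero_closed by (auto simp: ext_zero emb_def)
    show "x \<oplus>\<^bsub>ext\<^esub> y \<in> emb ` flag R a i" if xy: "x \<in> emb ` flag R a i" "y \<in> emb ` flag R a i" for x y
    proof -
      obtain p q where "p \<in> flag R a i" "x = emb p" "q \<in> flag R a i" "y = emb q" using xy by blast
      then have "p \<oplus> q \<in> flag R a i" "x \<oplus>\<^bsub>ext\<^esub> y = emb (p \<oplus> q)"
        using J.a_closed J.Icarr ring_hom_add[OF emb_hom, of p q] by auto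
      then show ?thesis by blast
    qed
    show "r \<otimes>\<^bsub>ext\<^esub> x \<in> emb ` flag R a i" if x: "x \<in> emb ` flag R a i" and r: "r \<in> carrier ext" for x r
    proof -
      obtain p where p: "p \<in> flag R a i" "x = emb p" using x by blast
      obtain q v where qv: "r = proj (q, v)" "q \<in> carrier R" "v \<in> carrier R" using r unfolding ext_carrier by auto
      have "v \<otimes> p \<in> \<nn>" using Jn p(1) qv N.I_l_closed by blast
      then have "r \<otimes>\<^bsub>ext\<^esub> x = emb (q \<otimes> p)"
        using p qv J.Icarr[OF p(1)] by (simp add: emb_mult_proj proj_kill_snd)
      then show ?thesis using J.I_l_closed p qv by blast
    qed
  qed
  moreover have "gens j \<in> emb ` flag R a i" if "j < i" for j
    using gen_in_flag[of i a j] gen_closed that i unfolding gens_def by simp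
  ultimately show ?thesis by (rule T.flag_subset_ideal)
qed

lemma ext_length: "ring_length ext = enat (Suc (Suc k))"
proof (rule flag_ring.ring_length_eq[OF ext_flag_ring])
  interpret X: flag_ring ext gens "Suc (Suc k)" by (rule ext_flag_ring)
  fix i assume "i < Suc (Suc k)"
  then consider "i < k" | "i = k" | "i = Suc k" by linarith
  then show "gens i \<notin> flag ext gens i"
  proof cases
    case 1
    interpret J: ideal "flag R a i" R using flag_ideal' 1 by simp
    show ?thesis
    proof
      assume "gens i \<in> flag ext gens i"
      then obtain x where "x \<in> flag R a i" "emb (a i) = emb x"
        using flag_gens_subset[of i] 1 unfolding gens_def by auto
      then show False using inj_onD[OF emb_inj, of "a i" x] gen_closed[of i] strict[of i] J.Icarr 1 by auto
    qed
  next
    case 2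
    show ?thesis
    proof
      assume "gens i \<in> flag ext gens i"
      then obtain x where x: "x \<in> flag R a k" "root = emb x"
        using flag_gens_subset[of k] 2 unfolding gens_def by auto
      then have "\<one> \<ominus> \<zero> \<in> \<nn>"
        using proj_eq_iff[of \<zero> \<one> x \<zero>] flag_k unfolding root_def emb_def by auto
      then show False by (simp add: a_minus_def)
    qed
  next
    case 3
    have "gens j \<in> carrier ext - Units ext" if "j < Suc k" for j
    proof (cases "j < k")
      case True
      have "a j \<in> flag R a k" using gen_in_flag gen_closed True by simp
      then show ?thesis unfolding flag_k using True emb_closed proj_unit_iff[of "a j" \<zero>]
        by (simp add: gens_def emb_def)
    next
      case False
      then have "gens j = root" using that by (simp add: gens_def)
      then show ?thesis using root_nonunit by simp
    qed
    then have "flag ext gens (Suc k) \<subseteq> carrier ext - Units ext"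
      by (rule T.flag_subset_ideal[OF X.nonunits_ideal])
    moreover have "gens i = \<one>\<^bsub>ext\<^esub>" using 3 by (simp add: gens_def)
    ultimately show ?thesis using 3 T.Units_one_closed by auto
  qed
qed

text \<open>Sending t to 0 respects its square being s, because the non-unit s has residue
  0.\<close>

lemma ext_residue:
  assumes "\<psi> \<in> ring_hom R L" "\<psi> ` carrier R = carrier L" "field L"
  obtains \<psi>' where "\<psi>' \<in> ring_hom ext L" "\<psi>' ` carrier ext = carrier L"
proof -
  interpret L: field L by fact
  interpret h: ring_hom_ring R L \<psi> using assms(1) by (intro ring_hom_ringI2 ring_axioms L.ring_axioms)
  have s0: "\<psi> s = \<zero>\<^bsub>L\<^esub>" using hom_field_eq_zero_iff[OF assms(1,3)] s_nonunit by blast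
  have f: "(\<psi> \<circ> fst) \<in> ring_hom E L"
    by (rule ring_hom_memI) (use s0 s_closed in \<open>auto simp: adjoin_sqrt_simps\<close>)
  have z: "(\<psi> \<circ> fst) x = \<zero>\<^bsub>L\<^esub>" if "x \<in> nil" for x using that unfolding nil_def by auto
  obtain \<psi>' where \<psi>': "\<psi>' \<in> ring_hom (E Quot nil) L"
    "\<And>x. x \<in> carrier E \<Longrightarrow> \<psi>' (nil +>\<^bsub>E\<^esub> x) = (\<psi> \<circ> fst) x"
    using ideal.hom_factors[OF nil_ideal L.ring_axioms f z] by blast
  have "\<psi>' (proj (p, u)) = \<psi> p" if "p \<in> carrier R" "u \<in> carrier R" for p u
    using \<psi>'(2)[of "(p, u)"] that by (simp add: proj_def adjoin_sqrt_simps)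
  then have "\<psi>' ` carrier ext = \<psi> ` carrier R" unfolding ext_carrier by (force simp: image_iff)
  then show thesis using that \<psi>'(1) assms(2) unfolding ext_def by simp
qed

lemma nonunit_extE:
  assumes "y \<in> carrier ext - Units ext"
  obtains q v where "y = proj (q, v)" "q \<in> \<nn>" "v \<in> carrier R"
  using assms proj_unit_iff unfolding ext_carrier by auto

text \<open>If t kills \<open>p + u t\<close>, then \<open>u s = 0\<close> and p is a non-unit. As s
  is nonzero, u is a non-unit as well, so \<open>u t = 0\<close> and only an element p of the old
  socle is left.\<close>

lemma ext_socle:
  assumes gen: "socle_generator R s" and nz: "s \<noteq> \<zero>"
  shows "socle_generator ext (emb s)"
proof (rule T.socle_generatorI)
  show "emb s \<in> carrier ext" using emb_closed s_closed .
  fix y assume "y \<in> carrier ext - Units ext"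
  then obtain q v where y: "y = proj (q, v)" "q \<in> \<nn>" "v \<in> carrier R" by (rule nonunit_extE)
  have "v \<otimes> s \<in> \<nn>" using N.I_l_closed s_nonunit y(3) by blast
  moreover have "q \<otimes> s = \<zero>" using s_socle[OF y(2)] m_comm[of q s] y(2) s_closed by auto
  ultimately have "y \<otimes>\<^bsub>ext\<^esub> emb s = \<zero>\<^bsub>ext\<^esub>"
    using y s_closed by (simp add: emb_mult_proj proj_zero_iff)
  then show "emb s \<otimes>\<^bsub>ext\<^esub> y = \<zero>\<^bsub>ext\<^esub>" using T.m_comm emb_closed s_closed y proj_closed by simp
next
  fix x assume x: "x \<in> carrier ext" and kill: "\<And>y. y \<in> carrier ext - Units ext \<Longrightarrow> x \<otimes>\<^bsub>ext\<^esub> y = \<zero>\<^bsub>ext\<^esub>"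
  obtain p u where pu: "x = proj (p, u)" "p \<in> carrier R" "u \<in> carrier R" using x unfolding ext_carrier by auto
  have "proj (u \<otimes> s, p) = \<zero>\<^bsub>ext\<^esub>" using kill[OF root_nonunit] pu by (simp add: root_mult_proj)
  then have us: "u \<otimes> s = \<zero>" and p: "p \<notin> Units R" using proj_zero_iff pu s_closed by auto
  have "u \<notin> Units R"
  proof
    assume u: "u \<in> Units R"
    then have "inv u \<otimes> (u \<otimes> s) = \<zero>" using us by simp
    moreover have "inv u \<otimes> (u \<otimes> s) = (inv u \<otimes> u) \<otimes> s" using u s_closed by (intro m_assoc[symmetric]) auto
    ultimately show False using u s_closed nz by simp
  qed
  then have xe: "x = emb p" using pu proj_kill_snd by simp
  have "p \<otimes> y = \<zero>" if y: "y \<in> \<nn>" for y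
  proof -
    have "emb y \<in> carrier ext - Units ext" using y emb_closed proj_unit_iff[of y \<zero>] by (simp add: emb_def)
    then have "emb (p \<otimes> y) = \<zero>\<^bsub>ext\<^esub>" using kill ring_hom_mult[OF emb_hom pu(2)] y xe by simp
    then show ?thesis using proj_zero_iff[of "p \<otimes> y" \<zero>] y pu unfolding emb_def by simp
  qed
  then obtain r where "r \<in> carrier R" "p = r \<otimes> s" using socle_generatorD(3)[OF gen pu(2)] by blast
  then show "\<exists>r\<in>carrier ext. x = r \<otimes>\<^bsub>ext\<^esub> emb s"
    using xe ring_hom_mult[OF emb_hom] s_closed emb_closed by blast
qed

text \<open>Here s = 0 and the extension is the ring of dual numbers, whose socle is generated by
  t.\<close>

lemma ext_socle_field:
  assumes field: "\<nn> = {\<zero>}"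
  shows "socle_generator ext root"
proof (rule T.socle_generatorI)
  show "root \<in> carrier ext" by (rule root_closed)
  have s: "s = \<zero>" using s_nonunit field by blast
  fix y assume "y \<in> carrier ext - Units ext"
  then obtain q v where y: "y = proj (q, v)" "q \<in> \<nn>" "v \<in> carrier R" by (rule nonunit_extE)
  then have q0: "q = \<zero>" using field by blast
  have vs: "v \<otimes> s = \<zero>" using s y(3) by simp
  then have "y \<otimes>\<^bsub>ext\<^esub> root = \<zero>\<^bsub>ext\<^esub>"
    using root_mult_proj[of q v] y(1,3) unfolding q0 vs ext_zero by simp
  then show "root \<otimes>\<^bsub>ext\<^esub> y = \<zero>\<^bsub>ext\<^esub>" using T.m_comm root_closed y proj_closed by simp
next
  fix x assume x: "x \<in> carrier ext" and kill: "\<And>y. y \<in> carrier ext - Units ext \<Longrightarrow> x \<otimes>\<^bsub>ext\<^esub> y = \<zero>\<^bsub>ext\<^esub>"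
  obtain p u where pu: "x = proj (p, u)" "p \<in> carrier R" "u \<in> carrier R" using x unfolding ext_carrier by auto
  have "proj (u \<otimes> s, p) = \<zero>\<^bsub>ext\<^esub>" using kill[OF root_nonunit] pu by (simp add: root_mult_proj)
  then have "p = \<zero>" using proj_zero_iff pu s_closed field by auto
  then have "x = \<zero>\<^bsub>ext\<^esub> \<oplus>\<^bsub>ext\<^esub> emb u \<otimes>\<^bsub>ext\<^esub> root"
    using pu proj_eq_emb_root[of p u] by (simp add: emb_def ext_zero)
  then have "x = emb u \<otimes>\<^bsub>ext\<^esub> root" using emb_closed[OF pu(3)] root_closed by simp
  then show "\<exists>r\<in>carrier ext. x = r \<otimes>\<^bsub>ext\<^esub> root" using emb_closed[OF pu(3)] by blast
qed

end

theorem gorenstein_lengthen: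
  fixes R :: "('a, 'm) ring_scheme"
  assumes R: "flag_ring R a l" and strict: "\<And>i. i < l \<Longrightarrow> a i \<notin> flag R a i"
    and s: "socle_generator R s"
    and L: "field L" and \<psi>: "\<psi> \<in> ring_hom R L" "\<psi> ` carrier R = carrier L"
  obtains T :: "('a \<times> 'a) set ring" and b e s' \<psi>' where
    "|carrier T| \<le>o |carrier R \<times> carrier R|" "flag_ring T b (Suc l)" "ring_length T = enat (Suc l)" "socle_generator T s'"
    "e \<in> ring_hom R T" "inj_on e (carrier R)" "\<psi>' \<in> ring_hom T L" "\<psi>' ` carrier T = carrier L"
proof -
  interpret R0: flag_ring R a l by fact
  interpret N: ideal "carrier R - Units R" R by (rule R0.nonunits_ideal)
  note sD = R0.socle_generatorD[OF s]
  obtain k where l: "l = Suc k" using R0.one_in_flag R0.one_not_zero by (cases l) auto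
  show thesis
  \<comment> \<open>Over a field the socle generator is a unit and has no place in
    \<open>socle_extension\<close>, so 0 is used instead.\<close>
  proof (cases "carrier R - Units R = {\<zero>\<^bsub>R\<^esub>}")
    case True
    interpret socle_extension R a k "\<zero>\<^bsub>R\<^esub>"
      by unfold_locales (use strict R0.gen_closed R0.one_in_flag R0.unit_or_lowers R0.one_not_zero N.zero_closed in \<open>auto simp: l\<close>)
    show thesis
      using ext_residue[OF \<psi> L] that ext_card ext_flag_ring[folded l] ext_length[folded l] ext_socle_field[OF True] emb_hom emb_inj
      by metis
  next
    case False
    then obtain y where y: "y \<in> carrier R - Units R" "y \<noteq> \<zero>\<^bsub>R\<^esub>" using N.zero_closed by blast
    have "s \<notin> Units R"
    proof
      assume u: "s \<in> Units R"
      have "inv\<^bsub>R\<^esub> s \<otimes>\<^bsub>R\<^esub> (s \<otimes>\<^bsub>R\<^esub> y) = (inv\<^bsub>R\<^esub> s \<otimes>\<^bsub>R\<^esub> s) \<otimes>\<^bsub>R\<^esub> y"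
        using u y(1) by (intro R0.m_assoc[symmetric]) auto
      then show False using sD(2)[OF y(1)] u y by simp
    qed
    then interpret socle_extension R a k s
      by unfold_locales (use strict R0.gen_closed R0.one_in_flag R0.unit_or_lowers R0.one_not_zero sD in \<open>auto simp: l\<close>)
    \<comment> \<open>The first generator \<open>a 0\<close> is nonzero by strictness and is killed
      by all non-units, so the socle is nonzero.\<close>
    have nz: "s \<noteq> \<zero>\<^bsub>R\<^esub>"
    proof
      assume "s = \<zero>\<^bsub>R\<^esub>"
      have l0: "0 < l" using l by simp
      have "a 0 \<otimes>\<^bsub>R\<^esub> y = \<zero>\<^bsub>R\<^esub>" if "y \<in> carrier R - Units R" for y
      proof -
        have "y \<otimes>\<^bsub>R\<^esub> a 0 \<in> flag R a 0"
          using R0.nonunit_iff_lowers[of y] that l0 unfolding lowers_flag_def by blast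
        then show ?thesis using R0.m_comm[OF R0.gen_closed[OF l0], of y] that by simp
      qed
      then obtain r where "r \<in> carrier R" "a 0 = r \<otimes>\<^bsub>R\<^esub> s" using sD(3)[OF R0.gen_closed[OF l0]] by blast
      then have "a 0 = \<zero>\<^bsub>R\<^esub>" using \<open>s = \<zero>\<^bsub>R\<^esub>\<close> by simp
      then show False using strict[of 0] by simp
    qed
    show thesis
      using ext_residue[OF \<psi> L] that ext_card ext_flag_ring[folded l] ext_length[folded l] ext_socle[OF s nz] emb_hom emb_inj
      by metis
  qed
qed

section \<open>Embedding into a Gorenstein ring\<close>

lemma algebraically_closed_iso:
  assumes K: "field K" and L: "algebraically_closed L" and f: "f \<in> ring_iso K L"
  shows "algebraically_closed K"
proof -
  interpret K: field K by fact
  interpret L: algebraically_closed L by fact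
  have fh: "f \<in> ring_hom K L" and bij: "bij_betw f (carrier K) (carrier L)"
    using f unfolding ring_iso_def by auto
  interpret f: ring_hom_ring K L f using fh by (intro ring_hom_ringI2 K.ring_axioms L.ring_axioms)
  show ?thesis
  proof (rule K.algebraically_closedI)
    fix p assume p: "p \<in> carrier (poly_ring K)" "degree p > 1"
    have sub: "set p \<subseteq> carrier K" using p(1) by (simp add: K.polynomial_incl univ_poly_carrier)
    have "map f p \<in> carrier (poly_ring L)"
      by (rule polynomial_hom[OF fh K.field_axioms L.field_axioms p(1)])
    then obtain y where y: "y \<in> carrier L" "L.eval (map f p) y = \<zero>\<^bsub>L\<^esub>"
      using L.exists_root p(2) by (metis One_nat_def Suc_lessD length_map)
    obtain x where x: "x \<in> carrier K" "y = f x" using y(1) bij unfolding bij_betw_def by auto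
    have "f (K.eval p x) = f \<zero>\<^bsub>K\<^esub>" using y(2) f.eval_hom'[OF x(1) sub] x(2) by simp
    then have "K.eval p x = \<zero>\<^bsub>K\<^esub>"
      using bij K.eval_in_carrier[OF sub x(1)] unfolding bij_betw_def by (meson K.zero_closed inj_onD)
    then show "\<exists>x\<in>carrier K. K.eval p x = \<zero>\<^bsub>K\<^esub>" using x(1) by blast
  qed
qed

lemma (in flag_ring) residue_field_algebraically_closed:
  assumes "algebraically_closed L" "\<psi> \<in> ring_hom R L" "\<psi> ` carrier R = carrier L"
  shows "algebraically_closed (R Quot (carrier R - Units R))"
proof -
  interpret L: algebraically_closed L by fact
  interpret h: ring_hom_ring R L \<psi> using assms(2) by (intro ring_hom_ringI2 ring_axioms L.ring_axioms)
  have ker: "a_kernel R L \<psi> = carrier R - Units R"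
    using hom_field_eq_zero_iff[OF assms(2) L.field_axioms] unfolding a_kernel_def' by blast
  have "(\<lambda>C. the_elem (\<psi> ` C)) \<in> ring_iso (R Quot a_kernel R L \<psi>) L"
    using h.FactRing_iso_set_aux unfolding assms(3) by simp
  then show ?thesis
    using algebraically_closed_iso[OF _ assms(1)] maximalideal.quotient_is_field[OF nonunits_maximal is_cring]
    unfolding ker by blast
qed

section \<open>Gorenstein covers of prescribed length\<close>

text \<open>The invariant of an induction on the length. The surjection onto a fixed L keeps the
  residue field algebraically closed throughout.\<close>

definition gorenstein_cover ::
    "('q, 'm) ring_scheme \<Rightarrow> ('c, 'n) ring_scheme \<Rightarrow> 'v ring \<Rightarrow> nat \<Rightarrow> bool" where
  "gorenstein_cover Q L T k \<longleftrightarrow>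
     (\<exists>b. flag_ring T b k) \<and> ring_length T = enat k \<and> (\<exists>s. socle_generator T s) \<and>
     (\<exists>\<psi>\<in>ring_hom T L. \<psi> ` carrier T = carrier L) \<and> (\<exists>h\<in>ring_hom Q T. inj_on h (carrier Q))"

text \<open>Exchanges a flag that merely bounds the length for a strict one whose size is the
  length.\<close>

lemma (in flag_ring) strict_flag_of_length:
  assumes "ring_length R = enat k"
  obtains b where "flag_ring R b k" "\<And>i. i < k \<Longrightarrow> b i \<notin> flag R b i"
  using artinian_local_ring.exists_strict_flag[OF is_artinian_local assms] by blast

text \<open>The length is carried over by a strict flag: the inverse of g is again a homomorphism
  and would pull a failure of strictness back to T.\<close>

lemma gorenstein_cover_transport:
  assumes T: "gorenstein_cover Q L T k" and g: "inj_on g (carrier T)"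
  shows "gorenstein_cover Q L (image_ring g T) k"
proof -
  let ?E = "image_ring g T"
  obtain b0 s \<psi> h where fl0: "flag_ring T b0 k" and len: "ring_length T = enat k" and s: "socle_generator T s"
    and \<psi>: "\<psi> \<in> ring_hom T L" "\<psi> ` carrier T = carrier L" and h: "h \<in> ring_hom Q T" "inj_on h (carrier Q)"
    using T unfolding gorenstein_cover_def by blast
  obtain b where fl: "flag_ring T b k" and strict: "\<And>i. i < k \<Longrightarrow> b i \<notin> flag T b i"
    using flag_ring.strict_flag_of_length[OF fl0 len] by blast
  interpret T: flag_ring T b k by (rule fl)
  interpret E: flag_ring ?E "g \<circ> b" k by (rule T.image_ring_flag_ring[OF g])
  have gh: "g \<in> ring_hom T ?E" by (rule image_ring_hom[OF g])
  define r where "r = inv_into (carrier T) g"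
  have r: "r (g x) = x" if "x \<in> carrier T" for x using that g unfolding r_def by simp
  have rh: "r \<in> ring_hom ?E T"
  proof (rule hom_from_image_ring[OF T.ring_axioms g])
    show "id \<in> ring_hom T T" by (rule id_ring_hom)
    show "r (g x) = id x" if "x \<in> carrier T" for x using r[OF that] by simp
  qed
  have units: "g x \<in> Units ?E \<longleftrightarrow> x \<in> Units T" if "x \<in> carrier T" for x
    using ring_hom_Units[OF gh T.is_cring E.is_cring, of x]
      ring_hom_Units[OF rh E.is_cring T.is_cring, of "g x"] r[OF that] by auto
  have "ring_length ?E = enat k"
  proof (rule E.ring_length_eq)
    fix i assume i: "i < k"
    have "flag T (r \<circ> (g \<circ> b)) i = flag T b i"
      by (rule flag_cong) (use i T.gen_closed r in simp)
    moreover have "x \<in> flag ?E (g \<circ> b) i \<Longrightarrow> r x \<in> flag T (r \<circ> (g \<circ> b)) i" for x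
      using flag_hom[OF rh E.ring_axioms T.ring_axioms, of i "g \<circ> b" x] E.gen_closed i by auto
    ultimately show "(g \<circ> b) i \<notin> flag ?E (g \<circ> b) i"
      using strict[OF i] r[OF T.gen_closed[OF i]] by fastforce
  qed
  moreover have "socle_generator ?E (g s)"
  proof (rule E.socle_generatorI)
    note sD = T.socle_generatorD[OF s]
    show "g s \<in> carrier ?E" using sD(1) by (simp add: image_ring_carrier)
    fix y assume "y \<in> carrier ?E - Units ?E"
    then obtain x where x: "x \<in> carrier T - Units T" "y = g x" using units by (auto simp: image_ring_carrier)
    then have "g s \<otimes>\<^bsub>?E\<^esub> y = g (s \<otimes>\<^bsub>T\<^esub> x)" using ring_hom_mult[OF gh sD(1)] by simp
    then show "g s \<otimes>\<^bsub>?E\<^esub> y = \<zero>\<^bsub>?E\<^esub>" using sD(2)[OF x(1)] by (simp add: image_ring_zero)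
  next
    note sD = T.socle_generatorD[OF s]
    fix y assume "y \<in> carrier ?E" and kill: "\<And>z. z \<in> carrier ?E - Units ?E \<Longrightarrow> y \<otimes>\<^bsub>?E\<^esub> z = \<zero>\<^bsub>?E\<^esub>"
    then obtain x where x: "x \<in> carrier T" "y = g x" by (auto simp: image_ring_carrier)
    have "x \<otimes>\<^bsub>T\<^esub> z = \<zero>\<^bsub>T\<^esub>" if z: "z \<in> carrier T - Units T" for z
    proof -
      have "g z \<in> carrier ?E - Units ?E" using z units by (auto simp: image_ring_carrier)
      then have "g (x \<otimes>\<^bsub>T\<^esub> z) = g \<zero>\<^bsub>T\<^esub>"
        using kill ring_hom_mult[OF gh x(1)] z x(2) by (simp add: image_ring_zero)
      then show ?thesis using inj_onD[OF g] x(1) z by blast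
    qed
    then obtain t where t: "t \<in> carrier T" "x = t \<otimes>\<^bsub>T\<^esub> s" using sD(3)[OF x(1)] by blast
    then have "y = g t \<otimes>\<^bsub>?E\<^esub> g s" using ring_hom_mult[OF gh t(1) sD(1)] x by simp
    then show "\<exists>t\<in>carrier ?E. y = t \<otimes>\<^bsub>?E\<^esub> g s" using t(1) by (auto simp: image_ring_carrier)
  qed
  moreover have "\<psi> \<circ> r \<in> ring_hom ?E L" using rh \<psi>(1) by (rule ring_hom_trans)
  moreover have "(\<psi> \<circ> r) ` carrier ?E = carrier L"
    unfolding image_ring_carrier \<psi>(2)[symmetric] image_image by (rule image_cong) (simp_all add: r)
  moreover have "g \<circ> h \<in> ring_hom Q ?E" using h(1) gh by (rule ring_hom_trans)
  moreover have "inj_on (g \<circ> h) (carrier Q)"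
    using h(2) g ring_hom_closed[OF h(1)] by (intro comp_inj_on) (auto intro: inj_on_subset)
  ultimately show ?thesis unfolding gorenstein_cover_def using E.flag_ring_axioms by blast
qed

text \<open>One lengthening leaves the type \<open>'v\<close>. Since \<open>'v\<close> is infinite,
  squaring does not enlarge its cardinality, so the result fits back into it and the step can be
  iterated.\<close>

lemma gorenstein_cover_Suc:
  fixes T :: "'v ring"
  assumes inf: "infinite (UNIV :: 'v set)" and L: "field L" and T: "gorenstein_cover Q L T k"
  shows "\<exists>E :: 'v ring. gorenstein_cover Q L E (Suc k)"
proof -
  obtain b0 s \<psi> h where fl0: "flag_ring T b0 k" and len: "ring_length T = enat k" and s: "socle_generator T s"
    and \<psi>: "\<psi> \<in> ring_hom T L" "\<psi> ` carrier T = carrier L" and h: "h \<in> ring_hom Q T" "inj_on h (carrier Q)"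
    using T unfolding gorenstein_cover_def by blast
  obtain b where fl: "flag_ring T b k" and strict: "\<And>i. i < k \<Longrightarrow> b i \<notin> flag T b i"
    using flag_ring.strict_flag_of_length[OF fl0 len] by blast
  obtain E :: "('v \<times> 'v) set ring" and c e s' \<psi>' where
    E: "|carrier E| \<le>o |carrier T \<times> carrier T|" "flag_ring E c (Suc k)" "ring_length E = enat (Suc k)"
    "socle_generator E s'" "e \<in> ring_hom T E" "inj_on e (carrier T)"
    "\<psi>' \<in> ring_hom E L" "\<psi>' ` carrier E = carrier L"
    by (rule gorenstein_lengthen[OF fl strict s L \<psi>])
  have "e \<circ> h \<in> ring_hom Q E" using h(1) E(5) by (rule ring_hom_trans)
  moreover have "inj_on (e \<circ> h) (carrier Q)"
    using h(2) E(6) ring_hom_closed[OF h(1)] by (intro comp_inj_on) (auto intro: inj_on_subset)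
  ultimately have cov: "gorenstein_cover Q L E (Suc k)"
    unfolding gorenstein_cover_def using E by blast
  have "|carrier T \<times> carrier T| \<le>o |(UNIV :: 'v set) \<times> (UNIV :: 'v set)|"
    by (rule card_of_mono1) simp
  then have "|carrier E| \<le>o |UNIV :: 'v set|"
    using E(1) card_of_Times_same_infinite[OF inf] ordLeq_transitive ordLeq_ordIso_trans by metis
  then obtain g :: "_ \<Rightarrow> 'v" where "inj_on g (carrier E)" using card_of_ordLeq by metis
  then show ?thesis using gorenstein_cover_transport[OF cov] by blast
qed

lemma infinite_UNIV_plus_nat: "infinite (UNIV :: ('a + nat) set)"
  using range_inj_infinite[of "Inr :: nat \<Rightarrow> 'a + nat"] finite_subset[OF subset_UNIV] by auto

text \<open>A function is recovered from the set of its graph. The pair of \<open>u\<close> and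
  \<open>f u\<close> is the single list \<open>f u # u\<close>, and lists over \<open>'a\<close>
  inject into the infinite type \<open>'a + nat\<close>.\<close>

lemma card_functions_on_lists:
  "|UNIV :: ('a list \<Rightarrow> 'a) set| \<le>o |UNIV :: ('a + nat) set set|"
proof -
  note inf = infinite_UNIV_plus_nat
  have "inj (map Inl :: 'a list \<Rightarrow> ('a + nat) list)" by (simp add: inj_map)
  then have "|UNIV :: 'a list set| \<le>o |UNIV :: ('a + nat) list set|"
    using card_of_ordLeq[of "UNIV :: 'a list set" "UNIV :: ('a + nat) list set"] by blast
  moreover have "|UNIV :: ('a + nat) list set| =o |UNIV :: ('a + nat) set|"
    using card_of_lists_infinite[OF inf] by simp
  ultimately have "|UNIV :: 'a list set| \<le>o |UNIV :: ('a + nat) set|" by (rule ordLeq_ordIso_trans)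
  then obtain j :: "'a list \<Rightarrow> 'a + nat" where j: "inj j"
    using card_of_ordLeq[of "UNIV :: 'a list set" "UNIV :: ('a + nat) set"] by auto
  let ?G = "\<lambda>f :: 'a list \<Rightarrow> 'a. (\<lambda>u. j (f u # u)) ` UNIV"
  have "inj ?G"
  proof (intro injI ext)
    fix f f' u assume "?G f = ?G f'"
    then have "j (f u # u) \<in> ?G f'" by blast
    then obtain v where "j (f u # u) = j (f' v # v)" by blast
    then show "f u = f' u" using injD[OF j] by blast
  qed
  then show ?thesis
    using card_of_ordLeq[of "UNIV :: ('a list \<Rightarrow> 'a) set" "UNIV :: ('a + nat) set set"] by blast
qed

theorem corollary1p7:
  fixes R :: "('a, 'm) ring_scheme" and \<mm> :: "'a set" and l :: nat
  assumes "artinian_local_ring R \<mm>"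
    and "ring_length R = enat l"
  shows "\<exists>(S :: ('a + nat) set ring) (\<nn> :: ('a + nat) set set) (h :: 'a \<Rightarrow> ('a + nat) set).
           artinian_local_gorenstein_ring S \<nn> \<and>
           ring_length S = enat l \<and>
           algebraically_closed (S Quot \<nn>) \<and>
           h \<in> ring_hom R S \<and> inj_on h (carrier R)"
proof -
  have inf: "infinite (UNIV :: ('a + nat) set set)"
    using infinite_UNIV_plus_nat Finite_Set.finite_set by blast
  obtain a where R: "flag_ring R a l"
    using artinian_local_ring.exists_strict_flag[OF assms] by blast
  interpret R: flag_ring R a l by (rule R)
  obtain M :: "('a list \<Rightarrow> 'a) set ring" and \<iota>0 where
    M: "flag_ring M (\<iota>0 \<circ> a) l" "\<iota>0 \<in> ring_hom R M" "inj_on \<iota>0 (carrier R)"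
      "|carrier M| \<le>o |UNIV :: ('a list \<Rightarrow> 'a) set|"
    and large: "infinite (carrier R) \<Longrightarrow> \<exists>F. \<forall>Y\<in>Pow (carrier R). F Y \<in> carrier M \<and>
       (\<forall>Z\<in>Pow (carrier R). Y \<noteq> Z \<longrightarrow> F Y \<ominus>\<^bsub>M\<^esub> F Z \<in> Units M)"
    using R.large_residue_extension by blast
  interpret M: flag_ring M "\<iota>0 \<circ> a" l by (rule M(1))
  have small: "|carrier M| \<le>o |UNIV :: ('a + nat) set set|"
    using M(4) card_functions_on_lists by (rule ordLeq_transitive)
  obtain S :: "('a + nat) set ring"
    and L :: "((('a list \<Rightarrow> 'a) set set list \<times> nat) multiset \<Rightarrow> ('a list \<Rightarrow> 'a) set set) ring" and \<iota>1 \<psi> where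
    S: "flag_ring S (\<iota>1 \<circ> (\<iota>0 \<circ> a)) l" "\<iota>1 \<in> ring_hom M S" "inj_on \<iota>1 (carrier M)"
    "algebraically_closed L" "\<psi> \<in> ring_hom S L" "\<psi> ` carrier S = carrier L"
    by (rule algebraically_closed_residue_extension[OF M(1) small inf])
  interpret S: flag_ring S "\<iota>1 \<circ> (\<iota>0 \<circ> a)" l by (rule S(1))
  interpret L: algebraically_closed L by (rule S(4))
  have \<psi>1: "\<psi> \<circ> \<iota>1 \<in> ring_hom M L" using S(2,5) by (rule ring_hom_trans)
  interpret p: ring_hom_ring M L "\<psi> \<circ> \<iota>1"
    using \<psi>1 by (intro ring_hom_ringI2 M.ring_axioms L.ring_axioms)
  \<comment> \<open>A finite R is smaller than the infinite field L. Otherwise the elements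
    \<open>F Y\<close> of M differ by units, hence have distinct residues in L, and R is strictly
    smaller than its power set.\<close>
  have card: "\<not> |carrier L| \<le>o |carrier R|"
  proof (cases "finite (carrier R)")
    case True
    then show ?thesis using L.infinite_carrier card_of_ordLeq_finite by blast
  next
    case False
    then obtain F where F: "\<And>Y. Y \<subseteq> carrier R \<Longrightarrow> F Y \<in> carrier M"
      "\<And>Y Z. Y \<subseteq> carrier R \<Longrightarrow> Z \<subseteq> carrier R \<Longrightarrow> Y \<noteq> Z \<Longrightarrow> F Y \<ominus>\<^bsub>M\<^esub> F Z \<in> Units M"
      using large by (metis PowI)
    let ?f = "(\<psi> \<circ> \<iota>1) \<circ> F"
    have "inj_on ?f (Pow (carrier R))"
    proof (rule inj_onI, rule ccontr)
      fix Y Z assume YZ: "Y \<in> Pow (carrier R)" "Z \<in> Pow (carrier R)" "?f Y = ?f Z" "Y \<noteq> Z"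
      then have u: "F Y \<ominus>\<^bsub>M\<^esub> F Z \<in> Units M" and c: "F Y \<in> carrier M" "F Z \<in> carrier M" using F by auto
      have "(\<psi> \<circ> \<iota>1) (F Y \<ominus>\<^bsub>M\<^esub> F Z) = (\<psi> \<circ> \<iota>1) (F Y) \<ominus>\<^bsub>L\<^esub> (\<psi> \<circ> \<iota>1) (F Z)"
        unfolding a_minus_def using c p.hom_add[of "F Y" "\<ominus>\<^bsub>M\<^esub> F Z"] p.hom_a_inv[of "F Z"] by simp
      also have "\<dots> = \<zero>\<^bsub>L\<^esub>" using YZ(3) p.hom_closed[OF c(2)] by (simp add: a_minus_def L.r_neg)
      finally show False using M.hom_field_eq_zero_iff[OF \<psi>1 L.field_axioms] u by blast
    qed
    moreover have "?f ` Pow (carrier R) \<subseteq> carrier L" using F(1) p.hom_closed by (auto simp del: o_apply simp: o_apply[of _ F])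
    ultimately have "|Pow (carrier R)| \<le>o |carrier L|" using card_of_ordLeq by blast
    then have "|carrier R| <o |carrier L|" using card_of_Pow by (rule ordLess_ordLeq_trans[rotated])
    then show ?thesis by (simp add: not_ordLeq_iff_ordLess)
  qed
  have h: "\<iota>1 \<circ> \<iota>0 \<in> ring_hom R S" using M(2) S(2) by (rule ring_hom_trans)
  have hi: "inj_on (\<iota>1 \<circ> \<iota>0) (carrier R)"
    using M(3) S(3) ring_hom_closed[OF M(2)] by (intro comp_inj_on) (auto intro: inj_on_subset)
  obtain T0 :: "('a + nat) set set ring" and b s \<psi>' h' where
    T0: "|carrier T0| \<le>o |carrier S|" "flag_ring T0 b l" "socle_generator T0 s"
    "\<psi>' \<in> ring_hom T0 L" "\<psi>' ` carrier T0 = carrier L" "h' \<in> ring_hom R T0" "inj_on h' (carrier R)"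
    using S.gorenstein_quotient[OF L.field_axioms S(5,6) R.ring_axioms R.one_not_zero h hi card] by blast
  interpret T0: flag_ring T0 b l by (rule T0(2))
  \<comment> \<open>The quotient may be too short. Its true length is k, and the missing
    \<open>l - k\<close> is made up by an induction that raises the length by one each time.\<close>
  obtain k where k: "ring_length T0 = enat k" "k \<le> l" using T0.ring_length_le by (cases "ring_length T0") auto
  obtain c where "flag_ring T0 c k" using T0.strict_flag_of_length[OF k(1)] by blast
  then have cov0: "gorenstein_cover R L T0 k" unfolding gorenstein_cover_def using T0 k(1) by blast
  obtain g :: "_ \<Rightarrow> ('a + nat) set" where g: "inj_on g (carrier T0)"
    using T0(1) card_of_ordLeq by metis
  have "\<exists>T :: ('a + nat) set ring. gorenstein_cover R L T (k + n)" for n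
  proof (induction n)
    case 0
    then show ?case using gorenstein_cover_transport[OF cov0 g] by auto
  next
    case (Suc n)
    then show ?case using gorenstein_cover_Suc[OF inf L.field_axioms] by auto
  qed
  from this[of "l - k"] obtain T :: "('a + nat) set ring" where "gorenstein_cover R L T l" using k(2) by auto
  then obtain b s \<psi> h where T: "flag_ring T b l" "ring_length T = enat l" "socle_generator T s"
    "\<psi> \<in> ring_hom T L" "\<psi> ` carrier T = carrier L" "h \<in> ring_hom R T" "inj_on h (carrier R)"
    unfolding gorenstein_cover_def by blast
  then show ?thesis
    using flag_ring.socle_generator_imp_gorenstein[OF T(1,3)]
      flag_ring.residue_field_algebraically_closed[OF T(1) S(4) T(4,5)] by blast
qed

end
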